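(* Let $(\Sigma_P,\theta,\mu)$ be a Markov shift over a finite alphabet. Let $x=(x_1,x_2,\dots)\in\Sigma_P$ be a periodic point of prime period $p$ such that $(x_1,\dots,x_p)$ is a reduced word and the local escape rate $\rho(x,\mathbbm{1})$ exists. Let $A_\nu=[x_1,\dots,x_{\nu p}]$ and $\mu_\nu=\mu(A_\nu)$ for $\nu\in\mathbb{N}$. Let $\varphi$ be a ceiling function that is a cylinder function. Then, as $\nu\to\infty$, \[\rho(A_\nu,\varphi)=\frac{1-c_o}{\mu(\varphi)}\mu_\nu+\Big(\frac{1-c_o}{\mu(\varphi)}\Big)^2S_p\varphi(x)\,\nu\,\mu_\nu^2+o(\nu\mu_\nu^2),\] where $c_o=p_{x_1,x_2}\cdots p_{x_p,x_{p+1}}$.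
   Context: Markov shift: $P=(p_{a,b})$ non-negative irreducible row-stochastic on a finite set $S$, $\Sigma_P=\{y\in S^{\mathbb{N}}:p_{y_i,y_{i+1}}>0\ \forall i\}$, $\theta$ the shift, $\pi$ the positive stationary probability vector, $\mu([a_1,\dots,a_n])=\pi_{a_1}\prod_{i<n}p_{a_i,a_{i+1}}$; metric $d(y,y')=e^{-\beta|y\wedge y'|}$ for some $\beta>0$ ($|y\wedge y'|$ the length of the common prefix). A word $(a_1,\dots,a_m)$ is reduced if there is $a_m'\ne a_m$ with $(a_1,\dots,a_{m-1},a_m')$ admissible. A cylinder function is a function constant on each $n$-cylinder for some $n$; a ceiling function is a measurable $\varphi$ with $\inf\varphi>0$; $\mu(\varphi)=\int\varphi\,d\mu$; $S_j\varphi=\sum_{i<j}\varphi\circ\theta^i$. Special flow: $N_t(y)=\min\{j\ge0:S_j\varphi(y)>t\}$, $\overline{X}=\{(y,s):0\le s<\varphi(y)\}$ with $\overline{\mu}$ the restriction of $\mu\otimes$Lebesgue, $\Phi_t(y,s)=(y,s+t)$ if $t<\varphi(y)-s$, else $(\theta^{N-1}y,s+t-S_{N-1}\varphi(y))$, $N=N_{s+t}(y)$. For a hole $A$ (measurable, $\bigcup_j\theta^{-j}A=\Sigma_P$ a.e.), $\rho(A,\varphi)=\lim_{t\to\infty}-\frac1t\log\overline{\mu}(\{(y,s):\forall\tau\in[0,t]:\Phi_\tau(y,s)\notin A\times\mathbb{R}\})$; the local escape rate is $\rho(x,\varphi)=\lim_{r\to0}\rho(B_r(x),\varphi)/\mu(B_r(x))$,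 and $\mathbbm{1}$ is the constant function $1$. *)

theory Defs
  imports "HOL-Probability.Probability" "HOL-Library.Landau_Symbols"
begin

text \<open>Conventions: sequences are 0-indexed, y = (y 0, y 1, ...) stands for (y_1, y_2, ...).
  The alphabet S is a finite type 'a.\<close>

type_synonym 'a seq = "nat \<Rightarrow> 'a"

fun mpow :: "('a::finite \<Rightarrow> 'a \<Rightarrow> real) \<Rightarrow> nat \<Rightarrow> 'a \<Rightarrow> 'a \<Rightarrow> real" where
  "mpow P 0 a b = (if a = b then 1 else 0)"
| "mpow P (Suc n) a b = (\<Sum>c\<in>UNIV. mpow P n a c * P c b)"

definition stochastic_irreducible :: "('a::finite \<Rightarrow> 'a \<Rightarrow> real) \<Rightarrow> bool" where
  "stochastic_irreducible P \<longleftrightarrow>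
     (\<forall>a b. P a b \<ge> 0) \<and> (\<forall>a. (\<Sum>b\<in>UNIV. P a b) = 1) \<and>
     (\<forall>a b. \<exists>n>0. mpow P n a b > 0)"

definition stationary_vector :: "('a::finite \<Rightarrow> 'a \<Rightarrow> real) \<Rightarrow> ('a \<Rightarrow> real) \<Rightarrow> bool" where
  "stationary_vector P \<pi> \<longleftrightarrow>
     (\<forall>a. \<pi> a > 0) \<and> (\<Sum>a\<in>UNIV. \<pi> a) = 1 \<and> (\<forall>b. (\<Sum>a\<in>UNIV. \<pi> a * P a b) = \<pi> b)"

definition Sigma_P :: "('a \<Rightarrow> 'a \<Rightarrow> real) \<Rightarrow> 'a seq set" where
  "Sigma_P P = {y. \<forall>i. P (y i) (y (Suc i)) > 0}"

definition shiftn :: "nat \<Rightarrow> 'a seq \<Rightarrow> 'a seq" where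
  "shiftn n y = (\<lambda>i. y (i + n))"

text \<open>mu is the Markov measure on the full sequence space (product of discrete sigma algebras),
  determined by its values on cylinders; it is concentrated on Sigma_P.\<close>
definition markov_measure :: "('a::finite \<Rightarrow> 'a \<Rightarrow> real) \<Rightarrow> ('a \<Rightarrow> real) \<Rightarrow> 'a seq measure \<Rightarrow> bool" where
  "markov_measure P \<pi> \<mu> \<longleftrightarrow>
     sets \<mu> = sets (Pi\<^sub>M UNIV (\<lambda>_. count_space (UNIV :: 'a set))) \<and>
     (\<forall>n w. n \<ge> 1 \<longrightarrow> emeasure \<mu> {y. \<forall>i<n. y i = w i}
                 = ennreal (\<pi> (w 0) * (\<Prod>i<n - 1. P (w i) (w (Suc i)))))"

definition cyl :: "('a \<Rightarrow> 'a \<Rightarrow> real) \<Rightarrow> 'a seq \<Rightarrow> nat \<Rightarrow> 'a seq set" where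
  "cyl P w n = {y \<in> Sigma_P P. \<forall>i<n. y i = w i}"

definition admissible_word :: "('a \<Rightarrow> 'a \<Rightarrow> real) \<Rightarrow> (nat \<Rightarrow> 'a) \<Rightarrow> nat \<Rightarrow> bool" where
  "admissible_word P w m \<longleftrightarrow> (\<forall>i. Suc i < m \<longrightarrow> P (w i) (w (Suc i)) > 0)"

definition reduced_word :: "('a \<Rightarrow> 'a \<Rightarrow> real) \<Rightarrow> (nat \<Rightarrow> 'a) \<Rightarrow> nat \<Rightarrow> bool" where
  "reduced_word P w m \<longleftrightarrow> m \<ge> 1 \<and>
     (\<exists>a'. a' \<noteq> w (m - 1) \<and> admissible_word P (w(m - 1 := a')) m)"

definition seq_dist :: "real \<Rightarrow> 'a seq \<Rightarrow> 'a seq \<Rightarrow> real" where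
  "seq_dist \<beta> y y' = (if y = y' then 0 else exp (- \<beta> * real (LEAST n. y n \<noteq> y' n)))"

definition seq_ball :: "('a \<Rightarrow> 'a \<Rightarrow> real) \<Rightarrow> real \<Rightarrow> 'a seq \<Rightarrow> real \<Rightarrow> 'a seq set" where
  "seq_ball P \<beta> x r = {y \<in> Sigma_P P. seq_dist \<beta> x y < r}"

definition cylinder_function :: "('a seq \<Rightarrow> real) \<Rightarrow> bool" where
  "cylinder_function f \<longleftrightarrow> (\<exists>n. \<forall>y y'. (\<forall>i<n. y i = y' i) \<longrightarrow> f y = f y')"

definition ceiling_function :: "('a \<Rightarrow> 'a \<Rightarrow> real) \<Rightarrow> 'a seq measure \<Rightarrow> ('a seq \<Rightarrow> real) \<Rightarrow> bool" where
  "ceiling_function P \<mu> \<phi> \<longleftrightarrow> \<phi> \<in> borel_measurable \<mu> \<and> (INF y\<in>Sigma_P P. \<phi> y) > 0"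

definition birkhoff_sum :: "('a seq \<Rightarrow> real) \<Rightarrow> nat \<Rightarrow> 'a seq \<Rightarrow> real" where
  "birkhoff_sum \<phi> j y = (\<Sum>i<j. \<phi> (shiftn i y))"

definition lap_count :: "('a seq \<Rightarrow> real) \<Rightarrow> real \<Rightarrow> 'a seq \<Rightarrow> nat" where
  "lap_count \<phi> t y = (LEAST j. birkhoff_sum \<phi> j y > t)"

definition special_flow :: "('a seq \<Rightarrow> real) \<Rightarrow> real \<Rightarrow> 'a seq \<times> real \<Rightarrow> 'a seq \<times> real" where
  "special_flow \<phi> t ys = (let (y, s) = ys in
     if t < \<phi> y - s then (y, s + t)
     else (let N = lap_count \<phi> (s + t) y in
           (shiftn (N - 1) y, s + t - birkhoff_sum \<phi> (N - 1) y)))"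

definition survivor_set :: "('a \<Rightarrow> 'a \<Rightarrow> real) \<Rightarrow> ('a seq \<Rightarrow> real) \<Rightarrow> 'a seq set \<Rightarrow> real \<Rightarrow> ('a seq \<times> real) set" where
  "survivor_set P \<phi> A t = {(y, s). y \<in> Sigma_P P \<and> 0 \<le> s \<and> s < \<phi> y \<and>
       (\<forall>\<tau>\<in>{0..t}. fst (special_flow \<phi> \<tau> (y, s)) \<notin> A)}"

text \<open>rho(A, phi) exists and equals L (mu-bar is the restriction of mu x Lebesgue to X-bar)\<close>
definition has_escape_rate :: "('a \<Rightarrow> 'a \<Rightarrow> real) \<Rightarrow> 'a seq measure \<Rightarrow> 'a seq set \<Rightarrow> ('a seq \<Rightarrow> real) \<Rightarrow> real \<Rightarrow> bool" where
  "has_escape_rate P \<mu> A \<phi> L \<longleftrightarrow>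
     ((\<lambda>t. - ln (measure (\<mu> \<Otimes>\<^sub>M lborel) (survivor_set P \<phi> A t)) / t) \<longlongrightarrow> L) at_top"

definition local_escape_rate_exists :: "('a \<Rightarrow> 'a \<Rightarrow> real) \<Rightarrow> 'a seq measure \<Rightarrow> real \<Rightarrow> 'a seq \<Rightarrow> bool" where
  "local_escape_rate_exists P \<mu> \<beta> x \<longleftrightarrow>
     (\<exists>R L. (\<forall>\<^sub>F r in at_right 0. has_escape_rate P \<mu> (seq_ball P \<beta> x r) (\<lambda>_. 1) (R r)) \<and>
            ((\<lambda>r. R r / measure \<mu> (seq_ball P \<beta> x r)) \<longlongrightarrow> L) (at_right 0))"

end

theory Submission
  imports Defs
begin

text \<open>
  For a parameter \<open>z\<close>, let \<open>R z\<close> be the expectation of \<open>exp (z * S)\<close>, where \<open>S\<close> is the time the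
  flow needs to return from a fixed cylinder \<open>W\<close> around the periodic point \<open>x\<close> to \<open>W\<close>, and let \<open>H z y\<close> be
  the same expectation for the time to reach \<open>W\<close> from \<open>y\<close>. Stationarity of the Markov measure gives
  \<open>R z = 1 + z * m / \<mu>(W) + O(z\<^sup>2)\<close> with \<open>m\<close> the integral of \<open>\<phi>\<close>.

  Every visit to \<open>W\<close> continues to the hole \<open>A\<close> with probability \<open>r = c ^ J\<close>. Hence
  \<open>r * exp (z * S_k) * H z\<close>, minus \<open>R z - 1\<close> times the sum over \<open>i < k\<close> of \<open>exp (z * S_i)\<close> weighted by the
  conditional probability that \<open>A\<close> is hit at time \<open>i\<close>, is a martingale. Its value on the hole is
  \<open>b ^ J - (R z - 1) * (1 + b + \<dots> + b ^ (J - 1))\<close> with \<open>b = c * exp (z * S_p \<phi> x)\<close>. If \<open>z\<close> is a root of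
  this expression, the martingale gives a positive function \<open>h\<close> with \<open>h = exp (z * \<phi>) E[h \<circ> \<theta>]\<close> off the
  hole and \<open>h = 0\<close> on it, which forces the survival probability to be comparable to \<open>exp (- z * t)\<close>. The
  escape rate is therefore a root of \<open>R z - 1 = b ^ J * (R z - b)\<close>, and expanding this equation
  yields the claim.
\<close>

section \<open>Functions of finitely many letters and the Markov measure\<close>

text \<open>The cylinder \<open>W\<close> stays fixed while the hole shrinks. Its renewal function
  \<open>R\<close> is therefore a single function with constants uniform in \<nu>, and \<nu> enters
  the escape equation only through the exponent \<open>J = \<nu> - n\<^sub>0\<close>. All functions
  involved read finitely many letters, so a conditional expectation over one step is the finite sum
  \<open>push\<close>. The obstacle is positivity of \<open>h\<close> off the hole, because a
  correction is subtracted there. The conditional hitting probabilities then add up to at most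
  \<open>q / (1 - c)\<close>, where \<open>q\<close> is the transition probability into the last
  letter of the period; at the root, \<open>R z - 1\<close> is asymptotic to
  \<open>(1 - c) * r\<close>. What is left is about \<open>(1 - q) * r\<close>, and
  \<open>q < 1\<close> is what reducedness supplies. The second-order term has one source: in
  \<open>b ^ J = r * exp (J * z * S_p \<phi> x)\<close> the exponent is of order \<nu> times
  \<open>z\<close>, whereas all other errors are of order \<open>z\<^sup>2\<close> without a factor
  \<nu>.\<close>

definition word_fun :: "nat \<Rightarrow> ('a seq \<Rightarrow> 'b) \<Rightarrow> bool" where
  "word_fun n f \<longleftrightarrow> (\<forall>y y'. (\<forall>i<n. y i = y' i) \<longrightarrow> f y = f y')"

lemma word_funI: "(\<And>y y'. (\<And>i. i < n \<Longrightarrow> y i = y' i) \<Longrightarrow> f y = f y') \<Longrightarrow> word_fun n f"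
  unfolding word_fun_def by blast

lemma word_funD: "word_fun n f \<Longrightarrow> (\<And>i. i < n \<Longrightarrow> y i = y' i) \<Longrightarrow> f y = f y'"
  unfolding word_fun_def by blast

lemma word_fun_mono: "word_fun n f \<Longrightarrow> n \<le> m \<Longrightarrow> word_fun m f"
  unfolding word_fun_def by (meson less_le_trans)

lemma word_fun_comp: "word_fun n f \<Longrightarrow> word_fun n (\<lambda>y. g (f y))"
  unfolding word_fun_def by metis

lemma word_fun_comp2: "word_fun n f \<Longrightarrow> word_fun n f' \<Longrightarrow> word_fun n (\<lambda>y. g (f y) (f' y))"
  unfolding word_fun_def by metis

lemma word_fun_const: "word_fun n (\<lambda>_. k)"
  unfolding word_fun_def by simp

lemma word_fun_sum: "(\<And>i. i \<in> I \<Longrightarrow> word_fun n (f i)) \<Longrightarrow> word_fun n (\<lambda>y. \<Sum>i\<in>I. f i y)"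
  unfolding word_fun_def by (auto intro!: sum.cong)

lemma word_fun_shiftn: "word_fun n f \<Longrightarrow> word_fun (n + k) (\<lambda>y. f (shiftn k y))"
  unfolding word_fun_def shiftn_def by simp

text \<open>Extensional representatives: from position \<open>n\<close> on the value is
  \<open>undefined\<close>, so the set is finite, yet each word is itself a sequence to which
  functions can be applied.\<close>

abbreviation words :: "nat \<Rightarrow> 'a seq set" where
  "words n \<equiv> PiE {..<n} (\<lambda>_. UNIV)"

lemma finite_words: "finite (words n :: ('a::finite) seq set)"
  by (simp add: finite_PiE)

lemma finite_words_Collect: "finite {v \<in> words n :: ('a::finite) seq set. Q v}"
  by (rule finite_subset[OF _ finite_words]) blast

lemma word_fun_restrict: "word_fun n f \<Longrightarrow> f (restrict y {..<n}) = f y"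
  by (erule word_funD) simp

lemma range_word_fun: "word_fun n f \<Longrightarrow> range f = f ` words n"
proof -
  assume f: "word_fun n f"
  have "f y \<in> f ` words n" for y
    using word_fun_restrict[OF f, of y] by (metis image_eqI restrict_PiE_iff UNIV_I)
  then show ?thesis by blast
qed

lemma finite_range_word_fun: "word_fun n f \<Longrightarrow> finite (range (f :: ('a::finite) seq \<Rightarrow> 'b))"
  by (simp add: range_word_fun finite_words)

lemma word_fun_bounded:
  fixes f :: "('a::finite) seq \<Rightarrow> real"
  assumes "word_fun n f"
  obtains B where "\<And>y. \<bar>f y\<bar> \<le> B" "B > 0"
proof -
  have "finite (range (\<lambda>y. \<bar>f y\<bar>))"
    using finite_range_word_fun[OF word_fun_comp[OF assms, of abs]] .
  then have "\<bar>f y\<bar> \<le> max 1 (Max (range (\<lambda>y. \<bar>f y\<bar>)))" for y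
    by (simp add: Max_ge le_max_iff_disj)
  then show thesis by (intro that[of "max 1 (Max (range (\<lambda>y. \<bar>f y\<bar>)))"]) auto
qed

text \<open>Not intersected with \<open>Sigma_P P\<close>, in contrast to \<open>cyl\<close>: these
  are the sets on which \<open>markov_measure\<close> prescribes values, and the difference is a
  null set.\<close>

definition prefix_set :: "'a seq \<Rightarrow> nat \<Rightarrow> 'a seq set" where
  "prefix_set w n = {y. \<forall>i<n. y i = w i}"

lemma mem_prefix_set: "y \<in> prefix_set w n \<longleftrightarrow> (\<forall>i<n. y i = w i)"
  by (simp add: prefix_set_def)

lemma word_fun_mem_prefix_set: "word_fun n (\<lambda>y. y \<in> prefix_set w n)"
  by (rule word_funI) (auto simp: mem_prefix_set)

lemma UN_prefix_set_words: "(\<Union>v\<in>words n. prefix_set v n) = UNIV"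
proof -
  have "y \<in> prefix_set (restrict y {..<n}) n" "restrict y {..<n} \<in> words n" for y
    by (auto simp: mem_prefix_set)
  then have "y \<in> (\<Union>v\<in>words n. prefix_set v n)" for y by (rule UN_I[rotated])
  then show ?thesis by (intro equalityI subset_UNIV subsetI)
qed

lemma prefix_set_words_eq_iff:
  "v \<in> words n \<Longrightarrow> y \<in> prefix_set v n \<longleftrightarrow> v = restrict y {..<n}"
  by (auto simp: mem_prefix_set fun_eq_iff PiE_def extensional_def)

text \<open>Expansion over the finitely many cylinders of length \<open>n\<close>; it yields
  measurability of word functions and reduces their integrals to finite sums of weights.\<close>

lemma word_fun_eq_sum:
  fixes f :: "('a::finite) seq \<Rightarrow> real"
  assumes "word_fun n f"
  shows "f y = (\<Sum>v\<in>words n. f v * indicator (prefix_set v n) y)"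
proof -
  have "(\<Sum>v\<in>words n. f v * indicator (prefix_set v n) y)
        = (\<Sum>v\<in>words n. if v = restrict y {..<n} then f v else 0)"
    by (intro sum.cong) (auto simp: indicator_def prefix_set_words_eq_iff)
  also have "\<dots> = f (restrict y {..<n})"
    by (simp add: finite_words)
  finally show ?thesis using word_fun_restrict[OF assms] by simp
qed

lemma prefix_set_eq_UN_Suc:
  "prefix_set w n = (\<Union>b. prefix_set (w(n := b)) (Suc n))"
  by (auto simp: prefix_set_def less_Suc_eq)

lemma prefix_set_Suc_disjoint:
  "a \<noteq> b \<Longrightarrow> prefix_set (w(n := a)) (Suc n) \<inter> prefix_set (w(n := b)) (Suc n) = {}"
  by (auto simp: prefix_set_def)

section \<open>Measurability of cylinders, shifts and word functions\<close>

abbreviation seq_algebra :: "'a seq measure" where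
  "seq_algebra \<equiv> PiM UNIV (\<lambda>_. count_space UNIV)"

lemma shiftn_0 [simp]: "shiftn 0 y = y"
  by (simp add: shiftn_def)

lemma shiftn_shiftn [simp]: "shiftn i (shiftn j y) = shiftn (i + j) y"
  by (simp add: shiftn_def add.assoc)

lemma prefix_set_measurable: "prefix_set w n \<in> sets (seq_algebra :: ('a::finite) seq measure)"
proof -
  have "prefix_set w n = {y \<in> space seq_algebra. \<forall>i<n. y i = w i}"
    by (auto simp: prefix_set_def space_PiM)
  also have "\<dots> \<in> sets seq_algebra"
    by measurable
  finally show ?thesis .
qed

lemma shiftn_measurable [measurable]: "shiftn j \<in> measurable (seq_algebra :: ('a::finite) seq measure) seq_algebra"
  unfolding shiftn_def by (rule measurable_PiM_single') (auto simp: space_PiM)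

lemma Sigma_P_measurable: "Sigma_P P \<in> sets (seq_algebra :: ('a::finite) seq measure)"
proof -
  have "Sigma_P P = (\<Inter>i. \<Union>v\<in>{v \<in> words (Suc (Suc i)). P (v i) (v (Suc i)) > 0}. prefix_set v (Suc (Suc i)))" (is "_ = ?R")
  proof (intro set_eqI iffI INT_I)
    fix y i assume "y \<in> Sigma_P P"
    then show "y \<in> (\<Union>v\<in>{v \<in> words (Suc (Suc i)). P (v i) (v (Suc i)) > 0}. prefix_set v (Suc (Suc i)))"
      by (intro UN_I[of "restrict y {..<Suc (Suc i)}"]) (auto simp: Sigma_P_def mem_prefix_set)
  next
    fix y assume "y \<in> ?R"
    then have "\<exists>v. P (v i) (v (Suc i)) > 0 \<and> (\<forall>j<Suc (Suc i). y j = v j)" for i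
      by (auto simp: mem_prefix_set)
    then have "P (y i) (y (Suc i)) > 0" for i by (metis lessI less_SucI)
    then show "y \<in> Sigma_P P" by (simp add: Sigma_P_def)
  qed
  also have "\<dots> \<in> sets seq_algebra"
    by (intro sets.countable_INT' sets.finite_UN)
       (auto simp: prefix_set_measurable intro: finite_words_Collect)
  finally show ?thesis .
qed

lemma word_fun_measurable:
  fixes f :: "('a::finite) seq \<Rightarrow> real"
  assumes "word_fun n f"
  shows "f \<in> borel_measurable seq_algebra"
proof -
  have "(\<lambda>y. \<Sum>v\<in>words n. f v * indicator (prefix_set v n) y) \<in> borel_measurable seq_algebra"
    by (intro borel_measurable_sum borel_measurable_times borel_measurable_const
        borel_measurable_indicator prefix_set_measurable)
  also have "(\<lambda>y. \<Sum>v\<in>words n. f v * indicator (prefix_set v n) y) = f"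
    by (rule ext) (rule word_fun_eq_sum[OF assms, symmetric])
  finally show ?thesis .
qed

text \<open>The Markov transition operator on a window of \<open>n\<close> letters. The new letter
  \<open>b\<close> is drawn from the row of the last letter and the shift drops the first one, so
  for \<open>word_fun n f\<close> this is the conditional expectation of \<open>f\<close> after one
  shift, given the first \<open>n\<close> letters.\<close>

definition push :: "('a::finite \<Rightarrow> 'a \<Rightarrow> real) \<Rightarrow> nat \<Rightarrow> ('a seq \<Rightarrow> real) \<Rightarrow> 'a seq \<Rightarrow> real" where
  "push P n f y = (\<Sum>b\<in>UNIV. P (y (n - 1)) b * f (shiftn 1 (y(n := b))))"

lemma push_add: "push P n (\<lambda>y. f y + g y) y = push P n f y + push P n g y"
  by (simp add: push_def sum.distrib algebra_simps)

lemma push_diff: "push P n (\<lambda>y. f y - g y) y = push P n f y - push P n g y"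
  by (simp add: push_def sum_subtractf algebra_simps)

lemma push_cmult: "push P n (\<lambda>y. k * f y) y = k * push P n f y"
  by (simp add: push_def sum_distrib_left algebra_simps)

lemma push_sum: "push P n (\<lambda>y. \<Sum>i\<in>I. f i y) y = (\<Sum>i\<in>I. push P n (f i) y)"
  by (simp add: push_def sum_distrib_left sum.swap[of _ I])

lemma word_fun_push: "n \<ge> 1 \<Longrightarrow> word_fun n f \<Longrightarrow> word_fun n (push P n f)"
proof (rule word_funI)
  fix y y' :: "'a seq"
  assume n: "n \<ge> 1" and f: "word_fun n f" and e: "\<And>i. i < n \<Longrightarrow> y i = y' i"
  have "f (shiftn 1 (y(n := b))) = f (shiftn 1 (y'(n := b)))" for b
    by (rule word_funD[OF f]) (use e in \<open>auto simp: shiftn_def\<close>)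
  then show "push P n f y = push P n f y'"
    using e[of "n - 1"] n by (simp add: push_def)
qed

section \<open>The Markov measure and its shift invariance\<close>

locale markov_shift =
  fixes P :: "'a::finite \<Rightarrow> 'a \<Rightarrow> real" and \<pi> :: "'a \<Rightarrow> real" and \<mu> :: "'a seq measure"
  assumes irreducible: "stochastic_irreducible P"
    and stationary: "stationary_vector P \<pi>"
    and markov: "markov_measure P \<pi> \<mu>"
begin

lemma P_nonneg [simp]: "P a b \<ge> 0"
  using irreducible by (simp add: stochastic_irreducible_def)

lemma P_row_sum: "(\<Sum>b\<in>UNIV. P a b) = 1"
  using irreducible by (simp add: stochastic_irreducible_def)

lemma P_le_1: "P a b \<le> 1"
proof -
  have "P a b \<le> (\<Sum>b\<in>UNIV. P a b)" by (rule member_le_sum) auto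
  then show ?thesis by (simp add: P_row_sum)
qed

lemma P_less_1: "P a b' > 0 \<Longrightarrow> b' \<noteq> b \<Longrightarrow> P a b < 1"
proof -
  assume "P a b' > 0" "b' \<noteq> b"
  have "(\<Sum>b\<in>{b, b'}. P a b) \<le> (\<Sum>b\<in>UNIV. P a b)" by (rule sum_mono2) auto
  then show ?thesis using \<open>P a b' > 0\<close> \<open>b' \<noteq> b\<close> by (simp add: P_row_sum)
qed

lemma \<pi>_pos: "\<pi> a > 0"
  using stationary by (simp add: stationary_vector_def)

lemma \<pi>_P: "(\<Sum>a\<in>UNIV. \<pi> a * P a b) = \<pi> b"
  using stationary by (simp add: stationary_vector_def)

lemma \<pi>_sum: "(\<Sum>a\<in>UNIV. \<pi> a) = 1"
  using stationary by (simp add: stationary_vector_def)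

lemma push_mono: "(\<And>y. f y \<le> g y) \<Longrightarrow> push P n f y \<le> push P n g y"
  unfolding push_def by (intro sum_mono mult_left_mono) auto

lemma push_const: "push P n (\<lambda>_. k) y = k"
  by (simp add: push_def P_row_sum flip: sum_distrib_right)

lemma push_nonneg: "(\<And>y. f y \<ge> 0) \<Longrightarrow> push P n f y \<ge> 0"
  unfolding push_def by (intro sum_nonneg mult_nonneg_nonneg) auto

definition weight :: "'a seq \<Rightarrow> nat \<Rightarrow> real" where
  "weight w n = \<pi> (w 0) * (\<Prod>i<n - 1. P (w i) (w (Suc i)))"

lemma weight_nonneg: "weight w n \<ge> 0"
  unfolding weight_def by (intro mult_nonneg_nonneg prod_nonneg) (auto intro: less_imp_le \<pi>_pos)

lemma sets_\<mu> [measurable_cong]: "sets \<mu> = sets seq_algebra"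
  using markov by (simp add: markov_measure_def)

lemma space_\<mu> [simp]: "space \<mu> = UNIV"
  using sets_eq_imp_space_eq[OF sets_\<mu>] by (simp add: space_PiM)

lemma prefix_set_sets [measurable]: "prefix_set w n \<in> sets \<mu>"
  by (simp add: sets_\<mu> prefix_set_measurable)

lemma Sigma_sets [measurable]: "Sigma_P P \<in> sets \<mu>"
  by (simp add: sets_\<mu> Sigma_P_measurable)

lemma emeasure_prefix: "n \<ge> 1 \<Longrightarrow> emeasure \<mu> (prefix_set w n) = ennreal (weight w n)"
  using markov by (simp add: markov_measure_def prefix_set_def weight_def)

lemma measure_prefix: "n \<ge> 1 \<Longrightarrow> measure \<mu> (prefix_set w n) = weight w n"
  by (simp add: measure_def emeasure_prefix weight_nonneg)

lemma weight_1: "weight w 1 = \<pi> (w 0)"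
  by (simp add: weight_def)

lemma weight_Suc: "n \<ge> 1 \<Longrightarrow> weight (w(n := b)) (Suc n) = weight w n * P (w (n - 1)) b"
proof -
  assume n: "n \<ge> 1"
  then obtain k where k: "n = Suc k" by (cases n) auto
  show ?thesis unfolding k weight_def by simp
qed

text \<open>Total mass is read off from the one-letter cylinders, because cylinder values are
  prescribed for \<open>n \<ge> 1\<close> only.\<close>

sublocale prob_space \<mu>
proof
  have "(\<Union>v. prefix_set (\<lambda>_. v) 1) = (UNIV :: 'a seq set)"
    by (auto simp: prefix_set_def)
  then have "emeasure \<mu> UNIV = emeasure \<mu> (\<Union>v::'a. prefix_set (\<lambda>_. v) 1)" by simp
  also have "\<dots> = (\<Sum>v\<in>UNIV. emeasure \<mu> (prefix_set (\<lambda>_. v) 1))"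
  proof (rule sum_emeasure[symmetric])
    show "disjoint_family (\<lambda>v::'a. prefix_set (\<lambda>_. v) 1)"
      by (auto simp: disjoint_family_on_def prefix_set_def)
  qed (auto intro: prefix_set_sets)
  also have "\<dots> = ennreal (\<Sum>v\<in>UNIV. \<pi> v)"
    by (simp add: emeasure_prefix weight_1[unfolded One_nat_def] sum_ennreal \<pi>_pos less_imp_le)
  finally show "emeasure \<mu> (space \<mu>) = 1" by (simp add: \<pi>_sum)
qed

text \<open>For each \<open>i\<close> the exceptional set is a finite union of cylinders whose
  weight contains a vanishing transition; countably many \<open>i\<close> remain.\<close>

lemma AE_Sigma: "AE y in \<mu>. y \<in> Sigma_P P"
proof -
  have "AE y in \<mu>. P (y i) (y (Suc i)) > 0" for i
  proof (rule AE_I)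
    let ?V = "{v \<in> words (Suc (Suc i)). P (v i) (v (Suc i)) = 0}"
    show "{y \<in> space \<mu>. \<not> P (y i) (y (Suc i)) > 0} \<subseteq> (\<Union>v\<in>?V. prefix_set v (Suc (Suc i)))"
    proof
      fix y assume "y \<in> {y \<in> space \<mu>. \<not> P (y i) (y (Suc i)) > 0}"
      then have y: "P (y i) (y (Suc i)) = 0" using P_nonneg[of "y i" "y (Suc i)"] by auto
      then have "restrict y {..<Suc (Suc i)} \<in> ?V" by auto
      moreover have "y \<in> prefix_set (restrict y {..<Suc (Suc i)}) (Suc (Suc i))"
        by (simp add: mem_prefix_set)
      ultimately show "y \<in> (\<Union>v\<in>?V. prefix_set v (Suc (Suc i)))" by blast
    qed
    show "(\<Union>v\<in>?V. prefix_set v (Suc (Suc i))) \<in> sets \<mu>"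
      by (rule sets.finite_UN[OF finite_words_Collect]) simp
    have "emeasure \<mu> (\<Union>v\<in>?V. prefix_set v (Suc (Suc i))) \<le> (\<Sum>v\<in>?V. emeasure \<mu> (prefix_set v (Suc (Suc i))))"
    proof (rule emeasure_subadditive_finite)
      show "finite ?V" by (rule finite_words_Collect)
      show "(\<lambda>v. prefix_set v (Suc (Suc i))) ` ?V \<subseteq> sets \<mu>" by (intro image_subsetI prefix_set_sets)
    qed
    also have "\<dots> = 0"
      by (intro sum.neutral ballI) (simp add: emeasure_prefix weight_def)
    finally show "emeasure \<mu> (\<Union>v\<in>?V. prefix_set v (Suc (Suc i))) = 0" by simp
  qed
  then show ?thesis by (simp add: Sigma_P_def AE_all_countable)
qed

lemma integrable_word_fun: "word_fun n f \<Longrightarrow> integrable \<mu> (f :: _ \<Rightarrow> real)"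
proof -
  assume f: "word_fun n f"
  obtain B where "\<And>y. \<bar>f y\<bar> \<le> B" using word_fun_bounded[OF f] by blast
  moreover have "f \<in> borel_measurable \<mu>" using word_fun_measurable[OF f] measurable_cong_sets[OF sets_\<mu> refl] by blast
  ultimately show ?thesis by (intro integrable_const_bound[where B = B]) auto
qed

text \<open>Stationarity on a single cylinder. One step can lead into the cylinder of
  \<open>v\<close> only from sequences that read some letter \<open>a\<close> followed by
  \<open>v 0, ..., v (n - 2)\<close>; summing over \<open>a\<close> collapses
  \<open>\<pi> a * P a (v 0)\<close> to \<open>\<pi> (v 0)\<close>.\<close>

lemma integral_push_indicator:
  assumes n: "n \<ge> 2"
  shows "(\<integral>y. push P n (indicator (prefix_set v n)) y \<partial>\<mu>) = weight v n"
proof -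
  \<comment> \<open>\<open>case_nat a v\<close> prepends \<open>a\<close> to \<open>v\<close>; cut
    at length \<open>n\<close> it lacks the last letter of \<open>v\<close>, which is the letter
    supplied by \<open>push\<close>.\<close>
  define A where "A = (\<lambda>a. prefix_set (case_nat a v) n)"
  have v: "push P n (indicator (prefix_set v n)) y
          = (\<Sum>a\<in>UNIV. P (v (n - 2)) (v (n - 1)) * indicator (A a) y)" for y
  proof -
    have mem: "shiftn 1 (y(n := b)) \<in> prefix_set v n \<longleftrightarrow> (\<forall>i<n-1. y (Suc i) = v i) \<and> b = v (n - 1)" for b
    proof
      assume *: "shiftn 1 (y(n := b)) \<in> prefix_set v n"
      show "(\<forall>i<n-1. y (Suc i) = v i) \<and> b = v (n - 1)"
      proof (intro conjI allI impI)
        fix i assume "i < n - 1"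
        then have "shiftn 1 (y(n := b)) i = v i" "Suc i \<noteq> n" using * by (auto simp: mem_prefix_set)
        then show "y (Suc i) = v i" by (simp add: shiftn_def)
      next
        have "shiftn 1 (y(n := b)) (n - 1) = v (n - 1)" using * n by (auto simp: mem_prefix_set)
        then show "b = v (n - 1)" using n by (simp add: shiftn_def)
      qed
    next
      assume *: "(\<forall>i<n-1. y (Suc i) = v i) \<and> b = v (n - 1)"
      then show "shiftn 1 (y(n := b)) \<in> prefix_set v n"
        by (auto simp: mem_prefix_set shiftn_def)
    qed
    have A: "y \<in> A a \<longleftrightarrow> a = y 0 \<and> (\<forall>i<n-1. y (Suc i) = v i)" for a
    proof
      assume *: "y \<in> A a"
      show "a = y 0 \<and> (\<forall>i<n-1. y (Suc i) = v i)"
      proof (intro conjI allI impI)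
        show "a = y 0" using * n by (auto simp: A_def mem_prefix_set)
        fix i assume "i < n - 1"
        then have "Suc i < n" by simp
        then show "y (Suc i) = v i" using * unfolding A_def mem_prefix_set by (metis nat.simps(5))
      qed
    next
      assume "a = y 0 \<and> (\<forall>i<n-1. y (Suc i) = v i)"
      then show "y \<in> A a" by (auto simp: A_def mem_prefix_set split: nat.split)
    qed
    show ?thesis
    proof (cases "\<forall>i<n-1. y (Suc i) = v i")
      case True
      have "push P n (indicator (prefix_set v n)) y = (\<Sum>b\<in>UNIV. if b = v (n - 1) then P (y (n - 1)) b else 0)"
        unfolding push_def by (intro sum.cong refl, unfold indicator_def mem) (use True in auto)
      also have "\<dots> = P (y (n - 1)) (v (n - 1))" by simp
      also have "y (n - 1) = v (n - 2)"
        using True[rule_format, of "n - 2"] n by (simp add: Suc_diff_Suc numeral_2_eq_2)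
      also have "P (v (n - 2)) (v (n - 1)) = (\<Sum>a\<in>UNIV. if a = y 0 then P (v (n - 2)) (v (n - 1)) else 0)" by simp
      also have "\<dots> = (\<Sum>a\<in>UNIV. P (v (n - 2)) (v (n - 1)) * indicator (A a) y)"
        by (intro sum.cong) (auto simp: indicator_def A True)
      finally show ?thesis .
    next
      case False
      then have e: "((\<forall>i<n-1. y (Suc i) = v i) \<and> b = v (n - 1)) = False" "(a = y 0 \<and> (\<forall>i<n-1. y (Suc i) = v i)) = False" for a b
        by blast+
      show ?thesis
        by (simp only: push_def indicator_def mem A e of_bool_eq mult_zero_right sum.neutral_const)
    qed
  qed
  obtain k where k: "n = Suc (Suc k)" using n by (metis add_2_eq_Suc le_Suc_ex)
  have "weight (case_nat a v) n * P (v (n - 2)) (v (n - 1)) = \<pi> a * P a (v 0) * (\<Prod>i<n - 1. P (v i) (v (Suc i)))" for a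
  proof -
    have "weight (case_nat a v) n = \<pi> a * (P a (v 0) * (\<Prod>i<k. P (v i) (v (Suc i))))"
      unfolding weight_def k by (simp add: prod.lessThan_Suc_shift del: prod.lessThan_Suc)
    moreover have "(\<Prod>i<n - 1. P (v i) (v (Suc i))) = (\<Prod>i<k. P (v i) (v (Suc i))) * P (v (n - 2)) (v (n - 1))"
      by (simp add: k)
    ultimately show ?thesis by simp
  qed
  then have "(\<integral>y. push P n (indicator (prefix_set v n)) y \<partial>\<mu>) = (\<Sum>a\<in>UNIV. \<pi> a * P a (v 0) * (\<Prod>i<n - 1. P (v i) (v (Suc i))))"
    unfolding v using n
    by (subst Bochner_Integration.integral_sum)
       (auto simp: A_def measure_prefix emeasure_prefix mult.commute)
  also have "\<dots> = weight v n"
    by (simp add: weight_def \<pi>_P flip: sum_distrib_right)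
  finally show ?thesis .
qed

text \<open>Shift invariance of \<open>\<mu>\<close> in operator form. In the renewal equation it
  makes the integrals of \<open>H\<close> cancel, which leaves the mean return time.\<close>

lemma integral_push:
  assumes n: "n \<ge> 2" and f: "word_fun n f"
  shows "(\<integral>y. push P n f y \<partial>\<mu>) = (\<integral>y. f y \<partial>\<mu>)"
proof -
  have eq: "(\<lambda>y. \<Sum>v\<in>words n. f v * indicator (prefix_set v n) y) = f"
    by (rule ext) (rule word_fun_eq_sum[OF f, symmetric])
  have ind: "word_fun n (indicator (prefix_set v n) :: _ \<Rightarrow> real)" for v
    using word_fun_comp[OF word_fun_mem_prefix_set, of n of_bool v]
    by (simp add: indicator_def[abs_def] of_bool_def)
  have "(\<integral>y. f y \<partial>\<mu>) = (\<integral>y. (\<Sum>v\<in>words n. f v * indicator (prefix_set v n) y) \<partial>\<mu>)"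
    by (simp only: eq)
  also have "\<dots> = (\<Sum>v\<in>words n. f v * weight v n)"
    using n by (subst Bochner_Integration.integral_sum) (auto simp: measure_prefix emeasure_prefix)
  also have "\<dots> = (\<Sum>v\<in>words n. f v * (\<integral>y. push P n (indicator (prefix_set v n)) y \<partial>\<mu>))"
    by (simp add: integral_push_indicator n)
  also have "\<dots> = (\<integral>y. (\<Sum>v\<in>words n. f v * push P n (indicator (prefix_set v n)) y) \<partial>\<mu>)"
  proof (subst Bochner_Integration.integral_sum)
    fix v :: "'a seq"
    have "word_fun n (push P n (indicator (prefix_set v n)))"
      using n by (intro word_fun_push ind) auto
    then show "integrable \<mu> (\<lambda>y. f v * push P n (indicator (prefix_set v n)) y)"
      by (intro integrable_mult_right integrable_word_fun)
  qed simp
  also have "(\<lambda>y. \<Sum>v\<in>words n. f v * push P n (indicator (prefix_set v n)) y) = push P n (\<lambda>y. \<Sum>v\<in>words n. f v * indicator (prefix_set v n) y)"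
    by (simp add: push_sum push_cmult fun_eq_iff)
  also have "\<dots> = push P n f" by (simp only: eq)
  finally show ?thesis by simp
qed

end

section \<open>The renewal function of a cylinder\<close>

lemma exp_minus_1_le: "0 \<le> t \<Longrightarrow> t \<le> 1 \<Longrightarrow> exp t - 1 \<le> 2 * (t::real)"
proof -
  assume t: "0 \<le> t" "t \<le> 1"
  have "t\<^sup>2 \<le> t * 1" unfolding power2_eq_square using t by (intro mult_left_mono) auto
  then show ?thesis using exp_bound[OF t] by simp
qed

text \<open>The lower bound is demanded for every sequence, not only on \<open>Sigma_P P\<close>, so
  that no estimate carries a membership condition; a ceiling is brought into this form by truncation
  at its infimum. \<open>N \<ge> 2\<close> is the condition of \<open>integral_push\<close>.\<close>

locale renewal = markov_shift P \<pi> \<mu>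
  for P :: "'a::finite \<Rightarrow> 'a \<Rightarrow> real" and \<pi> :: "'a \<Rightarrow> real" and \<mu> :: "'a seq measure" +
  fixes \<phi> :: "'a seq \<Rightarrow> real" and \<phi>\<^sub>0 :: real and x :: "'a seq" and N :: nat
  assumes N: "N \<ge> 2" and \<phi>: "word_fun N \<phi>" and \<phi>_ge: "\<And>y. \<phi> y \<ge> \<phi>\<^sub>0" and \<phi>\<^sub>0: "\<phi>\<^sub>0 > 0"
    and x: "x \<in> Sigma_P P"
begin

lemma x_step: "P (x i) (x (Suc i)) > 0"
  using x by (simp add: Sigma_P_def)

lemma \<phi>_pos: "\<phi> y > 0"
  using \<phi>_ge[of y] \<phi>\<^sub>0 by simp

lemma weight_x_pos: "weight x n > 0"
  unfolding weight_def by (intro mult_pos_pos \<pi>_pos prod_pos) (simp add: x_step)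

definition W :: "'a seq set" where "W = prefix_set x N"

text \<open>One step of the chain killed on entering \<open>W\<close>, tilted by the time spent
  before the step. Killing is tested after the step, so a start inside \<open>W\<close> is allowed
  and describes returns.\<close>

definition T :: "real \<Rightarrow> ('a seq \<Rightarrow> real) \<Rightarrow> 'a seq \<Rightarrow> real" where
  "T z f y = exp (z * \<phi> y) * push P N (\<lambda>v. if v \<in> W then 0 else f v) y"

lemma word_fun_off_W: "word_fun N f \<Longrightarrow> word_fun N (\<lambda>v. if v \<in> W then k else f v)"
  unfolding W_def
  by (rule word_fun_comp2[where g = "\<lambda>b t. if b then k else t", OF word_fun_mem_prefix_set])

lemma word_fun_T: "word_fun N f \<Longrightarrow> word_fun N (T z f)"
  unfolding T_def[abs_def] using N
  by (intro word_fun_comp2[where g = "(*)"] word_fun_comp[OF \<phi>] word_fun_push word_fun_off_W) auto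

lemma word_fun_T_iterate: "word_fun N f \<Longrightarrow> word_fun N ((T z ^^ n) f)"
  by (induction n) (auto intro: word_fun_T)

lemma T_mono: "(\<And>y. f y \<le> g y) \<Longrightarrow> T z f y \<le> T z g y"
  unfolding T_def by (intro mult_left_mono push_mono) auto

lemma T_nonneg: "(\<And>y. f y \<ge> 0) \<Longrightarrow> T z f y \<ge> 0"
  unfolding T_def by (intro mult_nonneg_nonneg push_nonneg) auto

lemma T_cmult: "T z (\<lambda>y. k * f y) y = k * T z f y"
proof -
  have "(\<lambda>v. if v \<in> W then 0 else k * f v) = (\<lambda>v. k * (if v \<in> W then 0 else f v))" by auto
  then show ?thesis by (simp add: T_def push_cmult)
qed

lemma T_sum: "T z (\<lambda>y. \<Sum>i\<in>I. f i y) y = (\<Sum>i\<in>I. T z (f i) y)"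
proof -
  have "(\<lambda>v. if v \<in> W then 0 else \<Sum>i\<in>I. f i v) = (\<lambda>v. \<Sum>i\<in>I. if v \<in> W then 0 else f i v)" by auto
  then show ?thesis by (simp add: T_def push_sum sum_distrib_left)
qed

lemma T_0: "T z f y = exp (z * \<phi> y) * T 0 f y"
  by (simp add: T_def)

text \<open>\<open>(T 0 ^^ n) (\<lambda>_. 1) y\<close> is the probability of avoiding \<open>W\<close> at the times \<open>1, \<dots>, n\<close> when
  starting from the word \<open>y 0, \<dots>, y (N - 1)\<close>.\<close>

abbreviation avoid :: "nat \<Rightarrow> 'a seq \<Rightarrow> real" where
  "avoid n \<equiv> (T 0 ^^ n) (\<lambda>_. 1)"

lemma word_fun_avoid: "word_fun N (avoid n)"
  by (intro word_fun_T_iterate word_fun_const)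

section \<open>Uniform decay of the probability of avoiding \<open>W\<close>\<close>

lemma avoid_bounds: "0 \<le> avoid n y \<and> avoid n y \<le> 1"
proof (induction n arbitrary: y)
  case (Suc n)
  have "T 0 (avoid n) y \<le> T 0 (\<lambda>_. 1) y"
    using Suc by (intro T_mono) simp
  also have "\<dots> \<le> push P N (\<lambda>_. 1) y"
    unfolding T_def by (simp, intro push_mono) auto
  finally show ?case using Suc T_nonneg[of "avoid n" 0 y] by (simp add: push_const)
qed simp

lemma avoid_antimono: "n \<le> m \<Longrightarrow> avoid m y \<le> avoid n y"
proof (rule lift_Suc_antimono_le[of "\<lambda>n. avoid n y"])
  show "avoid (Suc n) y \<le> avoid n y" for n
  proof (induction n arbitrary: y)
    case 0
    then show ?case using avoid_bounds[of 1] by simp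
  next
    case (Suc n)
    show ?case using T_mono[OF Suc] by simp
  qed
qed

text \<open>The letters of \<open>y\<close> from position \<open>N\<close> on prescribe an
  admissible path into \<open>W\<close>. The summand \<open>b = y N\<close> follows that path and is
  strictly smaller than its transition probability; this strictness passes through the
  induction.\<close>

lemma avoid_less_1:
  assumes "n \<ge> 1" "\<And>i. i < n \<Longrightarrow> P (y (i + N - 1)) (y (i + N)) > 0" "shiftn n y \<in> W"
  shows "avoid n y < 1"
  using assms
proof (induction n arbitrary: y)
  case (Suc n)
  have eq: "avoid (Suc n) y = (\<Sum>b\<in>UNIV. P (y (N - 1)) b * (if shiftn 1 (y(N := b)) \<in> W then 0 else avoid n (shiftn 1 (y(N := b)))))"
    by (simp add: T_def push_def)
  have less: "(if shiftn 1 y \<in> W then 0 else avoid n (shiftn 1 y)) < 1"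
  proof (cases "n = 0")
    case True
    then show ?thesis using Suc.prems by simp
  next
    case False
    have "avoid n (shiftn 1 y) < 1"
    proof (rule Suc.IH)
      show "P (shiftn 1 y (i + N - 1)) (shiftn 1 y (i + N)) > 0" if "i < n" for i
        using Suc.prems(2)[of "Suc i"] that N by (simp add: shiftn_def)
      show "shiftn n (shiftn 1 y) \<in> W" using Suc.prems(3) by simp
    qed (use False in simp)
    then show ?thesis by simp
  qed
  have "avoid (Suc n) y < (\<Sum>b\<in>UNIV. P (y (N - 1)) b)"
    unfolding eq
  proof (rule sum_strict_mono_ex1)
    show "\<forall>b\<in>UNIV. P (y (N - 1)) b * (if shiftn 1 (y(N := b)) \<in> W then 0 else avoid n (shiftn 1 (y(N := b)))) \<le> P (y (N - 1)) b"
      using avoid_bounds by (auto intro!: mult_left_le)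
    show "\<exists>b\<in>UNIV. P (y (N - 1)) b * (if shiftn 1 (y(N := b)) \<in> W then 0 else avoid n (shiftn 1 (y(N := b)))) < P (y (N - 1)) b"
    proof (intro bexI[of _ "y N"])
      have "P (y (N - 1)) (y N) > 0" using Suc.prems(2)[of 0] by simp
      then have "P (y (N - 1)) (y N) * (if shiftn 1 y \<in> W then 0 else avoid n (shiftn 1 y)) < P (y (N - 1)) (y N) * 1"
        using less by (rule mult_strict_left_mono[rotated])
      then show "P (y (N - 1)) (y N) * (if shiftn 1 (y(N := y N)) \<in> W then 0 else avoid n (shiftn 1 (y(N := y N)))) < P (y (N - 1)) (y N)"
        by (simp only: fun_upd_triv mult_1_right)
    qed simp
  qed simp
  then show ?case by (simp only: P_row_sum)
qed simp

lemma mpow_walk: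
  "mpow P k a b > 0 \<Longrightarrow> \<exists>w. w 0 = a \<and> w k = b \<and> (\<forall>i<k. P (w i) (w (Suc i)) > 0)"
proof (induction k arbitrary: b)
  case 0
  then show ?case by (intro exI[of _ "\<lambda>_. a"]) (auto split: if_splits)
next
  case (Suc k)
  have nonneg: "mpow P n a b \<ge> 0" for n a b
    by (induction n arbitrary: b) (auto intro!: sum_nonneg)
  obtain c where "mpow P k a c * P c b > 0"
    using Suc.prems by (metis (no_types, lifting) mpow.simps(2) not_less sum_nonpos)
  then have c: "mpow P k a c > 0" "P c b > 0"
    using nonneg[of k a c] P_nonneg[of c b] by (auto simp: zero_less_mult_iff)
  obtain w where "w 0 = a" "w k = c" "\<forall>i<k. P (w i) (w (Suc i)) > 0"
    using Suc.IH[OF c(1)] by blast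
  then show ?case using c(2)
    by (intro exI[of _ "w(Suc k := b)"]) (auto simp: less_Suc_eq)
qed

text \<open>By irreducibility some path leads from the last letter of the word to
  \<open>x 0\<close>, and from there the letters of \<open>x\<close> can be read.\<close>

lemma ex_avoid_less_1: "\<exists>n. avoid n y < 1"
proof -
  obtain k where k: "k > 0" "mpow P k (y (N - 1)) (x 0) > 0"
    using irreducible unfolding stochastic_irreducible_def by blast
  obtain w where w: "w 0 = y (N - 1)" "w k = x 0" "\<And>i. i < k \<Longrightarrow> P (w i) (w (Suc i)) > 0"
    using mpow_walk[OF k(2)] by blast
  \<comment> \<open>The word of \<open>y\<close>, the walk and \<open>x\<close> are glued with
    overlaps of one letter: \<open>w 0\<close> is the letter at \<open>N - 1\<close>, and
    \<open>w k\<close> at \<open>N - 1 + k\<close> is \<open>x 0\<close>.\<close>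
  define y' where "y' = (\<lambda>i. if i < N then y i else if i < N - 1 + k then w (i - (N - 1)) else x (i - (N - 1 + k)))"
  have tail: "y' (i + (N - 1)) = (if i \<le> k then w i else x (i - k))" for i
  proof -
    consider "i = 0" | "0 < i" "i < k" | "i = k" | "i > k" by linarith
    then show ?thesis using N k w by cases (auto simp: y'_def)
  qed
  have "avoid (N - 1 + k) y' < 1"
  proof (rule avoid_less_1)
    show "N - 1 + k \<ge> 1" using k by simp
    show "shiftn (N - 1 + k) y' \<in> W"
      using N k by (auto simp: W_def mem_prefix_set shiftn_def y'_def)
    fix i
    have "P (y' (i + (N - 1))) (y' (Suc i + (N - 1))) > 0"
      unfolding tail using w x_step[of "i - k"] x_step[of 0]
      by (cases "i < k"; cases "i = k") (auto simp: Suc_diff_le)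
    then show "P (y' (i + N - 1)) (y' (i + N)) > 0" using N by simp
  qed
  moreover have "avoid (N - 1 + k) y' = avoid (N - 1 + k) y"
    by (rule word_funD[OF word_fun_avoid]) (simp add: y'_def)
  ultimately show ?thesis by auto
qed

text \<open>The first time at which avoidance is uncertain depends on \<open>N\<close> letters only.
  It takes finitely many values, and monotonicity allows passing to their maximum; finiteness then
  also gives the gap \<open>\<epsilon>\<close>.\<close>

lemma uniform_avoid:
  obtains m \<epsilon> where "m \<ge> 1" "\<epsilon> > 0" "\<And>y. avoid m y \<le> 1 - \<epsilon>"
proof -
  define n where "n = (\<lambda>y. LEAST k. avoid k y < 1)"
  have n: "avoid (n y) y < 1" for y
    unfolding n_def by (rule LeastI_ex) (rule ex_avoid_less_1)
  have "word_fun N n"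
  proof (rule word_funI)
    fix y y' :: "'a seq" assume "\<And>i. i < N \<Longrightarrow> y i = y' i"
    then have "avoid k y = avoid k y'" for k by (rule word_funD[OF word_fun_avoid])
    then show "n y = n y'" by (simp add: n_def)
  qed
  then have fin: "finite (range n)" by (rule finite_range_word_fun)
  define m where "m = Max (range n) + 1"
  have "n y \<le> m" for y using Max_ge[OF fin, of "n y"] by (simp add: m_def)
  then have less: "avoid m y < 1" for y using avoid_antimono n by (meson le_less_trans)
  have fin': "finite (range (avoid m))" by (rule finite_range_word_fun[OF word_fun_avoid])
  have "Max (range (avoid m)) < 1" using fin' less by (subst Max_less_iff) auto
  moreover have "avoid m y \<le> Max (range (avoid m))" for y using fin' by (intro Max_ge) auto
  ultimately show thesis by (intro that[of m "1 - Max (range (avoid m))"]) (auto simp: m_def)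
qed

text \<open>The sum of the first \<open>m\<close> avoidance probabilities telescopes under \<open>T 0\<close>, hence is a
  Lyapunov function.\<close>

lemma lyapunov:
  obtains V M \<gamma> \<delta> B where
    "word_fun N V" "\<And>y. 1 \<le> V y" "\<And>y. V y \<le> M" "0 \<le> \<gamma>" "\<gamma> < 1" "0 < \<delta>"
    "\<And>z y. 0 \<le> z \<Longrightarrow> z \<le> \<delta> \<Longrightarrow> T z V y \<le> \<gamma> * V y"
    "B > 0" "\<And>y. \<phi> y \<le> B" "\<delta> * B \<le> 1"
proof -
  obtain m \<epsilon> where m: "m \<ge> 1" "\<epsilon> > 0" "\<And>y. avoid m y \<le> 1 - \<epsilon>" by (rule uniform_avoid) blast
  obtain B where B: "\<And>y. \<bar>\<phi> y\<bar> \<le> B" "B > 0" using word_fun_bounded[OF \<phi>] by blast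
  have \<epsilon>1: "\<epsilon> \<le> 1" using m(3)[of x] avoid_bounds[of m x] by linarith
  define V where "V = (\<lambda>y. \<Sum>n<m. avoid n y)"
  define M where "M = real m"
  \<comment> \<open>Since \<open>V \<le> M\<close>, an additive loss \<open>\<epsilon>\<close> is a
    relative loss \<open>\<eta>\<close>. The choice of \<open>\<delta>\<close> keeps the tilt below
    \<open>1 + \<eta>\<close>, so the contraction factor is
    \<open>(1 + \<eta>) * (1 - \<eta>)\<close>.\<close>
  define \<eta> where "\<eta> = \<epsilon> / M"
  have \<eta>: "0 < \<eta>" "\<eta> \<le> 1" using m \<epsilon>1 by (auto simp: \<eta>_def M_def field_simps)
  define \<delta> where "\<delta> = min (1 / B) (ln (1 + \<eta>) / B)"
  have V1: "1 \<le> V y" for y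
  proof -
    have "(\<Sum>n\<in>{0}. avoid n y) \<le> V y"
      unfolding V_def using m avoid_bounds by (intro sum_mono2) auto
    then show ?thesis by simp
  qed
  have VM: "V y \<le> M" for y
    using sum_bounded_above[of "{..<m}" "\<lambda>n. avoid n y" 1] avoid_bounds by (simp add: V_def M_def)
  have TV: "T 0 V y \<le> V y - \<epsilon>" for y
  proof -
    have "T 0 V y = (\<Sum>n<m. avoid (Suc n) y)" by (simp add: V_def T_sum)
    also have "\<dots> = V y + avoid m y - avoid 0 y"
      unfolding V_def using sum.lessThan_Suc_shift[of "\<lambda>n. avoid n y" m] by simp
    finally show ?thesis using m(3)[of y] by simp
  qed
  show thesis
  proof (rule that[of V M "1 - \<eta>\<^sup>2" \<delta> B])
    show "word_fun N V" unfolding V_def by (intro word_fun_sum word_fun_avoid)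
    show "0 \<le> 1 - \<eta>\<^sup>2" "1 - \<eta>\<^sup>2 < 1" using \<eta> by (auto simp: power_le_one)
    show "0 < \<delta>" using B \<eta> by (simp add: \<delta>_def)
    have \<delta>B: "\<delta> * B \<le> ln (1 + \<eta>)" using B(2) by (simp add: \<delta>_def min_def field_simps)
    show "\<delta> * B \<le> 1" using B(2) by (simp add: \<delta>_def min_def field_simps)
    show "\<phi> y \<le> B" for y using B(1)[of y] by simp
    fix z y assume z: "0 \<le> z" "z \<le> \<delta>"
    have "z * \<phi> y \<le> \<delta> * B" using z B(1)[of y] B(2) \<phi>_pos[of y] by (intro mult_mono) auto
    then have "exp (z * \<phi> y) \<le> exp (ln (1 + \<eta>))" using \<delta>B by simp
    then have e: "exp (z * \<phi> y) \<le> 1 + \<eta>" using \<eta> by simp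
    have "T 0 V y \<le> V y - \<eta> * V y"
    proof -
      have "\<eta> * V y \<le> \<eta> * M" using VM[of y] \<eta> by (intro mult_left_mono) auto
      then show ?thesis using TV[of y] m by (simp add: \<eta>_def M_def)
    qed
    moreover have "0 \<le> T 0 V y" using V1 by (intro T_nonneg) (meson order_trans zero_le_one)
    ultimately have "T z V y \<le> (1 + \<eta>) * (V y - \<eta> * V y)"
      unfolding T_0[of z] using e \<eta> by (intro mult_mono) auto
    then show "T z V y \<le> (1 - \<eta>\<^sup>2) * V y" by (simp add: algebra_simps power2_eq_square)
  qed (use V1 VM B in auto)
qed

text \<open>\<open>1 + u z y\<close> is the expected \<open>exp (z * time)\<close> of the first
  visit to \<open>W\<close> at a positive number of steps. Taking off the \<open>1\<close> leaves an
  inhomogeneous term of order \<open>z\<close>, so the Neumann series of \<open>T z\<close>,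
  dominated by a geometric series through the Lyapunov function, gives the linear bound; uniformity
  of the domination in \<open>z\<close> gives continuity.\<close>

lemma renewal_solution:
  obtains \<delta> K u where "\<delta> > 0" "K > 0" "\<And>y. \<delta> * \<phi> y \<le> 1"
    "\<And>z. 0 \<le> z \<Longrightarrow> z \<le> \<delta> \<Longrightarrow> word_fun N (u z)"
    "\<And>z y. 0 \<le> z \<Longrightarrow> z \<le> \<delta> \<Longrightarrow> 0 \<le> u z y"
    "\<And>z y. 0 \<le> z \<Longrightarrow> z \<le> \<delta> \<Longrightarrow> u z y \<le> K * z"
    "\<And>z y. 0 \<le> z \<Longrightarrow> z \<le> \<delta> \<Longrightarrow> u z y = exp (z * \<phi> y) - 1 + T z (u z) y"
    "\<And>y. continuous_on {0..\<delta>} (\<lambda>z. u z y)"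
proof -
  obtain V M \<gamma> \<delta> B where V: "word_fun N V" "\<And>y. 1 \<le> V y" "\<And>y. V y \<le> M"
    and \<gamma>: "0 \<le> \<gamma>" "\<gamma> < 1" and \<delta>: "0 < \<delta>"
    and TV: "\<And>z y. 0 \<le> z \<Longrightarrow> z \<le> \<delta> \<Longrightarrow> T z V y \<le> \<gamma> * V y"
    and B: "B > 0" "\<And>y. \<phi> y \<le> B" "\<delta> * B \<le> 1"
    by (rule lyapunov) blast
  define g where "g = (\<lambda>z y. exp (z * \<phi> y) - 1)"
  define a where "a = (\<lambda>z n. (T z ^^ n) (g z))"
  define u where "u = (\<lambda>z y. \<Sum>n. a z n y)"
  have M: "M \<ge> 1" using V(2,3)[of x] by linarith
  have \<delta>\<phi>: "z * \<phi> y \<le> 1" "z * \<phi> y \<le> B * z" "0 \<le> z * \<phi> y" if "0 \<le> z" "z \<le> \<delta>" for z y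
  proof -
    show "0 \<le> z * \<phi> y" using that \<phi>_pos[of y] by simp
    show "z * \<phi> y \<le> B * z" using mult_left_mono[OF B(2)[of y] that(1)] by (simp add: mult.commute)
    have "z * \<phi> y \<le> \<delta> * B" using that B(2)[of y] \<phi>_pos[of y] by (intro mult_mono) auto
    then show "z * \<phi> y \<le> 1" using B(3) by simp
  qed
  have g: "0 \<le> g z y" "g z y \<le> 2 * B * z" if "0 \<le> z" "z \<le> \<delta>" for z y
    using \<delta>\<phi>[OF that, of y] exp_minus_1_le[of "z * \<phi> y"] by (auto simp: g_def)
  have a_Suc: "a z (Suc n) y = T z (a z n) y" for z n y by (simp add: a_def)
  have a_word: "word_fun N (a z n)" for z n
    unfolding a_def g_def by (intro word_fun_T_iterate word_fun_comp[OF \<phi>])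
  have a_nonneg: "0 \<le> a z n y" if "0 \<le> z" "z \<le> \<delta>" for z n y
  proof (induction n arbitrary: y)
    case 0
    then show ?case using g[OF that] by (simp add: a_def)
  qed (simp add: a_Suc T_nonneg)
  have a_le_V: "a z n y \<le> 2 * B * z * \<gamma> ^ n * V y" if z: "0 \<le> z" "z \<le> \<delta>" for z n y
  proof (induction n arbitrary: y)
    case 0
    have "g z y \<le> 2 * B * z * 1" using g[OF z] by simp
    also have "\<dots> \<le> 2 * B * z * V y" using V(2)[of y] B z by (intro mult_left_mono) auto
    finally show ?case by (simp add: a_def)
  next
    case (Suc n)
    have "a z (Suc n) y \<le> T z (\<lambda>y. 2 * B * z * \<gamma> ^ n * V y) y"
      unfolding a_Suc by (rule T_mono) (rule Suc)
    also have "\<dots> = 2 * B * z * \<gamma> ^ n * T z V y" by (rule T_cmult)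
    also have "\<dots> \<le> 2 * B * z * \<gamma> ^ n * (\<gamma> * V y)"
      using TV[OF z] B z \<gamma> by (intro mult_left_mono) auto
    finally show ?case by (simp add: mult_ac)
  qed
  have a_le: "a z n y \<le> 2 * B * z * M * \<gamma> ^ n" if z: "0 \<le> z" "z \<le> \<delta>" for z n y
  proof -
    have "2 * B * z * \<gamma> ^ n * V y \<le> 2 * B * z * \<gamma> ^ n * M"
      using V(3) B z \<gamma> by (intro mult_left_mono) auto
    then show ?thesis using a_le_V[OF z, of n y] by (simp add: mult_ac)
  qed
  have geo: "summable (\<lambda>n. k * \<gamma> ^ n)" for k :: real
    using \<gamma> by (intro summable_mult summable_geometric) simp
  have summable: "summable (\<lambda>n. a z n y)" if z: "0 \<le> z" "z \<le> \<delta>" for z y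
    by (rule summable_comparison_test'[OF geo[of "2 * B * z * M"], of 0])
       (use a_le[OF z] a_nonneg[OF z] in auto)
  show thesis
  proof (rule that[of \<delta> "2 * B * M / (1 - \<gamma>)" u])
    show "\<delta> > 0" by (rule \<delta>)
    show "2 * B * M / (1 - \<gamma>) > 0" using B M \<gamma> by simp
    show "\<delta> * \<phi> y \<le> 1" for y using \<delta>\<phi>(1)[of \<delta>] \<delta> by simp
  next
    fix z assume z: "0 \<le> z" "z \<le> \<delta>"
    show "word_fun N (u z)" unfolding u_def
    proof (rule word_funI)
      fix y y' :: "'a seq" assume "\<And>i. i < N \<Longrightarrow> y i = y' i"
      then have "a z n y = a z n y'" for n by (rule word_funD[OF a_word])
      then show "(\<Sum>n. a z n y) = (\<Sum>n. a z n y')" by simp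
    qed
    show "0 \<le> u z y" for y unfolding u_def by (intro suminf_nonneg summable z a_nonneg)
    show "u z y \<le> 2 * B * M / (1 - \<gamma>) * z" for y
    proof -
      have "u z y \<le> (\<Sum>n. 2 * B * z * M * \<gamma> ^ n)"
        unfolding u_def by (intro suminf_le a_le z summable geo)
      also have "\<dots> = 2 * B * z * M * (1 / (1 - \<gamma>))"
        using \<gamma> by (subst suminf_mult) (auto simp: suminf_geometric summable_geometric)
      finally show ?thesis by (simp add: mult_ac)
    qed
    show "u z y = exp (z * \<phi> y) - 1 + T z (u z) y" for y
    proof -
      let ?v = "\<lambda>b. shiftn 1 (y(N := b))"
      have s: "summable (\<lambda>n. if v \<in> W then 0 else a z n v)" for v
        using summable[OF z, of v] by (cases "v \<in> W") auto
      have "T z (u z) y = exp (z * \<phi> y) * (\<Sum>b\<in>UNIV. P (y (N - 1)) b * (\<Sum>n. if ?v b \<in> W then 0 else a z n (?v b)))"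
        unfolding T_def push_def u_def by (intro arg_cong2[where f = "(*)"] refl sum.cong) auto
      also have "\<dots> = (\<Sum>n. exp (z * \<phi> y) * (\<Sum>b\<in>UNIV. P (y (N - 1)) b * (if ?v b \<in> W then 0 else a z n (?v b))))"
        by (subst suminf_mult, intro summable_sum summable_mult s,
            subst suminf_sum, intro summable_mult s, subst suminf_mult[OF s]) (rule refl)
      also have "\<dots> = (\<Sum>n. a z (Suc n) y)"
        by (simp add: a_Suc T_def push_def)
      also have "\<dots> = u z y - a z 0 y"
        unfolding u_def using suminf_split_head[OF summable[OF z]] .
      finally show ?thesis by (simp add: a_def g_def)
    qed
  next
    fix y
    have cont: "continuous_on {0..\<delta>} (\<lambda>z. a z n y)" for n
    proof (induction n arbitrary: y)
      case 0
      then show ?case by (auto simp: a_def g_def intro!: continuous_intros)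
    next
      case (Suc n)
      have "continuous_on {0..\<delta>} (\<lambda>z. if v \<in> W then 0 else a z n v)" for v
        using Suc by (cases "v \<in> W") auto
      then show ?case unfolding a_Suc T_def push_def by (intro continuous_intros)
    qed
    have "uniform_limit {0..\<delta>} (\<lambda>n z. \<Sum>i<n. a z i y) (\<lambda>z. \<Sum>i. a z i y) sequentially"
    proof (rule Weierstrass_m_test[OF _ geo[of "2 * B * \<delta> * M"]])
      fix n z assume "z \<in> {0..\<delta>}"
      then have z: "0 \<le> z" "z \<le> \<delta>" by auto
      have "2 * B * z * M * \<gamma> ^ n \<le> 2 * B * \<delta> * M * \<gamma> ^ n"
        using z B M \<gamma> by (intro mult_right_mono mult_left_mono) auto
      then show "norm (a z n y) \<le> 2 * B * \<delta> * M * \<gamma> ^ n"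
        using a_nonneg[OF z, of n y] a_le[OF z, of n y] by simp
    qed
    then show "continuous_on {0..\<delta>} (\<lambda>z. u z y)"
      unfolding u_def
      by (rule uniform_limit_theorem[rotated]) (auto intro!: always_eventually continuous_on_sum cont)
  qed
qed

text \<open>The expansion of \<open>R\<close> is Kac's formula with an error term: integrating the
  equation for \<open>push P N (H z)\<close> against \<open>\<mu>\<close>, the integrals of
  \<open>H z\<close> and of its push cancel, and \<open>(R z - 1) * weight x N\<close> equals the
  integral of \<open>(exp (z * \<phi>) - 1)\<close> times the push.\<close>

lemma renewal_function:
  obtains \<delta> K H R where "\<delta> > 0" "K > 0"
    "\<And>z. 0 \<le> z \<Longrightarrow> z \<le> \<delta> \<Longrightarrow> word_fun N (H z)"
    "\<And>z y. 0 \<le> z \<Longrightarrow> z \<le> \<delta> \<Longrightarrow> 1 \<le> H z y"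
    "\<And>z y. 0 \<le> z \<Longrightarrow> z \<le> \<delta> \<Longrightarrow> y \<in> W \<Longrightarrow> H z y = 1"
    "\<And>z y. 0 \<le> z \<Longrightarrow> z \<le> \<delta> \<Longrightarrow>
       exp (z * \<phi> y) * push P N (H z) y = H z y + (if y \<in> W then R z - 1 else 0)"
    "\<And>z. 0 \<le> z \<Longrightarrow> z \<le> \<delta> \<Longrightarrow> 1 \<le> R z"
    "\<And>z. 0 \<le> z \<Longrightarrow> z \<le> \<delta> \<Longrightarrow> \<bar>R z - 1 - z * (\<integral>y. \<phi> y \<partial>\<mu>) / weight x N\<bar> \<le> K * z\<^sup>2"
    "continuous_on {0..\<delta>} R"
proof -
  obtain \<delta> K u where \<delta>: "\<delta> > 0" and K: "K > 0" and \<delta>\<phi>: "\<And>y. \<delta> * \<phi> y \<le> 1"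
    and u_word: "\<And>z. 0 \<le> z \<Longrightarrow> z \<le> \<delta> \<Longrightarrow> word_fun N (u z)"
    and u_nonneg: "\<And>z y. 0 \<le> z \<Longrightarrow> z \<le> \<delta> \<Longrightarrow> 0 \<le> u z y"
    and u_le: "\<And>z y. 0 \<le> z \<Longrightarrow> z \<le> \<delta> \<Longrightarrow> u z y \<le> K * z"
    and u_eq: "\<And>z y. 0 \<le> z \<Longrightarrow> z \<le> \<delta> \<Longrightarrow> u z y = exp (z * \<phi> y) - 1 + T z (u z) y"
    and u_cont: "\<And>y. continuous_on {0..\<delta>} (\<lambda>z. u z y)"
    by (rule renewal_solution) blast
  define H where "H = (\<lambda>z y. 1 + (if y \<in> W then 0 else u z y))"
  \<comment> \<open>\<open>x\<close> represents all of \<open>W\<close>: \<open>u z\<close> reads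
    \<open>N\<close> letters and is therefore constant there.\<close>
  define R where "R = (\<lambda>z. 1 + u z x)"
  obtain B where B: "\<And>y. \<bar>\<phi> y\<bar> \<le> B" "B > 0" using word_fun_bounded[OF \<phi>] by blast
  have H_word: "word_fun N (H z)" if "0 \<le> z" "z \<le> \<delta>" for z
    unfolding H_def by (intro word_fun_comp[where g = "\<lambda>t. 1 + t"] word_fun_off_W u_word that)
  have H_bounds: "1 \<le> H z y" "H z y \<le> 1 + K * z" if "0 \<le> z" "z \<le> \<delta>" for z y
    using u_nonneg[OF that] u_le[OF that] K that by (auto simp: H_def)
  have push_H: "exp (z * \<phi> y) * push P N (H z) y = H z y + (if y \<in> W then R z - 1 else 0)"
    if z: "0 \<le> z" "z \<le> \<delta>" for z y
  proof -
    have "exp (z * \<phi> y) * push P N (H z) y = exp (z * \<phi> y) + T z (u z) y"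
      unfolding H_def T_def by (simp add: push_add push_const distrib_left)
    also have "\<dots> = 1 + u z y" using u_eq[OF z, of y] by simp
    also have "\<dots> = H z y + (if y \<in> W then R z - 1 else 0)"
      using word_funD[OF u_word[OF z], of y x] by (auto simp: H_def R_def W_def mem_prefix_set)
    finally show ?thesis .
  qed
  show thesis
  proof (rule that[of \<delta> "(B * B + 2 * B * K) / weight x N" H R])
    fix z assume z: "0 \<le> z" "z \<le> \<delta>"
    have z\<phi>: "0 \<le> z * \<phi> y" "z * \<phi> y \<le> 1" "z * \<phi> y \<le> B * z" for y
    proof -
      show "0 \<le> z * \<phi> y" using z \<phi>_pos[of y] by simp
      show "z * \<phi> y \<le> 1" using mult_right_mono[OF z(2), of "\<phi> y"] \<phi>_pos[of y] \<delta>\<phi>[of y] by linarith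
      have "\<phi> y \<le> B" using B(1)[of y] by simp
      then show "z * \<phi> y \<le> B * z" using mult_left_mono[of "\<phi> y" B z] z by (simp add: mult.commute)
    qed
    let ?h = "push P N (H z)"
    have h_word: "word_fun N ?h" using N by (intro word_fun_push H_word z) auto
    have h: "1 \<le> ?h y" "?h y \<le> 1 + K * z" for y
      using push_mono[of "\<lambda>_. 1" "H z" N y] push_mono[of "H z" "\<lambda>_. 1 + K * z" N y] H_bounds[OF z]
      by (auto simp: push_const)
    \<comment> \<open>The second-order part. Its bound adds the Taylor error of the exponential, at
      most \<open>(B * z)\<^sup>2\<close>, and the product of \<open>exp (z * \<phi> y) - 1\<close>,
      at most \<open>2 * B * z\<close>, with the excess of the push over one, at most
      \<open>K * z\<close>.\<close>
    define D where "D = (\<lambda>y. (exp (z * \<phi> y) - 1) * ?h y - z * \<phi> y)"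
    have D_word: "word_fun N D" unfolding D_def
      by (intro word_fun_comp2[where g = "(-)"] word_fun_comp2[where g = "(*)"] h_word
          word_fun_comp[OF \<phi>, of "\<lambda>t. exp (z * t) - 1"] word_fun_comp[OF \<phi>])
    have D_bound: "\<bar>D y\<bar> \<le> (B * B + 2 * B * K) * z\<^sup>2" for y
    proof -
      let ?t = "z * \<phi> y"
      have e: "?t \<le> exp ?t - 1" "exp ?t - 1 \<le> ?t + ?t\<^sup>2" "exp ?t - 1 \<le> 2 * ?t"
        using exp_ge_add_one_self[of ?t] exp_bound[OF z\<phi>(1,2), of y] exp_minus_1_le[OF z\<phi>(1,2), of y]
        by linarith+
      have "?t * 1 \<le> (exp ?t - 1) * ?h y" using e h z\<phi> by (intro mult_mono) auto
      then have "0 \<le> D y" by (simp add: D_def)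
      have "(exp ?t - 1) * ?h y \<le> (exp ?t - 1) * (1 + K * z)"
        using e z\<phi>(1)[of y] h by (intro mult_left_mono) auto
      also have "\<dots> = (exp ?t - 1) + (exp ?t - 1) * (K * z)" by (simp add: algebra_simps)
      also have "\<dots> \<le> (?t + ?t\<^sup>2) + (2 * (B * z)) * (K * z)"
        using e z\<phi>(3)[of y] K z by (intro add_mono mult_right_mono) auto
      also have "\<dots> \<le> (?t + (B * z)\<^sup>2) + (2 * (B * z)) * (K * z)"
        using z\<phi>[of y] by (intro add_mono power_mono) auto
      finally have "D y \<le> (B * B + 2 * B * K) * z\<^sup>2"
        by (simp add: D_def power2_eq_square algebra_simps)
      then show ?thesis using \<open>0 \<le> D y\<close> by simp
    qed
    have int: "integrable \<mu> (H z)" "integrable \<mu> ?h" "integrable \<mu> \<phi>" "integrable \<mu> D"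
      by (rule integrable_word_fun[OF H_word[OF z]] integrable_word_fun[OF h_word]
          integrable_word_fun[OF \<phi>] integrable_word_fun[OF D_word])+
    have W_int: "(\<integral>y. (if y \<in> W then R z - 1 else 0) \<partial>\<mu>) = (R z - 1) * weight x N"
    proof -
      have "(\<lambda>y. if y \<in> W then R z - 1 else 0) = (\<lambda>y. (R z - 1) * indicator W y)" by (auto simp: indicator_def)
      then show ?thesis using N by (simp add: W_def measure_prefix)
    qed
    have "(\<lambda>y. if y \<in> W then R z - 1 else 0) = (\<lambda>y. D y + z * \<phi> y + ?h y - H z y)"
      using push_H[OF z] by (auto simp: fun_eq_iff D_def algebra_simps)
    then have "(R z - 1) * weight x N = (\<integral>y. (D y + z * \<phi> y + ?h y - H z y) \<partial>\<mu>)"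
      using W_int by simp
    also have "\<dots> = (\<integral>y. D y \<partial>\<mu>) + z * (\<integral>y. \<phi> y \<partial>\<mu>)"
      using int integral_push[OF N H_word[OF z]] by simp
    finally have eq: "R z - 1 - z * (\<integral>y. \<phi> y \<partial>\<mu>) / weight x N = (\<integral>y. D y \<partial>\<mu>) / weight x N"
      using weight_x_pos[of N] by (simp add: field_simps)
    have "\<bar>\<integral>y. D y \<partial>\<mu>\<bar> \<le> (\<integral>y. \<bar>D y\<bar> \<partial>\<mu>)" by (rule integral_abs_bound)
    also have "\<dots> \<le> (\<integral>y. (B * B + 2 * B * K) * z\<^sup>2 \<partial>\<mu>)"
      using int(4) D_bound by (intro integral_mono integrable_abs integrable_const) auto
    also have "\<dots> = (B * B + 2 * B * K) * z\<^sup>2" using prob_space by simp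
    finally have "\<bar>\<integral>y. D y \<partial>\<mu>\<bar> / weight x N \<le> (B * B + 2 * B * K) * z\<^sup>2 / weight x N"
      by (rule divide_right_mono) (rule weight_nonneg)
    then show "\<bar>R z - 1 - z * (\<integral>y. \<phi> y \<partial>\<mu>) / weight x N\<bar> \<le> (B * B + 2 * B * K) / weight x N * z\<^sup>2"
      by (simp only: eq abs_divide abs_of_nonneg[OF weight_nonneg] times_divide_eq_left)
    show "1 \<le> R z" using u_nonneg[OF z] by (simp add: R_def)
  next
    show "(B * B + 2 * B * K) / weight x N > 0" using B K weight_x_pos by (simp add: add_pos_pos)
    show "continuous_on {0..\<delta>} R" unfolding R_def by (intro continuous_intros u_cont)
    show "\<delta> > 0" by (rule \<delta>)
    show "word_fun N (H z)" if "0 \<le> z" "z \<le> \<delta>" for z by (rule H_word[OF that])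
    show "1 \<le> H z y" if "0 \<le> z" "z \<le> \<delta>" for z y by (rule H_bounds(1)[OF that])
    show "H z y = 1" if "y \<in> W" for z y using that by (simp add: H_def)
    show "exp (z * \<phi> y) * push P N (H z) y = H z y + (if y \<in> W then R z - 1 else 0)"
      if "0 \<le> z" "z \<le> \<delta>" for z y by (rule push_H[OF that])
  qed
qed

end

section \<open>Escape rate of an eigenfunction\<close>

lemma birkhoff_sum_0 [simp]: "birkhoff_sum f 0 y = 0"
  by (simp add: birkhoff_sum_def)

lemma birkhoff_sum_Suc: "birkhoff_sum f (Suc j) y = birkhoff_sum f j y + f (shiftn j y)"
  by (simp add: birkhoff_sum_def)

lemma birkhoff_sum_add: "birkhoff_sum f (i + j) y = birkhoff_sum f i y + birkhoff_sum f j (shiftn i y)"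
  by (induction j) (simp_all add: birkhoff_sum_Suc add.commute)

lemma birkhoff_sum_Suc_shift: "birkhoff_sum f (Suc j) y = f y + birkhoff_sum f j (shiftn 1 y)"
  using birkhoff_sum_add[of f 1 j y] by (simp add: birkhoff_sum_Suc)

lemma word_fun_birkhoff_sum: "word_fun n f \<Longrightarrow> word_fun (n + k) (birkhoff_sum f k)"
proof -
  assume f: "word_fun n f"
  have "word_fun (n + k) (\<lambda>y. f (shiftn i y))" if "i < k" for i
    using word_fun_mono[OF word_fun_shiftn[OF f, of i], of "n + k"] that by simp
  then show ?thesis unfolding birkhoff_sum_def[abs_def] by (intro word_fun_sum) auto
qed

lemma exponential_rate:
  fixes m :: "real \<Rightarrow> real"
  assumes "\<And>t. t \<ge> 0 \<Longrightarrow> k\<^sub>1 * exp (- z * t) \<le> m t" "\<And>t. t \<ge> 0 \<Longrightarrow> m t \<le> k\<^sub>2 * exp (- z * t)" "k\<^sub>1 > 0"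
  shows "((\<lambda>t. - ln (m t) / t) \<longlongrightarrow> z) at_top"
proof (rule tendsto_sandwich)
  have k\<^sub>2: "k\<^sub>2 > 0" using assms(1)[of 0] assms(2)[of 0] assms(3) by simp
  have b: "z - ln k\<^sub>2 / t \<le> - ln (m t) / t \<and> - ln (m t) / t \<le> z - ln k\<^sub>1 / t" if t: "t > 0" for t
  proof -
    have pos: "0 < k\<^sub>1 * exp (- z * t)" using assms(3) by simp
    then have m: "0 < m t" using assms(1)[of t] t by linarith
    have "ln (k\<^sub>1 * exp (- z * t)) \<le> ln (m t)" using assms(1)[of t] t pos m by (subst ln_le_cancel_iff) auto
    moreover have "ln (m t) \<le> ln (k\<^sub>2 * exp (- z * t))" using assms(2)[of t] t m k\<^sub>2 by (subst ln_le_cancel_iff) auto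
    ultimately have "ln k\<^sub>1 - z * t \<le> ln (m t)" "ln (m t) \<le> ln k\<^sub>2 - z * t"
      using assms(3) k\<^sub>2 by (auto simp: ln_mult)
    then have "(z * t - ln k\<^sub>2) / t \<le> - ln (m t) / t" "- ln (m t) / t \<le> (z * t - ln k\<^sub>1) / t"
      using t by (intro divide_right_mono; simp)+
    then show ?thesis using t by (simp add: diff_divide_distrib)
  qed
  show "\<forall>\<^sub>F t in at_top. z - ln k\<^sub>2 / t \<le> - ln (m t) / t"
    using eventually_gt_at_top[of 0] by eventually_elim (use b in auto)
  show "\<forall>\<^sub>F t in at_top. - ln (m t) / t \<le> z - ln k\<^sub>1 / t"
    using eventually_gt_at_top[of 0] by eventually_elim (use b in auto)
  have "((\<lambda>t. z - k / t) \<longlongrightarrow> z - 0) at_top" for k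
    by (intro tendsto_diff tendsto_const real_tendsto_divide_at_top[OF tendsto_const] filterlim_ident)
  then show "((\<lambda>t. z - ln k\<^sub>2 / t) \<longlongrightarrow> z) at_top" "((\<lambda>t. z - ln k\<^sub>1 / t) \<longlongrightarrow> z) at_top"
    by simp_all
qed

section \<open>Survival of the flow reduced to visits of the base orbit\<close>

context renewal
begin

text \<open>Here \<open>t\<close> is the flow time that remains, counted from the bottom of the
  fibre over \<open>y\<close>. For \<open>t < 0\<close> the condition is vacuous, which is where the
  recursion \<open>survives_step\<close> ends.\<close>

definition survives :: "'a seq set \<Rightarrow> real \<Rightarrow> 'a seq \<Rightarrow> bool" where
  "survives A t y \<longleftrightarrow> (\<forall>j. birkhoff_sum \<phi> j y \<le> t \<longrightarrow> shiftn j y \<notin> A)"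

lemma birkhoff_sum_ge: "birkhoff_sum \<phi> j y \<ge> j * \<phi>\<^sub>0"
  unfolding birkhoff_sum_def using sum_bounded_below[of "{..<j}" \<phi>\<^sub>0 "\<lambda>i. \<phi> (shiftn i y)"] \<phi>_ge by simp

lemma birkhoff_sum_nonneg: "birkhoff_sum \<phi> j y \<ge> 0"
  using birkhoff_sum_ge[of j y] \<phi>\<^sub>0 by (meson mult_nonneg_nonneg less_imp_le of_nat_0_le_iff order_trans)

lemma birkhoff_sum_mono: "i \<le> j \<Longrightarrow> birkhoff_sum \<phi> i y \<le> birkhoff_sum \<phi> j y"
  using birkhoff_sum_add[of \<phi> i "j - i" y] birkhoff_sum_nonneg[of "j - i" "shiftn i y"] by simp

lemma survives_step:
  assumes "t \<ge> 0"
  shows "survives A t y \<longleftrightarrow> y \<notin> A \<and> survives A (t - \<phi> y) (shiftn 1 y)"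
proof -
  have "survives A t y \<longleftrightarrow> (\<forall>j. j = 0 \<longrightarrow> birkhoff_sum \<phi> j y \<le> t \<longrightarrow> shiftn j y \<notin> A)
      \<and> (\<forall>j. birkhoff_sum \<phi> (Suc j) y \<le> t \<longrightarrow> shiftn (Suc j) y \<notin> A)"
    unfolding survives_def by (metis not0_implies_Suc)
  then show ?thesis
    using assms by (simp add: survives_def birkhoff_sum_Suc_shift algebra_simps)
qed

lemma survives_neg: "t < 0 \<Longrightarrow> survives A t y"
  unfolding survives_def using birkhoff_sum_nonneg by (meson leD le_less_trans)

lemma survives_antimono: "t \<le> t' \<Longrightarrow> survives A t' y \<Longrightarrow> survives A t y"
  unfolding survives_def by (meson order_trans)

text \<open>The base coordinate changes only when the roof is reached, so the uncountably many times
  \<open>\<tau>\<close> amount to the countably many base points reached up to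
  \<open>s + t\<close>.\<close>

lemma survivor_set_eq:
  assumes t: "t \<ge> 0"
  shows "survivor_set P \<phi> A t = {(y, s). y \<in> Sigma_P P \<and> 0 \<le> s \<and> s < \<phi> y \<and> survives A (s + t) y}"
proof -
  have "(\<forall>\<tau>\<in>{0..t}. fst (special_flow \<phi> \<tau> (y, s)) \<notin> A) \<longleftrightarrow> survives A (s + t) y"
    if s: "0 \<le> s" "s < \<phi> y" for y s
  proof
    assume *: "\<forall>\<tau>\<in>{0..t}. fst (special_flow \<phi> \<tau> (y, s)) \<notin> A"
    show "survives A (s + t) y" unfolding survives_def
    proof (intro allI impI)
      fix j assume j: "birkhoff_sum \<phi> j y \<le> s + t"
      show "shiftn j y \<notin> A"
      proof (cases j)
        case 0
        then show ?thesis using *[rule_format, of 0] t s by (simp add: special_flow_def)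
      next
        case (Suc i)
        \<comment> \<open>The moment of arrival at \<open>shiftn j y\<close>. The inequality in
          \<open>lap_count\<close> is strict, so the count is already \<open>Suc j\<close> there and
          the flow sits at height zero over the new base point.\<close>
        define \<tau> where "\<tau> = birkhoff_sum \<phi> j y - s"
        have ge: "birkhoff_sum \<phi> j y \<ge> \<phi> y"
          using birkhoff_sum_mono[of 1 j y] Suc by (simp add: birkhoff_sum_Suc)
        have "lap_count \<phi> (s + \<tau>) y = Suc j"
          unfolding lap_count_def \<tau>_def
        proof (rule Least_equality)
          show "birkhoff_sum \<phi> (Suc j) y > s + (birkhoff_sum \<phi> j y - s)"
            using \<phi>_pos by (simp add: birkhoff_sum_Suc)
          show "Suc j \<le> k" if "birkhoff_sum \<phi> k y > s + (birkhoff_sum \<phi> j y - s)" for k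
            using that birkhoff_sum_mono[of k j y] by (cases "k \<le> j") auto
        qed
        then have "fst (special_flow \<phi> \<tau> (y, s)) = shiftn j y"
          using ge s by (auto simp: special_flow_def \<tau>_def Let_def)
        moreover have "\<tau> \<in> {0..t}" using ge s j by (simp add: \<tau>_def)
        ultimately show ?thesis using * by metis
      qed
    qed
  next
    assume *: "survives A (s + t) y"
    show "\<forall>\<tau>\<in>{0..t}. fst (special_flow \<phi> \<tau> (y, s)) \<notin> A"
    proof
      fix \<tau> assume \<tau>: "\<tau> \<in> {0..t}"
      show "fst (special_flow \<phi> \<tau> (y, s)) \<notin> A"
      proof (cases "\<tau> < \<phi> y - s")
        case True
        have "y \<notin> A" using * t s unfolding survives_def by (metis birkhoff_sum_0 add_nonneg_nonneg shiftn_0)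
        then show ?thesis using True by (simp add: special_flow_def)
      next
        case False
        define k where "k = lap_count \<phi> (s + \<tau>) y"
        \<comment> \<open>Birkhoff sums grow at least like multiples of
          \<open>\<phi>\<^sub>0\<close>, so the \<open>LEAST\<close> in \<open>lap_count\<close> is
          attained.\<close>
        obtain n where n: "real n * \<phi>\<^sub>0 > s + \<tau>" using reals_Archimedean3[OF \<phi>\<^sub>0] by blast
        have "birkhoff_sum \<phi> k y > s + \<tau>"
          unfolding k_def lap_count_def by (rule LeastI[of _ n]) (use birkhoff_sum_ge[of n y] n in linarith)
        then have "k \<noteq> 0" using s \<tau> by (cases k) auto
        then have "\<not> birkhoff_sum \<phi> (k - 1) y > s + \<tau>"
          unfolding k_def lap_count_def by (intro not_less_Least) simp
        then have "shiftn (k - 1) y \<notin> A" using * \<tau> unfolding survives_def by auto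
        then show ?thesis using False by (simp add: special_flow_def Let_def k_def)
      qed
    qed
  qed
  then show ?thesis unfolding survivor_set_def by blast
qed

lemma word_set_measurable:
  fixes A :: "'a seq set"
  assumes "word_fun n (\<lambda>y. y \<in> A)"
  shows "A \<in> sets seq_algebra"
proof -
  have "(\<lambda>y. if y \<in> A then 1 else 0 :: real) \<in> borel_measurable seq_algebra"
    by (rule word_fun_measurable[OF word_fun_comp[OF assms, of "\<lambda>b. if b then 1 else (0::real)"]])
  from measurable_sets[OF this, of "{1}"] have "(\<lambda>y. if y \<in> A then 1 else 0 :: real) -` {1} \<inter> UNIV \<in> sets seq_algebra"
    by (simp add: space_PiM)
  also have "(\<lambda>y. if y \<in> A then 1 else 0 :: real) -` {1} \<inter> UNIV = A" by auto
  finally show ?thesis .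
qed

lemma \<phi>_measurable [measurable]: "\<phi> \<in> borel_measurable seq_algebra"
  by (rule word_fun_measurable[OF \<phi>])

lemma birkhoff_sum_measurable [measurable]: "birkhoff_sum \<phi> j \<in> borel_measurable seq_algebra"
  unfolding birkhoff_sum_def[abs_def] by measurable

lemma survives_measurable:
  assumes "word_fun n (\<lambda>y. y \<in> A)"
  shows "{(y, t). survives A t y} \<in> sets (seq_algebra \<Otimes>\<^sub>M borel)"
proof -
  have [measurable]: "A \<in> sets seq_algebra" by (rule word_set_measurable[OF assms])
  have "{(y, t). survives A t y} = {w \<in> space (seq_algebra \<Otimes>\<^sub>M borel). \<forall>j. birkhoff_sum \<phi> j (fst w) \<le> snd w \<longrightarrow> shiftn j (fst w) \<notin> A}"
    by (auto simp: survives_def space_pair_measure space_PiM)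
  also have "\<dots> \<in> sets (seq_algebra \<Otimes>\<^sub>M borel)" by measurable
  finally show ?thesis .
qed

lemma survives_sets:
  assumes "word_fun n (\<lambda>y. y \<in> A)"
  shows "{y. survives A t (shiftn j y)} \<in> sets \<mu>"
proof -
  have "(\<lambda>y. (shiftn j y, t)) -` {(y, t). survives A t y} \<inter> space seq_algebra \<in> sets seq_algebra"
    by (rule measurable_sets[OF _ survives_measurable[OF assms]]) measurable
  then show ?thesis by (simp add: space_PiM sets_\<mu> vimage_def)
qed

end

text \<open>\<open>exp (z * S_k) * h\<close> is a martingale until the hole is hit and vanishes
  there. The bounds \<open>a\<close> and \<open>C\<close> turn its constant expectation into
  two-sided bounds for the survival probability.\<close>

locale eigenfunction = renewal P \<pi> \<mu> \<phi> \<phi>\<^sub>0 x N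
  for P :: "'a::finite \<Rightarrow> 'a \<Rightarrow> real" and \<pi> \<mu> \<phi> \<phi>\<^sub>0 x N +
  fixes A :: "'a seq set" and l :: nat and h :: "'a seq \<Rightarrow> real" and z a C :: real
  assumes A: "word_fun l (\<lambda>y. y \<in> A)" and l: "N \<le> l" and h: "word_fun l h" and z: "z \<ge> 0"
    and h_eq: "\<And>y. y \<notin> A \<Longrightarrow> exp (z * \<phi> y) * push P l h y = h y"
    and h_0: "\<And>y. y \<in> A \<Longrightarrow> h y = 0"
    and h_ge: "\<And>y. y \<notin> A \<Longrightarrow> a \<le> h y" and a: "a > 0"
    and h_le: "\<And>y. h y \<le> C"
begin

lemma l_ge: "l \<ge> 2"
  using l N by simp

lemma h_nonneg: "h y \<ge> 0"
  using h_0[of y] h_ge[of y] a by (cases "y \<in> A") auto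

text \<open>The prefix contains the past \<open>j\<close> letters and the \<open>l\<close> letters
  that decide \<open>h (shiftn j y)\<close> and whether \<open>shiftn j y\<close> lies in the hole;
  each step of the recursion reveals one further letter.\<close>

definition E :: "'a seq \<Rightarrow> nat \<Rightarrow> real \<Rightarrow> 'a seq set" where
  "E y j t = {y' \<in> prefix_set y (j + l). survives A t (shiftn j y')}"

lemma E_sets [measurable]: "E y j t \<in> sets \<mu>"
proof -
  have "E y j t = prefix_set y (j + l) \<inter> {y'. survives A t (shiftn j y')}" by (auto simp: E_def)
  then show ?thesis using prefix_set_sets survives_sets[OF A] by (metis sets.Int)
qed

lemma E_in_hole: "t \<ge> 0 \<Longrightarrow> shiftn j y \<in> A \<Longrightarrow> E y j t = {}"
proof -
  assume t: "t \<ge> 0" and y: "shiftn j y \<in> A"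
  have "shiftn j y' \<in> A" if "y' \<in> prefix_set y (j + l)" for y'
    using word_funD[OF A, of "shiftn j y" "shiftn j y'"] that y by (auto simp: mem_prefix_set shiftn_def)
  then show ?thesis using t by (auto simp: E_def survives_step)
qed

lemma E_off_hole:
  assumes t: "t \<ge> 0" and y: "shiftn j y \<notin> A"
  shows "E y j t = (\<Union>b. E (y(j + l := b)) (Suc j) (t - \<phi> (shiftn j y)))"
proof -
  have "shiftn j y' \<notin> A" "\<phi> (shiftn j y') = \<phi> (shiftn j y)" if "y' \<in> prefix_set y (j + l)" for y'
    using word_funD[OF A, of "shiftn j y" "shiftn j y'"] word_funD[OF \<phi>, of "shiftn j y'" "shiftn j y"] that y l
    by (auto simp: mem_prefix_set shiftn_def)
  then have "E y j t = {y' \<in> prefix_set y (j + l). survives A (t - \<phi> (shiftn j y)) (shiftn (Suc j) y')}"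
    using t by (auto simp: E_def survives_step)
  then show ?thesis
    unfolding prefix_set_eq_UN_Suc[of y "j + l"] by (auto simp: E_def)
qed

lemma measure_E_off_hole:
  assumes t: "t \<ge> 0" and y: "shiftn j y \<notin> A"
  shows "measure \<mu> (E y j t) = (\<Sum>b\<in>UNIV. measure \<mu> (E (y(j + l := b)) (Suc j) (t - \<phi> (shiftn j y))))"
  unfolding E_off_hole[OF assms]
proof (rule finite_measure_finite_Union)
  show "disjoint_family (\<lambda>b. E (y(j + l := b)) (Suc j) (t - \<phi> (shiftn j y)))"
    unfolding disjoint_family_on_def E_def using prefix_set_Suc_disjoint[of _ _ y "j + l"] by fastforce
qed auto

text \<open>The counterpart for \<open>weight * h\<close> of the recursion
  \<open>measure_E_off_hole\<close>.\<close>

lemma sum_weight_h: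
  "(\<Sum>b\<in>UNIV. weight (y(j + l := b)) (Suc j + l) * h (shiftn (Suc j) (y(j + l := b)))) = weight y (j + l) * push P l h (shiftn j y)"
proof -
  have "shiftn (Suc j) (y(j + l := b)) = shiftn 1 ((shiftn j y)(l := b))" for b
    by (auto simp: shiftn_def fun_eq_iff)
  moreover have "weight (y(j + l := b)) (Suc j + l) = weight y (j + l) * P (shiftn j y (l - 1)) b" for b
    using weight_Suc[of "j + l" y b] l_ge by (simp add: shiftn_def add.commute)
  ultimately show ?thesis
    by (simp add: push_def sum_distrib_left mult.assoc)
qed

text \<open>Both sides obey the same recursion, and both vanish in the hole. \<open>n\<close> bounds
  the number of remaining laps, each lasting at least \<open>\<phi>\<^sub>0\<close>. In the last lap
  \<open>E y j t\<close> is a full cylinder, and \<open>a \<le> h y \<le> C\<close> compares it with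
  \<open>h\<close>; the unfinished lap accounts for \<open>exp (z * B)\<close>.\<close>

lemma measure_E_bounds:
  assumes B: "\<And>y. \<phi> y \<le> B" and t: "0 \<le> t" "t < real n * \<phi>\<^sub>0"
  shows "weight y (j + l) * h (shiftn j y) * exp (- z * t) / C \<le> measure \<mu> (E y j t) \<and>
         measure \<mu> (E y j t) \<le> weight y (j + l) * h (shiftn j y) * exp (- z * t) * (exp (z * B) / a)"
  using t
proof (induction n arbitrary: t j y)
  case (Suc n)
  let ?y = "shiftn j y" and ?w = "weight y (j + l)"
  show ?case
  proof (cases "?y \<in> A")
    case True
    then show ?thesis using Suc.prems by (simp add: h_0 E_in_hole)
  next
    case nA: False
    have C: "C > 0" using h_ge[OF nA] h_le[of ?y] a by linarith
    show ?thesis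
    proof (cases "t < \<phi> ?y")
      case True
      then have "E (y(j + l := b)) (Suc j) (t - \<phi> ?y) = prefix_set (y(j + l := b)) (Suc (j + l))" for b
        by (auto simp: E_def survives_neg)
      then have "E y j t = prefix_set y (j + l)"
        unfolding E_off_hole[OF Suc.prems(1) nA] prefix_set_eq_UN_Suc[of y "j + l"] by simp
      then have m: "measure \<mu> (E y j t) = ?w * 1" using l_ge by (simp add: measure_prefix)
      have "h ?y * exp (- z * t) \<le> C * 1"
        using h_le[of ?y] h_nonneg z Suc.prems C by (intro mult_mono) auto
      then have 1: "h ?y * exp (- z * t) / C \<le> 1" using C by (simp add: divide_le_eq)
      have "z * t \<le> z * B" using True B[of ?y] z by (intro mult_left_mono) auto
      then have "a * 1 \<le> h ?y * exp (- z * t + z * B)"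
        using h_ge[OF nA] a by (intro mult_mono) auto
      then have "a \<le> h ?y * exp (- z * t) * exp (z * B)"
        by (simp only: exp_add mult_1_right mult.assoc)
      then have 2: "1 \<le> h ?y * exp (- z * t) * (exp (z * B) / a)"
        using a by (simp add: le_divide_eq)
      show ?thesis
        using mult_left_mono[OF 1 weight_nonneg[of y "j + l"]] mult_left_mono[OF 2 weight_nonneg[of y "j + l"]]
        unfolding m by (simp add: mult.assoc)
    next
      case False
      let ?t = "t - \<phi> ?y"
      have t: "0 \<le> ?t" "?t < real n * \<phi>\<^sub>0" using False Suc.prems \<phi>_ge[of ?y] by (auto simp: algebra_simps)
      have e: "?w * push P l h ?y * exp (- z * ?t) = ?w * h ?y * exp (- z * t)"
      proof -
        have "exp (- z * ?t) = exp (z * \<phi> ?y) * exp (- z * t)"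
          by (simp add: algebra_simps flip: exp_add)
        then show ?thesis unfolding h_eq[OF nA, symmetric] by (simp add: mult_ac)
      qed
      note IH = Suc.IH[OF t, of _ "Suc j"]
      have "(\<Sum>b\<in>UNIV. weight (y(j + l := b)) (Suc j + l) * h (shiftn (Suc j) (y(j + l := b))) * exp (- z * ?t) / C) \<le> measure \<mu> (E y j t)"
        unfolding measure_E_off_hole[OF Suc.prems(1) nA] by (intro sum_mono) (use IH in blast)
      moreover have "measure \<mu> (E y j t) \<le> (\<Sum>b\<in>UNIV. weight (y(j + l := b)) (Suc j + l) * h (shiftn (Suc j) (y(j + l := b))) * exp (- z * ?t) * (exp (z * B) / a))"
        unfolding measure_E_off_hole[OF Suc.prems(1) nA] by (intro sum_mono) (use IH in blast)
      ultimately show ?thesis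
        unfolding sum_divide_distrib[symmetric] sum_distrib_right[symmetric] sum_weight_h e by blast
    qed
  qed
qed simp

text \<open>The survivors of the flow lie between two boxes over survivors in the base: starting at
  height below \<open>\<phi>\<^sub>0\<close> advances the clock by at most
  \<open>\<phi>\<^sub>0\<close>, and no fibre is higher than \<open>B\<close>. Such constants do not
  affect the exponential rate. The word \<open>v\<close> keeps the lower bound positive.\<close>

lemma escape_rate:
  assumes v: "v \<notin> A" "weight v l > 0"
  shows "has_escape_rate P \<mu> (Sigma_P P \<inter> A) \<phi> z"
proof -
  obtain B where B: "\<And>y. \<bar>\<phi> y\<bar> \<le> B" "B > 0" using word_fun_bounded[OF \<phi>] by blast
  have B': "\<phi> y \<le> B" for y using B(1)[of y] by simp
  have C: "C > 0" using h_ge[OF v(1)] h_le[of v] a by linarith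
  let ?E = "\<lambda>t. {y. survives A t y}"
  let ?S = "\<lambda>t. survivor_set P \<phi> (Sigma_P P \<inter> A) t"
  have surv_sets: "?E t \<in> sets \<mu>" for t using survives_sets[OF A, of t 0] by simp
  have S: "?S t = {(y, s). y \<in> Sigma_P P \<and> 0 \<le> s \<and> s < \<phi> y \<and> survives A (s + t) y}" if "t \<ge> 0" for t
  proof -
    have "shiftn j y \<in> Sigma_P P" if "y \<in> Sigma_P P" for j y
      using that by (auto simp: Sigma_P_def shiftn_def)
    then have "y \<in> Sigma_P P \<Longrightarrow> survives (Sigma_P P \<inter> A) t y \<longleftrightarrow> survives A t y" for y t
      by (auto simp: survives_def)
    then show ?thesis unfolding survivor_set_eq[OF that] by auto
  qed
  have S_sets: "?S t \<in> sets (\<mu> \<Otimes>\<^sub>M lborel)" if "t \<ge> 0" for t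
  proof -
    have sets_eq: "sets (\<mu> \<Otimes>\<^sub>M lborel) = sets (seq_algebra \<Otimes>\<^sub>M borel)"
      by (intro sets_pair_measure_cong sets_\<mu> sets_lborel)
    have [measurable]: "Sigma_P P \<in> sets seq_algebra" by (rule Sigma_P_measurable)
    have "(\<lambda>(y, s). (y, s + t)) -` {(y, t). survives A t y} \<inter> space (seq_algebra \<Otimes>\<^sub>M borel) \<in> sets (seq_algebra \<Otimes>\<^sub>M borel)"
      by (rule measurable_sets[OF _ survives_measurable[OF A]]) measurable
    moreover have "{w \<in> space (seq_algebra \<Otimes>\<^sub>M borel). fst w \<in> Sigma_P P \<and> 0 \<le> snd w \<and> snd w < \<phi> (fst w)} \<in> sets (seq_algebra \<Otimes>\<^sub>M borel)"
      by measurable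
    ultimately have "((\<lambda>(y, s). (y, s + t)) -` {(y, t). survives A t y} \<inter> space (seq_algebra \<Otimes>\<^sub>M borel)) \<inter>
      {w \<in> space (seq_algebra \<Otimes>\<^sub>M borel). fst w \<in> Sigma_P P \<and> 0 \<le> snd w \<and> snd w < \<phi> (fst w)} \<in> sets (seq_algebra \<Otimes>\<^sub>M borel)"
      by (rule sets.Int)
    also have "((\<lambda>(y, s). (y, s + t)) -` {(y, t). survives A t y} \<inter> space (seq_algebra \<Otimes>\<^sub>M borel)) \<inter>
      {w \<in> space (seq_algebra \<Otimes>\<^sub>M borel). fst w \<in> Sigma_P P \<and> 0 \<le> snd w \<and> snd w < \<phi> (fst w)} = ?S t"
      unfolding S[OF that] by (auto simp: space_pair_measure space_PiM)
    finally show ?thesis unfolding sets_eq .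
  qed
  have box: "emeasure (\<mu> \<Otimes>\<^sub>M lborel) (F \<times> {0..<k}) = ennreal (measure \<mu> F * k)" if "F \<in> sets \<mu>" "k > 0" for F and k :: real
    using that by (subst lborel.emeasure_pair_measure_Times) (auto simp: emeasure_eq_measure ennreal_mult)
  have S_upper: "emeasure (\<mu> \<Otimes>\<^sub>M lborel) (?S t) \<le> ennreal (measure \<mu> (?E t) * B)" if t: "t \<ge> 0" for t
  proof -
    have "?S t \<subseteq> ?E t \<times> {0..<B}"
    proof
      fix w assume "w \<in> ?S t"
      then obtain y s where w: "w = (y, s)" "0 \<le> s" "s < \<phi> y" "survives A (s + t) y"
        unfolding S[OF t] by auto
      then show "w \<in> ?E t \<times> {0..<B}"
        using B'[of y] survives_antimono[of t "s + t" A y] by auto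
    qed
    then show ?thesis
      using emeasure_mono[of "?S t" "?E t \<times> {0..<B}" "\<mu> \<Otimes>\<^sub>M lborel"] box[OF surv_sets B(2)] surv_sets by auto
  qed
  have S_lower: "ennreal (measure \<mu> (?E (t + \<phi>\<^sub>0)) * \<phi>\<^sub>0) \<le> emeasure (\<mu> \<Otimes>\<^sub>M lborel) (?S t)" if "t \<ge> 0" for t
  proof -
    have s: "?E (t + \<phi>\<^sub>0) \<inter> Sigma_P P \<in> sets \<mu>" using surv_sets by auto
    have "measure \<mu> (?E (t + \<phi>\<^sub>0) \<inter> Sigma_P P) = measure \<mu> (?E (t + \<phi>\<^sub>0))"
      by (rule finite_measure_eq_AE) (use AE_Sigma surv_sets s in auto)
    moreover have "(?E (t + \<phi>\<^sub>0) \<inter> Sigma_P P) \<times> {0..<\<phi>\<^sub>0} \<subseteq> ?S t"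
    proof -
      have "s < \<phi> y" "survives A (s + t) y" if "survives A (t + \<phi>\<^sub>0) y" "s < \<phi>\<^sub>0" for y s
        using that \<phi>_ge[of y] survives_antimono[of "s + t" "t + \<phi>\<^sub>0" A y] by auto
      then show ?thesis unfolding S[OF that] by auto
    qed
    ultimately show ?thesis
      using emeasure_mono[OF _ S_sets[OF that]] box[OF s \<phi>\<^sub>0] by metis
  qed
  have m_bounds: "measure \<mu> (?E (t + \<phi>\<^sub>0)) * \<phi>\<^sub>0 \<le> measure (\<mu> \<Otimes>\<^sub>M lborel) (?S t)"
    "measure (\<mu> \<Otimes>\<^sub>M lborel) (?S t) \<le> measure \<mu> (?E t) * B" if "t \<ge> 0" for t
  proof -
    have fin: "emeasure (\<mu> \<Otimes>\<^sub>M lborel) (?S t) = ennreal (measure (\<mu> \<Otimes>\<^sub>M lborel) (?S t))"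
      using S_upper[OF that] by (intro emeasure_eq_ennreal_measure) (auto simp: top_unique)
    show "measure \<mu> (?E (t + \<phi>\<^sub>0)) * \<phi>\<^sub>0 \<le> measure (\<mu> \<Otimes>\<^sub>M lborel) (?S t)"
      using S_lower[OF that] unfolding fin by simp
    show "measure (\<mu> \<Otimes>\<^sub>M lborel) (?S t) \<le> measure \<mu> (?E t) * B"
      using S_upper[OF that] B(2) unfolding fin by (simp add: ennreal_le_iff)
  qed
  have E_lower: "weight v l * h v / C * exp (- z * t) \<le> measure \<mu> (?E t)" if "t \<ge> 0" for t
  proof -
    obtain n where "t < real n * \<phi>\<^sub>0" using reals_Archimedean3[OF \<phi>\<^sub>0] by blast
    from measure_E_bounds[OF B' that this, of v 0]
    have "weight v l * h v / C * exp (- z * t) \<le> measure \<mu> (E v 0 t)" by simp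
    also have "\<dots> \<le> measure \<mu> (?E t)" by (intro finite_measure_mono surv_sets) (auto simp: E_def)
    finally show ?thesis .
  qed
  define K where "K = (\<Sum>w\<in>words l. weight w l * h w) * (exp (z * B) / a)"
  have E_upper: "measure \<mu> (?E t) \<le> K * exp (- z * t)" if "t \<ge> 0" for t
  proof -
    obtain n where n: "t < real n * \<phi>\<^sub>0" using reals_Archimedean3[OF \<phi>\<^sub>0] by blast
    have "?E t \<subseteq> (\<Union>w\<in>words l. E w 0 t)"
    proof
      fix y assume y: "y \<in> ?E t"
      have "y \<in> (\<Union>w\<in>words l. prefix_set w l)" by (simp only: UN_prefix_set_words UNIV_I)
      then obtain w where "w \<in> words l" "y \<in> prefix_set w l" by (rule UN_E)
      then show "y \<in> (\<Union>w\<in>words l. E w 0 t)" using y by (intro UN_I[of w]) (auto simp: E_def)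
    qed
    then have "measure \<mu> (?E t) \<le> measure \<mu> (\<Union>w\<in>words l. E w 0 t)"
      by (rule finite_measure_mono) (intro sets.finite_UN finite_words E_sets)
    also have "\<dots> \<le> (\<Sum>w\<in>words l. measure \<mu> (E w 0 t))"
      by (rule finite_measure_subadditive_finite[OF finite_words]) (rule image_subsetI, rule E_sets)
    also have "\<dots> \<le> (\<Sum>w\<in>words l. weight w l * h w * exp (- z * t) * (exp (z * B) / a))"
      using measure_E_bounds[OF B' that n, of _ 0] by (intro sum_mono) simp
    also have "\<dots> = K * exp (- z * t)" 
      unfolding K_def sum_distrib_right by (intro sum.cong refl) (simp add: mult_ac)
    finally show ?thesis .
  qed
  show ?thesis unfolding has_escape_rate_def
  proof (rule exponential_rate[where k\<^sub>1 = "weight v l * h v / C * exp (- z * \<phi>\<^sub>0) * \<phi>\<^sub>0" and k\<^sub>2 = "K * B"])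
    fix t :: real assume t: "t \<ge> 0"
    have "weight v l * h v / C * exp (- z * \<phi>\<^sub>0) * \<phi>\<^sub>0 * exp (- z * t) = (weight v l * h v / C * exp (- z * (t + \<phi>\<^sub>0))) * \<phi>\<^sub>0"
    proof -
      have "exp (- z * (t + \<phi>\<^sub>0)) = exp (- z * \<phi>\<^sub>0) * exp (- z * t)"
        by (simp add: algebra_simps flip: exp_add)
      then show ?thesis by (simp only: mult_ac)
    qed
    also have "\<dots> \<le> measure \<mu> (?E (t + \<phi>\<^sub>0)) * \<phi>\<^sub>0"
      using E_lower[of "t + \<phi>\<^sub>0"] t \<phi>\<^sub>0 by (intro mult_right_mono) auto
    also have "\<dots> \<le> measure (\<mu> \<Otimes>\<^sub>M lborel) (?S t)" by (rule m_bounds[OF t])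
    finally show "weight v l * h v / C * exp (- z * \<phi>\<^sub>0) * \<phi>\<^sub>0 * exp (- z * t) \<le> measure (\<mu> \<Otimes>\<^sub>M lborel) (?S t)" .
    have "measure (\<mu> \<Otimes>\<^sub>M lborel) (?S t) \<le> measure \<mu> (?E t) * B" by (rule m_bounds[OF t])
    also have "\<dots> \<le> (K * exp (- z * t)) * B" using E_upper[OF t] B(2) by (intro mult_right_mono) auto
    finally show "measure (\<mu> \<Otimes>\<^sub>M lborel) (?S t) \<le> K * B * exp (- z * t)" by (simp add: mult_ac)
  next
    have "h v > 0" using h_ge[OF v(1)] a by linarith
    then show "weight v l * h v / C * exp (- z * \<phi>\<^sub>0) * \<phi>\<^sub>0 > 0" using v C \<phi>\<^sub>0 by simp
  qed
qed

end

section \<open>The eigenfunction of a periodic hole\<close>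

lemma prod_lessThan_add:
  fixes f :: "nat \<Rightarrow> 'b::comm_monoid_mult"
  shows "(\<Prod>k<m + n. f k) = (\<Prod>k<m. f k) * (\<Prod>k<n. f (m + k))"
  by (induction n) (simp_all add: mult_ac)

text \<open>\<open>N\<close> is a multiple of \<open>p\<close>, so that a hole of \<nu> periods
  exceeds \<open>W\<close> by whole periods and carries \<open>x\<close> to \<open>x\<close> when
  these are dropped.\<close>

locale periodic_point = renewal P \<pi> \<mu> \<phi> \<phi>\<^sub>0 x N
  for P :: "'a::finite \<Rightarrow> 'a \<Rightarrow> real" and \<pi> \<mu> \<phi> \<phi>\<^sub>0 x N +
  fixes p n\<^sub>0 :: nat
  assumes p: "p \<ge> 1" and periodic: "shiftn p x = x"
    and prime_period: "\<And>r. 0 < r \<Longrightarrow> r < p \<Longrightarrow> shiftn r x \<noteq> x"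
    and reduced: "reduced_word P x p"
    and N_eq: "N = n\<^sub>0 * p" and n\<^sub>0: "n\<^sub>0 \<ge> 2"
begin

definition c :: real where "c = (\<Prod>i<p. P (x i) (x (Suc i)))"
definition s :: real where "s = birkhoff_sum \<phi> p x"
text \<open>The transition into the last letter of the period, read off in the second period so that
  the natural subtraction is also exact for \<open>p = 1\<close>.\<close>

definition q :: real where "q = P (x (2 * p - 2)) (x (2 * p - 1))"

lemma N_ge: "N \<ge> 2 * p"
  using N_eq n\<^sub>0 by simp

lemma x_add_p: "x (i + p) = x i"
  using fun_cong[OF periodic, of i] by (simp add: shiftn_def)

lemma x_add_mult_p: "x (i + k * p) = x i"
proof (induction k)
  case (Suc k)
  have "x (i + Suc k * p) = x (i + k * p + p)" by (simp add: algebra_simps)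
  then show ?case using Suc x_add_p by metis
qed simp

lemma shiftn_mult_p: "shiftn (k * p) x = x"
  by (simp add: shiftn_def x_add_mult_p)

lemma x_mod_p: "x (i mod p) = x i"
  using x_add_mult_p[of "i mod p" "i div p"] by simp

text \<open>By periodicity \<open>p\<close> matching letters make \<open>x\<close> invariant under
  the shift by \<open>i mod p\<close>, which contradicts primality of the period unless that
  remainder is zero.\<close>

lemma dvd_of_match:
  assumes "\<And>m. m < p \<Longrightarrow> x (m + i) = x m"
  shows "p dvd i"
proof (rule ccontr)
  assume "\<not> p dvd i"
  then have r: "0 < i mod p" "i mod p < p" using p by (auto simp: mod_eq_0_iff_dvd[symmetric])
  have "x (m + i mod p) = x m" for m
  proof -
    have "x (m + i mod p) = x (m + i)" using x_mod_p[of "m + i mod p"] x_mod_p[of "m + i"] by (simp add: mod_add_right_eq)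
    also have "\<dots> = x (m mod p + i)" using x_mod_p[of "m mod p + i"] x_mod_p[of "m + i"] by (simp add: mod_add_left_eq)
    also have "\<dots> = x (m mod p)" using assms p by simp
    finally show ?thesis by (simp add: x_mod_p)
  qed
  then have "shiftn (i mod p) x = x" by (simp add: shiftn_def)
  then show False using prime_period r by blast
qed

text \<open>Rotation invariance: moving the start by one trades the first factor for the equal
  factor one period later, and positivity permits cancelling it.\<close>

lemma prod_period: "(\<Prod>k<p. P (x (a + k)) (x (Suc (a + k)))) = c"
proof (induction a)
  case 0
  then show ?case by (simp add: c_def)
next
  case (Suc a)
  define g where "g = (\<lambda>k. P (x (a + k)) (x (Suc (a + k))))"
  have "g 0 * (\<Prod>k<p. g (Suc k)) = (\<Prod>k<p. g k) * g p"
    by (simp flip: prod.lessThan_Suc_shift)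
  moreover have "g p = g 0" using x_add_p[of a] x_add_p[of "Suc a"] by (simp add: g_def)
  moreover have "g 0 > 0" using x_step by (simp add: g_def)
  ultimately have "(\<Prod>k<p. g (Suc k)) = (\<Prod>k<p. g k)" by simp
  then show ?case using Suc by (simp add: g_def)
qed

lemma c_pos: "c > 0"
  unfolding c_def by (intro prod_pos) (simp add: x_step)

text \<open>For \<open>p \<ge> 2\<close> reducedness gives a competing last letter of positive
  probability. For \<open>p = 1\<close> it only says that another letter exists; then irreducibility
  forbids \<open>x 0\<close> to be absorbing.\<close>

lemma q_less_1: "q < 1"
proof (cases "p = 1")
  case True
  obtain a where a: "a \<noteq> x 0" using reduced True by (auto simp: reduced_word_def)
  have "P (x 0) (x 0) < 1"
  proof (rule ccontr)
    assume "\<not> P (x 0) (x 0) < 1"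
    then have z: "P (x 0) b = 0" if "b \<noteq> x 0" for b
      using P_less_1[of "x 0" b "x 0"] P_nonneg[of "x 0" b] that by linarith
    have "mpow P n (x 0) b = 0" if "b \<noteq> x 0" for n b
      using that
    proof (induction n arbitrary: b)
      case (Suc n)
      have "mpow P n (x 0) d * P d b = 0" for d
        using Suc z by (cases "d = x 0") auto
      then show ?case by (simp only: mpow.simps(2) sum.neutral_const)
    qed simp
    then have "mpow P n (x 0) a = 0" for n using a by blast
    then show False using irreducible by (metis less_irrefl stochastic_irreducible_def)
  qed
  moreover have "q = P (x 0) (x 0)" unfolding q_def using True x_add_p[of 0] by simp
  ultimately show ?thesis by simp
next
  case False
  then have p2: "p \<ge> 2" using p by simp
  obtain a where a: "a \<noteq> x (p - 1)" "admissible_word P (x(p - 1 := a)) p"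
    using reduced by (auto simp: reduced_word_def)
  obtain k where k: "p = Suc (Suc k)" using p2 by (metis add_2_eq_Suc le_Suc_ex)
  have "P (x (p - 2)) a > 0"
    using a(2)[unfolded admissible_word_def, rule_format, of k] by (simp add: k)
  then have "P (x (p - 2)) (x (p - 1)) < 1" using P_less_1 a(1) by blast
  moreover have "2 * p - 2 = (p - 2) + p" "2 * p - 1 = (p - 1) + p" using p2 by auto
  ultimately show ?thesis unfolding q_def by (simp only: x_add_p)
qed

lemma c_less_1: "c < 1"
proof -
  obtain k where k: "p = Suc k" using p by (cases p) auto
  have 1: "2 * p - 1 = Suc (2 * p - 2)" using p by simp
  have "c = (\<Prod>i<Suc k. P (x (2 * p - 2 + i)) (x (Suc (2 * p - 2 + i))))"
    using prod_period[of "2 * p - 2"] k by simp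
  also have "\<dots> = q * (\<Prod>i<k. P (x (2 * p - 2 + Suc i)) (x (Suc (2 * p - 2 + Suc i))))"
    unfolding prod.lessThan_Suc_shift q_def 1 by simp
  also have "\<dots> \<le> q * 1"
    using P_le_1 by (intro mult_left_mono prod_le_1) (auto simp: q_def)
  finally show ?thesis using q_less_1 by simp
qed

lemma birkhoff_sum_x: "birkhoff_sum \<phi> (j * p) x = j * s"
proof (induction j)
  case (Suc j)
  have "birkhoff_sum \<phi> (Suc j * p) x = birkhoff_sum \<phi> (j * p + p) x" by (simp add: add.commute)
  also have "\<dots> = birkhoff_sum \<phi> (j * p) x + s" by (simp only: birkhoff_sum_add shiftn_mult_p s_def)
  finally show ?case using Suc by (simp add: algebra_simps)
qed simp

lemma s_pos: "s > 0"
  unfolding s_def birkhoff_sum_def using p \<phi>_pos by (intro sum_pos) (auto simp: lessThan_empty_iff)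

text \<open>Supplies a word of positive measure outside the hole: every letter has some successor of
  positive probability.\<close>

lemma ex_admissible_off_x: "\<exists>v. v 0 \<noteq> x 0 \<and> weight v n > 0"
proof -
  obtain a where a: "a \<noteq> x 0" using reduced by (auto simp: reduced_word_def) metis
  define v where "v = rec_nat a (\<lambda>_ b. SOME b'. P b b' > 0)"
  have "\<exists>b. P a b > 0" for a
    using P_row_sum[of a] by (metis not_less sum_nonpos zero_less_one)
  then have "P a (SOME b. P a b > 0) > 0" for a by (rule someI_ex)
  then have "P (v i) (v (Suc i)) > 0" for i by (simp add: v_def)
  then have "weight v n > 0" unfolding weight_def by (intro mult_pos_pos \<pi>_pos prod_pos) auto
  moreover have "v 0 = a" by (simp add: v_def)
  ultimately show ?thesis using a by blast
qed

end

section \<open>The martingale of a fixed hole at a fixed parameter\<close>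

locale periodic_hole = periodic_point P \<pi> \<mu> \<phi> \<phi>\<^sub>0 x N p n\<^sub>0
  for P :: "'a::finite \<Rightarrow> 'a \<Rightarrow> real" and \<pi> \<mu> \<phi> \<phi>\<^sub>0 x N p n\<^sub>0 +
  fixes \<nu> :: nat and z R :: real and H :: "'a seq \<Rightarrow> real"
  assumes \<nu>: "\<nu> > n\<^sub>0" and z: "z \<ge> 0" and R: "R \<ge> 1"
    and H: "word_fun N H" and H_ge: "\<And>y. H y \<ge> 1" and H_W: "\<And>y. y \<in> W \<Longrightarrow> H y = 1"
    and push_H: "\<And>y. exp (z * \<phi> y) * push P N H y = H y + (if y \<in> W then R - 1 else 0)"
begin

definition l :: nat where "l = \<nu> * p"
definition J :: nat where "J = \<nu> - n\<^sub>0"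
definition A :: "'a seq set" where "A = prefix_set x l"

lemma l_eq: "l = N + J * p"
  using \<nu> by (simp add: l_def J_def N_eq flip: distrib_right)

text \<open>Probability that the last \<open>i\<close> letters of the word \<open>x 0, \<dots>, x (l - 1)\<close> follow its first \<open>l - i\<close> letters.\<close>

definition tail :: "nat \<Rightarrow> real" where
  "tail i = (\<Prod>k<i. P (x (l - 2 - k)) (x (l - 1 - k)))"

lemma tail_nonneg: "tail i \<ge> 0"
  unfolding tail_def by (intro prod_nonneg) auto

text \<open>The extra factors run backwards through one full period, so reversing them gives the
  cyclic product. The hypothesis keeps the natural subtractions exact.\<close>

lemma tail_add_p:
  assumes "i + p < l"
  shows "tail (i + p) = c * tail i"
proof -
  define g where "g = (\<lambda>k. P (x (l - 1 - i - p + k)) (x (Suc (l - 1 - i - p + k))))"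
  have "tail (i + p) = tail i * (\<Prod>k<p. P (x (l - 2 - (i + k))) (x (l - 1 - (i + k))))"
    unfolding tail_def by (rule prod_lessThan_add)
  also have "(\<Prod>k<p. P (x (l - 2 - (i + k))) (x (l - 1 - (i + k)))) = (\<Prod>k<p. g (p - Suc k))"
  proof (intro prod.cong refl)
    fix k assume "k \<in> {..<p}"
    then have "l - 2 - (i + k) = l - 1 - i - p + (p - Suc k)" "l - 1 - (i + k) = Suc (l - 1 - i - p + (p - Suc k))"
      using assms by auto
    then show "P (x (l - 2 - (i + k))) (x (l - 1 - (i + k))) = g (p - Suc k)"
      by (simp only: g_def)
  qed
  also have "\<dots> = (\<Prod>k<p. g k)" by (rule prod.nat_diff_reindex)
  also have "\<dots> = c" unfolding g_def by (rule prod_period)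
  finally show ?thesis by simp
qed

lemma tail_add_mult_p: "i + j * p < l \<Longrightarrow> tail (i + j * p) = c ^ j * tail i"
proof (induction j)
  case (Suc j)
  then show ?case using tail_add_p[of "i + j * p"] by (simp add: algebra_simps)
qed simp

lemma tail_mult_p: "j * p < l \<Longrightarrow> tail (j * p) = c ^ j"
  using tail_add_mult_p[of 0 j] by (simp add: tail_def)

text \<open>The first factor is the transition into the last letter of the hole, which periodicity
  identifies with \<open>q\<close>.\<close>

lemma tail_le_q:
  assumes "i \<ge> 1"
  shows "tail i \<le> q"
proof -
  obtain k where k: "i = Suc k" using assms by (cases i) auto
  have \<nu>2: "\<nu> \<ge> 2" using \<nu> n\<^sub>0 by simp
  have "l = 2 * p + (\<nu> - 2) * p" using \<nu>2 unfolding l_def by (metis le_add_diff_inverse distrib_right)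
  then have "l - 2 = (2 * p - 2) + (\<nu> - 2) * p" "l - 1 = (2 * p - 1) + (\<nu> - 2) * p" using p by auto
  then have "P (x (l - 2)) (x (l - 1)) = q" by (simp only: x_add_mult_p q_def)
  then have "tail i = q * (\<Prod>j<k. P (x (l - 2 - Suc j)) (x (l - 1 - Suc j)))"
    unfolding k tail_def prod.lessThan_Suc_shift by simp
  also have "\<dots> \<le> q * 1"
    using P_le_1 by (intro mult_left_mono prod_le_1) (auto simp: q_def)
  finally show ?thesis by simp
qed

definition matches :: "nat \<Rightarrow> 'a seq \<Rightarrow> bool" where
  "matches i y \<longleftrightarrow> (\<forall>m<l - i. y (i + m) = x m)"

text \<open>Conditional probability of \<open>shiftn i y \<in> A\<close> given \<open>y 0, \<dots>, y (l - 1)\<close>.\<close>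

definition hit :: "nat \<Rightarrow> 'a seq \<Rightarrow> real" where
  "hit i y = (if matches i y then tail i else 0)"

text \<open>Tower property: of all new letters only \<open>x (l - Suc i)\<close> keeps the match
  alive, and its transition probability is the additional factor of
  \<open>tail (Suc i)\<close>.\<close>

lemma push_hit:
  assumes i: "Suc i < l"
  shows "push P l (hit i) y = hit (Suc i) y"
proof -
  have m: "matches i (shiftn 1 (y(l := b))) \<longleftrightarrow> matches (Suc i) y \<and> b = x (l - Suc i)" for b
  proof
    assume *: "matches i (shiftn 1 (y(l := b)))"
    have "y (Suc i + m) = x m" if m: "m < l - Suc i" for m
    proof -
      have "m < l - i" "i + m + 1 \<noteq> l" using m by auto
      then show ?thesis using *[unfolded matches_def, rule_format, of m] by (simp add: shiftn_def)
    qed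
    moreover have "b = x (l - Suc i)"
      using *[unfolded matches_def, rule_format, of "l - Suc i"] i by (simp add: shiftn_def)
    ultimately show "matches (Suc i) y \<and> b = x (l - Suc i)" by (simp add: matches_def)
  next
    assume *: "matches (Suc i) y \<and> b = x (l - Suc i)"
    show "matches i (shiftn 1 (y(l := b)))" unfolding matches_def
    proof (intro allI impI)
      fix m assume "m < l - i"
      then consider "m < l - Suc i" | "m = l - Suc i" by linarith
      then show "shiftn 1 (y(l := b)) (i + m) = x m"
        by cases (use * i in \<open>auto simp: matches_def shiftn_def\<close>)
    qed
  qed
  have push: "push P l (hit i) y = (\<Sum>b\<in>UNIV. if matches (Suc i) y \<and> b = x (l - Suc i) then P (y (l - 1)) b * tail i else 0)"
    unfolding push_def hit_def m by (intro sum.cong) auto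
  show ?thesis
  proof (cases "matches (Suc i) y")
    case True
    have "Suc i + (l - 2 - i) = l - 1" "l - 2 - i < l - Suc i" using i by auto
    then have "y (l - 1) = x (l - 2 - i)" using True unfolding matches_def by metis
    then show ?thesis unfolding push using True by (simp add: hit_def tail_def)
  next
    case False
    then show ?thesis unfolding push by (simp add: hit_def)
  qed
qed

lemma \<phi>_shiftn_upd: "k + N \<le> l \<Longrightarrow> \<phi> (shiftn k (y(l := b))) = \<phi> (shiftn k y)"
  by (rule word_funD[OF \<phi>]) (auto simp: shiftn_def)

text \<open>Under the bound on \<open>i\<close>, the sum over \<open>shiftn 1 y\<close> reads no
  letter beyond the window, so the tilt leaves \<open>push\<close>.\<close>

lemma push_exp_birkhoff:
  assumes "i + N \<le> l"
  shows "exp (z * \<phi> y) * push P l (\<lambda>v. exp (z * birkhoff_sum \<phi> i v) * f v) y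
       = exp (z * birkhoff_sum \<phi> (Suc i) y) * push P l f y"
proof -
  have "birkhoff_sum \<phi> i (shiftn 1 (y(l := b))) = birkhoff_sum \<phi> i (shiftn 1 y)" for b
    unfolding birkhoff_sum_def using assms by (intro sum.cong) (auto simp: \<phi>_shiftn_upd)
  then have "push P l (\<lambda>v. exp (z * birkhoff_sum \<phi> i v) * f v) y = exp (z * birkhoff_sum \<phi> i (shiftn 1 y)) * push P l f y"
    by (simp add: push_def sum_distrib_left mult_ac)
  then show ?thesis
    by (simp add: birkhoff_sum_Suc_shift distrib_left exp_add)
qed

lemma push_H_shiftn: "push P l (\<lambda>v. H (shiftn (J * p) v)) y = push P N H (shiftn (J * p) y)"
proof -
  have "shiftn (J * p) (shiftn 1 (y(l := b))) = shiftn 1 ((shiftn (J * p) y)(N := b))" for b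
    by (auto simp: shiftn_def fun_eq_iff l_eq)
  moreover have "shiftn (J * p) y (N - 1) = y (l - 1)" using N by (simp add: shiftn_def l_eq)
  ultimately show ?thesis by (simp add: push_def)
qed

text \<open>The first term alone violates the martingale equation whenever \<open>W\<close> is
  visited at step \<open>J * p\<close>. The sum transports this defect back to step
  \<open>0\<close>, that is, onto the hole.\<close>

definition h :: "'a seq \<Rightarrow> real" where
  "h y = c ^ J * (exp (z * birkhoff_sum \<phi> (J * p) y) * H (shiftn (J * p) y))
       - (R - 1) * (\<Sum>i<J * p. exp (z * birkhoff_sum \<phi> i y) * hit i y)"

lemma word_fun_h: "word_fun l h"
proof (rule word_funI)
  fix y y' :: "'a seq" assume e: "\<And>i. i < l \<Longrightarrow> y i = y' i"
  have S: "birkhoff_sum \<phi> i y = birkhoff_sum \<phi> i y'" if "i \<le> J * p" for i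
    using that by (intro word_funD[OF word_fun_birkhoff_sum[OF \<phi>, of i]] e) (simp add: l_eq)
  have "H (shiftn (J * p) y) = H (shiftn (J * p) y')"
    by (rule word_funD[OF H]) (simp add: shiftn_def e l_eq)
  moreover have "hit i y = hit i y'" for i
    using e by (simp add: hit_def matches_def less_diff_conv add.commute)
  ultimately show "h y = h y'" using S unfolding h_def by (intro arg_cong2[where f = "(-)"] arg_cong2[where f = "(*)"] sum.cong refl) auto
qed

lemma matches_0: "matches 0 y \<longleftrightarrow> y \<in> A"
  by (simp add: matches_def A_def mem_prefix_set)

lemma matches_J: "matches (J * p) y \<longleftrightarrow> shiftn (J * p) y \<in> W"
  by (simp add: matches_def W_def mem_prefix_set shiftn_def l_eq add.commute)

text \<open>Applying the operator moves each summand from \<open>i\<close> to \<open>Suc i\<close>.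
  The new summand at \<open>J * p\<close> cancels the defect of \<open>H\<close> on
  \<open>W\<close>, as \<open>hit (J * p) y\<close> equals \<open>c ^ J\<close> there; the lost
  summand at \<open>0\<close> is the indicator of the hole.\<close>

lemma push_h: "exp (z * \<phi> y) * push P l h y = h y + (if y \<in> A then R - 1 else 0)"
proof -
  define G where "G = (\<lambda>i. exp (z * birkhoff_sum \<phi> i y) * hit i y)"
  have Jl: "J * p < l" using l_eq N by simp
  have "push P l h y = c ^ J * push P l (\<lambda>v. exp (z * birkhoff_sum \<phi> (J * p) v) * H (shiftn (J * p) v)) y
       - (R - 1) * (\<Sum>i<J * p. push P l (\<lambda>v. exp (z * birkhoff_sum \<phi> i v) * hit i v) y)"
    unfolding h_def by (simp only: push_diff push_cmult push_sum)
  then have "exp (z * \<phi> y) * push P l h y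
     = c ^ J * (exp (z * \<phi> y) * push P l (\<lambda>v. exp (z * birkhoff_sum \<phi> (J * p) v) * H (shiftn (J * p) v)) y)
       - (R - 1) * (\<Sum>i<J * p. exp (z * \<phi> y) * push P l (\<lambda>v. exp (z * birkhoff_sum \<phi> i v) * hit i v) y)"
    by (simp add: right_diff_distrib sum_distrib_left mult_ac)
  also have "(\<Sum>i<J * p. exp (z * \<phi> y) * push P l (\<lambda>v. exp (z * birkhoff_sum \<phi> i v) * hit i v) y) = (\<Sum>i<J * p. G (Suc i))"
  proof (intro sum.cong refl)
    fix i assume "i \<in> {..<J * p}"
    then have "i + N \<le> l" "Suc i < l" using l_eq N by auto
    then show "exp (z * \<phi> y) * push P l (\<lambda>v. exp (z * birkhoff_sum \<phi> i v) * hit i v) y = G (Suc i)"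
      by (simp add: push_exp_birkhoff push_hit G_def)
  qed
  also have "\<dots> = (\<Sum>i<J * p. G i) + G (J * p) - G 0"
    using sum.lessThan_Suc_shift[of G "J * p"] by simp
  also have "exp (z * \<phi> y) * push P l (\<lambda>v. exp (z * birkhoff_sum \<phi> (J * p) v) * H (shiftn (J * p) v)) y
     = exp (z * birkhoff_sum \<phi> (J * p) y) * (exp (z * \<phi> (shiftn (J * p) y)) * push P N H (shiftn (J * p) y))"
    by (subst push_exp_birkhoff) (simp_all add: l_eq push_H_shiftn[unfolded l_eq] birkhoff_sum_Suc distrib_left exp_add)
  also have "\<dots> = exp (z * birkhoff_sum \<phi> (J * p) y) * (H (shiftn (J * p) y) + (if shiftn (J * p) y \<in> W then R - 1 else 0))"
    unfolding push_H ..
  also have "c ^ J * \<dots> = c ^ J * (exp (z * birkhoff_sum \<phi> (J * p) y) * H (shiftn (J * p) y)) + (R - 1) * G (J * p)"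
  proof -
    have "hit (J * p) y = (if shiftn (J * p) y \<in> W then c ^ J else 0)"
      by (simp only: hit_def matches_J tail_mult_p[OF Jl])
    then show ?thesis by (simp add: G_def algebra_simps)
  qed
  also have "G 0 = (if y \<in> A then 1 else 0)" by (simp add: G_def hit_def matches_0 tail_def)
  finally have eq: "exp (z * \<phi> y) * push P l h y =
      c ^ J * (exp (z * birkhoff_sum \<phi> (J * p) y) * H (shiftn (J * p) y)) + (R - 1) * G (J * p)
      - (R - 1) * ((\<Sum>i<J * p. G i) + G (J * p) - (if y \<in> A then 1 else 0))" .
  have hy: "h y = c ^ J * (exp (z * birkhoff_sum \<phi> (J * p) y) * H (shiftn (J * p) y)) - (R - 1) * (\<Sum>i<J * p. G i)"
    by (simp add: h_def G_def)
  show ?thesis unfolding eq hy by (simp add: algebra_simps)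
qed

text \<open>On the hole, matches occur only at multiples of \<open>p\<close>, where the tail is
  \<open>c ^ j\<close> and the Birkhoff sum is \<open>j * s\<close>; the correction becomes a
  geometric sum.\<close>

lemma h_on_hole:
  assumes y: "y \<in> A"
  shows "h y = (c * exp (z * s)) ^ J - (R - 1) * (\<Sum>j<J. (c * exp (z * s)) ^ j)"
proof -
  let ?b = "c * exp (z * s)"
  have yx: "y i = x i" if "i < l" for i using y that by (simp add: A_def mem_prefix_set)
  have S: "birkhoff_sum \<phi> (j * p) y = j * s" if "j \<le> J" for j
  proof -
    have "j * p \<le> J * p" using that by simp
    then have "birkhoff_sum \<phi> (j * p) y = birkhoff_sum \<phi> (j * p) x"
      by (intro word_funD[OF word_fun_birkhoff_sum[OF \<phi>, of "j * p"]] yx) (use \<open>j * p \<le> J * p\<close> l_eq in linarith)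
    then show ?thesis by (simp add: birkhoff_sum_x)
  qed
  have power_b: "c ^ j * exp (z * (j * s)) = ?b ^ j" for j
    by (simp add: power_mult_distrib exp_of_nat_mult[symmetric] mult_ac)
  have "matches (J * p) y"
    unfolding matches_def using yx x_add_mult_p[of _ J] by (simp add: l_eq add.commute)
  then have "H (shiftn (J * p) y) = 1" using matches_J H_W by simp
  moreover have "(\<Sum>i<J * p. exp (z * birkhoff_sum \<phi> i y) * hit i y) = (\<Sum>j<J. ?b ^ j)"
  proof -
    have dvd: "p dvd i" if "hit i y \<noteq> 0" "i < J * p" for i
    proof (rule dvd_of_match)
      fix m assume "m < p"
      then have m: "m < l - i" "i + m < l" using that(2) l_eq N_ge by auto
      then have "y (i + m) = x m" using that(1) by (auto simp: hit_def matches_def split: if_splits)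
      then show "x (m + i) = x m" using yx[OF m(2)] by (simp add: add.commute)
    qed
    have "(\<Sum>i<J * p. exp (z * birkhoff_sum \<phi> i y) * hit i y) = (\<Sum>i\<in>(\<lambda>j. j * p) ` {..<J}. exp (z * birkhoff_sum \<phi> i y) * hit i y)"
    proof (rule sum.mono_neutral_right)
      show "(\<lambda>j. j * p) ` {..<J} \<subseteq> {..<J * p}" using p by auto
      show "\<forall>i\<in>{..<J * p} - (\<lambda>j. j * p) ` {..<J}. exp (z * birkhoff_sum \<phi> i y) * hit i y = 0"
      proof (rule ballI, rule ccontr)
        fix i assume i: "i \<in> {..<J * p} - (\<lambda>j. j * p) ` {..<J}" and "exp (z * birkhoff_sum \<phi> i y) * hit i y \<noteq> 0"
        then have "p dvd i" using dvd[of i] by simp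
        then obtain j where "i = j * p" by (metis dvdE mult.commute)
        then show False using i by auto
      qed
    qed simp
    also have "\<dots> = (\<Sum>j<J. exp (z * birkhoff_sum \<phi> (j * p) y) * hit (j * p) y)"
      using p by (subst sum.reindex) (auto simp: inj_on_def)
    also have "\<dots> = (\<Sum>j<J. ?b ^ j)"
    proof (intro sum.cong refl)
      fix j assume j: "j \<in> {..<J}"
      then have jl: "j * p < l" using p l_eq by (metis add.commute lessThan_iff mult_less_mono1 less_le_trans trans_less_add1 zero_less_one)
      have "matches (j * p) y"
        unfolding matches_def using yx x_add_mult_p[of _ j] by (simp add: add.commute)
      then show "exp (z * birkhoff_sum \<phi> (j * p) y) * hit (j * p) y = ?b ^ j"
        using j jl S[of j] power_b[of j] by (simp add: hit_def tail_mult_p mult.commute)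
    qed
    finally show ?thesis .
  qed
  ultimately show ?thesis using S[of J] power_b[of J] by (simp add: h_def)
qed

text \<open>Two occurrences of long prefixes of \<open>x\<close> overlap only at distances divisible by \<open>p\<close>, so the
  hitting probabilities decay geometrically from the first one.\<close>

lemma sum_hit_le:
  assumes y: "y \<notin> A"
  shows "(\<Sum>i<J * p. hit i y) \<le> q / (1 - c)"
proof -
  define I where "I = {i. i < J * p \<and> matches i y}"
  have fin: "finite I" by (simp add: I_def)
  \<comment> \<open>A match at \<open>0\<close> would put \<open>y\<close> into the hole. Every
    later match still lacks the last letter of the hole, whence the factor \<open>q\<close>.\<close>
  have I_pos: "i \<ge> 1" if "i \<in> I" for i
    using that y matches_0[of y] by (cases i) (auto simp: I_def)
  have "(\<Sum>i<J * p. hit i y) = (\<Sum>i\<in>I. tail i)"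
    unfolding hit_def I_def by (subst sum.inter_filter[symmetric]) (auto simp: lessThan_def)
  also have "\<dots> \<le> q / (1 - c)"
  proof (cases "I = {}")
    case True
    then show ?thesis using c_less_1 by (simp add: q_def)
  next
    case False
    define i\<^sub>0 where "i\<^sub>0 = Min I"
    have i\<^sub>0: "i\<^sub>0 \<in> I" "\<And>i. i \<in> I \<Longrightarrow> i\<^sub>0 \<le> i" using False fin by (auto simp: i\<^sub>0_def)
    have dvd: "p dvd i - i\<^sub>0" if i: "i \<in> I" for i
    proof (rule dvd_of_match)
      fix m assume "m < p"
      then have m: "m < l - i" "i - i\<^sub>0 + m < l - i\<^sub>0" using i i\<^sub>0 l_eq N_ge by (auto simp: I_def)
      have "y (i + m) = x m" using i m by (auto simp: I_def matches_def)
      moreover have "y (i\<^sub>0 + (i - i\<^sub>0 + m)) = x (i - i\<^sub>0 + m)" using i\<^sub>0 m by (auto simp: I_def matches_def)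
      ultimately show "x (m + (i - i\<^sub>0)) = x m" using i\<^sub>0(2)[OF i] by (simp add: add.commute)
    qed
    define f where "f = (\<lambda>i. (i - i\<^sub>0) div p)"
    have i_eq: "i = i\<^sub>0 + f i * p" if "i \<in> I" for i
      using dvd[OF that] i\<^sub>0(2)[OF that] by (simp add: f_def)
    have "tail i \<le> q * c ^ f i" if i: "i \<in> I" for i
    proof -
      have "i < l" using i l_eq by (auto simp: I_def)
      then have "tail i = c ^ f i * tail i\<^sub>0" using i_eq[OF i] tail_add_mult_p[of i\<^sub>0 "f i"] by simp
      also have "\<dots> \<le> c ^ f i * q" using tail_le_q[OF I_pos[OF i\<^sub>0(1)]] c_pos by (intro mult_left_mono) auto
      finally show ?thesis by (simp add: mult.commute)
    qed
    then have "(\<Sum>i\<in>I. tail i) \<le> q * (\<Sum>i\<in>I. c ^ f i)"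
      unfolding sum_distrib_left by (intro sum_mono) auto
    also have "(\<Sum>i\<in>I. c ^ f i) = (\<Sum>j\<in>f ` I. c ^ j)"
    proof -
      have "inj_on f I" by (rule inj_onI) (metis i_eq)
      then show ?thesis by (simp add: sum.reindex)
    qed
    also have "\<dots> \<le> (\<Sum>j. c ^ j)"
      using c_pos c_less_1 fin by (intro sum_le_suminf summable_geometric) auto
    also have "\<dots> = 1 / (1 - c)" using c_pos c_less_1 by (intro suminf_geometric) auto
    finally show ?thesis by (simp add: q_def mult_left_mono)
  qed
  finally show ?thesis .
qed

lemma h_off_hole:
  assumes y: "y \<notin> A" and pos: "c ^ J - (R - 1) * (q / (1 - c)) > 0"
  shows "h y \<ge> c ^ J - (R - 1) * (q / (1 - c))"
proof -
  let ?e = "exp (z * birkhoff_sum \<phi> (J * p) y)"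
  have "(\<Sum>i<J * p. exp (z * birkhoff_sum \<phi> i y) * hit i y) \<le> (\<Sum>i<J * p. ?e * hit i y)"
    using z birkhoff_sum_mono tail_nonneg
    by (intro sum_mono mult_right_mono) (auto intro!: mult_left_mono simp: hit_def)
  also have "\<dots> \<le> ?e * (q / (1 - c))"
    unfolding sum_distrib_left[symmetric] using sum_hit_le[OF y] by (intro mult_left_mono) auto
  finally have 1: "(R - 1) * (\<Sum>i<J * p. exp (z * birkhoff_sum \<phi> i y) * hit i y) \<le> (R - 1) * (?e * (q / (1 - c)))"
    using R by (intro mult_left_mono) auto
  have 2: "c ^ J * (?e * 1) \<le> c ^ J * (?e * H (shiftn (J * p) y))"
    using c_pos H_ge by (intro mult_left_mono) auto
  have "1 * (c ^ J - (R - 1) * (q / (1 - c))) \<le> ?e * (c ^ J - (R - 1) * (q / (1 - c)))"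
    using pos z birkhoff_sum_nonneg by (intro mult_right_mono) auto
  also have "\<dots> = c ^ J * (?e * 1) - (R - 1) * (?e * (q / (1 - c)))" by (simp add: algebra_simps)
  also have "\<dots> \<le> h y" using 1 2 unfolding h_def by linarith
  finally show ?thesis by simp
qed

lemma escape_rate_hole:
  assumes root: "(c * exp (z * s)) ^ J = (R - 1) * (\<Sum>j<J. (c * exp (z * s)) ^ j)"
    and pos: "(R - 1) * q < c ^ J * (1 - c)"
  shows "has_escape_rate P \<mu> (cyl P x (\<nu> * p)) \<phi> z"
proof -
  have pos': "c ^ J - (R - 1) * (q / (1 - c)) > 0"
    using pos c_less_1 by (simp add: field_simps)
  obtain C where C: "\<And>y. \<bar>h y\<bar> \<le> C" using word_fun_bounded[OF word_fun_h] by blast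
  have "eigenfunction P \<pi> \<mu> \<phi> \<phi>\<^sub>0 x N A l h z (c ^ J - (R - 1) * (q / (1 - c))) C"
  proof unfold_locales
    show "word_fun l (\<lambda>y. y \<in> A)" unfolding A_def by (rule word_fun_mem_prefix_set)
    show "N \<le> l" by (simp add: l_eq)
    show "word_fun l h" by (rule word_fun_h)
    show "z \<ge> 0" by (rule z)
    show "exp (z * \<phi> y) * push P l h y = h y" if "y \<notin> A" for y using push_h[of y] that by simp
    show "h y = 0" if "y \<in> A" for y using h_on_hole[OF that] root by simp
    show "c ^ J - (R - 1) * (q / (1 - c)) \<le> h y" if "y \<notin> A" for y by (rule h_off_hole[OF that pos'])
    show "h y \<le> C" for y using C[of y] by linarith
  qed (rule pos')
  then interpret ef: eigenfunction P \<pi> \<mu> \<phi> \<phi>\<^sub>0 x N A l h z "c ^ J - (R - 1) * (q / (1 - c))" C .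
  obtain v where v: "v 0 \<noteq> x 0" "weight v l > 0" using ex_admissible_off_x by blast
  have "v \<notin> A" using v(1) l_eq N unfolding A_def mem_prefix_set by (metis add_gr_0 less_le_trans zero_less_numeral)
  moreover have "Sigma_P P \<inter> A = cyl P x (\<nu> * p)" by (auto simp: cyl_def A_def mem_prefix_set l_def)
  ultimately show ?thesis using ef.escape_rate v(2) by metis
qed

end

section \<open>The escape equation\<close>

text \<open>In the application \<open>m\<close> is the integral of the ceiling and \<open>w\<close>
  the measure of \<open>W\<close>, so \<open>m / w\<close> is the mean return time and
  \<open>w * u \<nu>\<close> below is the measure of the hole.\<close>

locale escape_equation =
  fixes R :: "real \<Rightarrow> real" and c s m w K \<delta> :: real and n\<^sub>0 :: nat
  assumes c: "0 < c" "c < 1" and s: "0 < s" and m: "0 < m" and w: "0 < w" and \<delta>: "0 < \<delta>" and K: "0 < K"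
    and R_cont: "continuous_on {0..\<delta>} R"
    and R_approx: "\<And>z. 0 \<le> z \<Longrightarrow> z \<le> \<delta> \<Longrightarrow> \<bar>R z - 1 - z * m / w\<bar> \<le> K * z\<^sup>2"
begin

definition u :: "nat \<Rightarrow> real" where "u \<nu> = c ^ (\<nu> - n\<^sub>0)"

lemma u_pos: "u \<nu> > 0"
  using c by (simp add: u_def)

lemma of_nat_times_u: "(\<lambda>\<nu>. \<nu> * u \<nu>) \<longlonglongrightarrow> 0"
proof -
  have "(\<lambda>\<nu>. (\<nu> * c ^ \<nu>) / c ^ n\<^sub>0) \<longlonglongrightarrow> 0 / c ^ n\<^sub>0"
    using c by (intro tendsto_divide tendsto_const powser_times_n_limit_0) auto
  moreover have "\<forall>\<^sub>F \<nu> in sequentially. (\<nu> * c ^ \<nu>) / c ^ n\<^sub>0 = \<nu> * u \<nu>"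
    using eventually_ge_at_top[of n\<^sub>0] by eventually_elim (use c in \<open>simp add: u_def power_diff\<close>)
  ultimately show ?thesis using tendsto_cong by force
qed

lemma u_tendsto: "u \<longlonglongrightarrow> 0"
proof (rule Lim_null_comparison[OF _ of_nat_times_u])
  show "\<forall>\<^sub>F \<nu> in sequentially. norm (u \<nu>) \<le> \<nu> * u \<nu>"
    using eventually_ge_at_top[of 1] by eventually_elim (use u_pos in \<open>simp add: less_imp_le\<close>)
qed

definition b :: "real \<Rightarrow> real" where "b z = c * exp (z * s)"

text \<open>The condition that \<open>h\<close> vanish on the hole, multiplied by
  \<open>1 - b z\<close> to sum the geometric series. This adds the spurious root
  \<open>b z = 1\<close>, which is far from the roots of order \<open>u \<nu>\<close>.\<close>

definition F :: "nat \<Rightarrow> real \<Rightarrow> real" where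
  "F \<nu> z = R z - 1 - b z ^ (\<nu> - n\<^sub>0) * (R z - b z)"

text \<open>At scale \<open>u \<nu>\<close> the equation becomes linear: \<nu> times
  \<open>u \<nu>\<close> tends to zero, so the tilt over all periods of the hole tends to
  one.\<close>

lemma bounded_asymptotics:
  fixes Y :: "nat \<Rightarrow> real"
  assumes Y: "\<forall>\<^sub>F \<nu> in sequentially. 0 \<le> Y \<nu> \<and> Y \<nu> \<le> M * u \<nu>"
  shows bounded_null: "Y \<longlonglongrightarrow> 0"
    and bounded_times_null: "(\<lambda>\<nu>. \<nu> * Y \<nu>) \<longlonglongrightarrow> 0"
    and bounded_exp: "(\<lambda>\<nu>. exp (Y \<nu> * s) ^ (\<nu> - n\<^sub>0)) \<longlonglongrightarrow> 1"
    and bounded_b: "(\<lambda>\<nu>. b (Y \<nu>)) \<longlonglongrightarrow> c"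
    and bounded_le: "\<forall>\<^sub>F \<nu> in sequentially. 0 \<le> Y \<nu> \<and> Y \<nu> \<le> \<delta>"
    and bounded_R: "(\<lambda>\<nu>. (R (Y \<nu>) - 1) / u \<nu> - Y \<nu> / u \<nu> * (m / w)) \<longlonglongrightarrow> 0"
    and bounded_F: "(\<lambda>\<nu>. F \<nu> (Y \<nu>) / u \<nu> - (Y \<nu> / u \<nu> * (m / w) - (1 - c))) \<longlonglongrightarrow> 0"
proof -
  show Y0: "Y \<longlonglongrightarrow> 0"
  proof (rule Lim_null_comparison)
    show "\<forall>\<^sub>F \<nu> in sequentially. norm (Y \<nu>) \<le> M * u \<nu>" using Y by eventually_elim auto
    show "(\<lambda>\<nu>. M * u \<nu>) \<longlonglongrightarrow> 0" using tendsto_mult_right_zero[OF u_tendsto] .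
  qed
  show nY: "(\<lambda>\<nu>. \<nu> * Y \<nu>) \<longlonglongrightarrow> 0"
  proof (rule Lim_null_comparison)
    show "\<forall>\<^sub>F \<nu> in sequentially. norm (\<nu> * Y \<nu>) \<le> M * (\<nu> * u \<nu>)"
    proof (use Y in eventually_elim)
      case (elim \<nu>)
      then have "\<nu> * Y \<nu> \<le> \<nu> * (M * u \<nu>)" by (intro mult_left_mono) auto
      then show ?case using elim by (simp add: mult_ac)
    qed
    show "(\<lambda>\<nu>. M * (\<nu> * u \<nu>)) \<longlonglongrightarrow> 0" using tendsto_mult_right_zero[OF of_nat_times_u] .
  qed
  have JY: "(\<lambda>\<nu>. real (\<nu> - n\<^sub>0) * Y \<nu>) \<longlonglongrightarrow> 0"
  proof (rule Lim_null_comparison[OF _ nY])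
    show "\<forall>\<^sub>F \<nu> in sequentially. norm (real (\<nu> - n\<^sub>0) * Y \<nu>) \<le> \<nu> * Y \<nu>"
      using Y by eventually_elim (auto intro!: mult_right_mono)
  qed
  have "(\<lambda>\<nu>. exp (real (\<nu> - n\<^sub>0) * Y \<nu> * s)) \<longlonglongrightarrow> exp (0 * s)"
    by (intro tendsto_intros JY)
  then show e: "(\<lambda>\<nu>. exp (Y \<nu> * s) ^ (\<nu> - n\<^sub>0)) \<longlonglongrightarrow> 1"
    by (simp add: mult.assoc flip: exp_of_nat_mult)
  have "(\<lambda>\<nu>. b (Y \<nu>)) \<longlonglongrightarrow> c * exp (0 * s)"
    unfolding b_def by (intro tendsto_intros Y0)
  then show b: "(\<lambda>\<nu>. b (Y \<nu>)) \<longlonglongrightarrow> c" by simp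
  have "\<forall>\<^sub>F \<nu> in sequentially. Y \<nu> < \<delta>" by (rule order_tendstoD(2)[OF Y0 \<delta>])
  with Y show le: "\<forall>\<^sub>F \<nu> in sequentially. 0 \<le> Y \<nu> \<and> Y \<nu> \<le> \<delta>" by eventually_elim auto
  show R: "(\<lambda>\<nu>. (R (Y \<nu>) - 1) / u \<nu> - Y \<nu> / u \<nu> * (m / w)) \<longlonglongrightarrow> 0"
  proof (rule Lim_null_comparison)
    show "\<forall>\<^sub>F \<nu> in sequentially. norm ((R (Y \<nu>) - 1) / u \<nu> - Y \<nu> / u \<nu> * (m / w)) \<le> K * M * Y \<nu>"
    proof (use Y le in eventually_elim)
      case (elim \<nu>)
      have "(R (Y \<nu>) - 1) / u \<nu> - Y \<nu> / u \<nu> * (m / w) = (R (Y \<nu>) - 1 - Y \<nu> * m / w) / u \<nu>"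
        by (simp add: diff_divide_distrib)
      then have "norm ((R (Y \<nu>) - 1) / u \<nu> - Y \<nu> / u \<nu> * (m / w)) = \<bar>R (Y \<nu>) - 1 - Y \<nu> * m / w\<bar> / u \<nu>"
        using u_pos[of \<nu>] by (simp add: abs_divide)
      also have "\<dots> \<le> K * (Y \<nu>)\<^sup>2 / u \<nu>"
        using R_approx[of "Y \<nu>"] elim u_pos[of \<nu>] by (intro divide_right_mono) auto
      also have "\<dots> \<le> K * (M * u \<nu> * Y \<nu>) / u \<nu>"
        using elim K u_pos[of \<nu>] unfolding power2_eq_square
        by (intro divide_right_mono mult_left_mono mult_right_mono) auto
      also have "\<dots> = K * M * Y \<nu>" using u_pos[of \<nu>] by simp
      finally show ?case .
    qed
    show "(\<lambda>\<nu>. K * M * Y \<nu>) \<longlonglongrightarrow> 0" using tendsto_mult_right_zero[OF Y0] .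
  qed
  have R1: "(\<lambda>\<nu>. R (Y \<nu>) - 1) \<longlonglongrightarrow> 0"
  proof (rule Lim_null_comparison)
    show "\<forall>\<^sub>F \<nu> in sequentially. norm (R (Y \<nu>) - 1) \<le> Y \<nu> * m / w + K * (Y \<nu>)\<^sup>2"
    proof (use le in eventually_elim)
      case (elim \<nu>)
      have "0 \<le> Y \<nu> * m / w" using elim m w by simp
      then show ?case using R_approx[of "Y \<nu>"] elim by simp
    qed
    have "(\<lambda>\<nu>. Y \<nu> * m / w + K * (Y \<nu>)\<^sup>2) \<longlonglongrightarrow> 0 * m / w + K * 0\<^sup>2"
      using w by (intro tendsto_intros Y0) auto
    then show "(\<lambda>\<nu>. Y \<nu> * m / w + K * (Y \<nu>)\<^sup>2) \<longlonglongrightarrow> 0" by simp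
  qed
  have eq: "F \<nu> (Y \<nu>) / u \<nu> - (Y \<nu> / u \<nu> * (m / w) - (1 - c))
     = ((R (Y \<nu>) - 1) / u \<nu> - Y \<nu> / u \<nu> * (m / w)) - exp (Y \<nu> * s) ^ (\<nu> - n\<^sub>0) * ((R (Y \<nu>) - 1) + 1 - b (Y \<nu>)) + (1 - c)" for \<nu>
  proof -
    have "b (Y \<nu>) ^ (\<nu> - n\<^sub>0) = u \<nu> * exp (Y \<nu> * s) ^ (\<nu> - n\<^sub>0)"
      by (simp add: b_def u_def power_mult_distrib)
    then have "F \<nu> (Y \<nu>) / u \<nu> = (R (Y \<nu>) - 1) / u \<nu> - exp (Y \<nu> * s) ^ (\<nu> - n\<^sub>0) * ((R (Y \<nu>) - 1) + 1 - b (Y \<nu>))"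
      using u_pos[of \<nu>] by (simp add: F_def diff_divide_distrib)
    then show ?thesis by simp
  qed
  have lim: "(\<lambda>\<nu>. ((R (Y \<nu>) - 1) / u \<nu> - Y \<nu> / u \<nu> * (m / w)) - exp (Y \<nu> * s) ^ (\<nu> - n\<^sub>0) * ((R (Y \<nu>) - 1) + 1 - b (Y \<nu>)) + (1 - c))
    \<longlonglongrightarrow> 0 - 1 * (0 + 1 - c) + (1 - c)"
    by (intro tendsto_intros R e R1 b)
  have val: "0 - 1 * (0 + 1 - c) + (1 - c) = 0" by simp
  show "(\<lambda>\<nu>. F \<nu> (Y \<nu>) / u \<nu> - (Y \<nu> / u \<nu> * (m / w) - (1 - c))) \<longlonglongrightarrow> 0"
    using lim unfolding eq val .
qed

definition \<kappa> :: real where "\<kappa> = (1 - c) / m"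

lemma \<kappa>_pos: "\<kappa> > 0"
  using c m by (simp add: \<kappa>_def)

lemma F_at_multiple:
  assumes "k \<ge> 0"
  shows "(\<lambda>\<nu>. F \<nu> (k * \<kappa> * w * u \<nu>) / u \<nu>) \<longlonglongrightarrow> (k - 1) * (1 - c)"
proof -
  have "(\<lambda>\<nu>. F \<nu> (k * \<kappa> * w * u \<nu>) / u \<nu> - (k * \<kappa> * w * u \<nu> / u \<nu> * (m / w) - (1 - c))) \<longlonglongrightarrow> 0"
    using assms \<kappa>_pos w u_pos by (intro bounded_F[where M = "k * \<kappa> * w"]) (simp add: less_imp_le)
  moreover have "k * \<kappa> * w * u \<nu> / u \<nu> * (m / w) - (1 - c) = (k - 1) * (1 - c)" for \<nu>
    using u_pos[of \<nu>] w m by (simp add: \<kappa>_def field_simps)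
  ultimately have "(\<lambda>\<nu>. F \<nu> (k * \<kappa> * w * u \<nu>) / u \<nu> - (k - 1) * (1 - c)) \<longlonglongrightarrow> 0" by simp
  then show ?thesis by (rule LIM_zero_cancel)
qed

text \<open>Intermediate value theorem between half and twice the zero
  \<open>\<kappa> * w * u \<nu>\<close> of the linearized equation, where \<open>F\<close> divided
  by \<open>u \<nu>\<close> has limits \<open>- (1 - c) / 2\<close> and
  \<open>1 - c\<close>.\<close>

lemma ex_root:
  "\<forall>\<^sub>F \<nu> in sequentially. \<exists>z. \<kappa> / 2 * w * u \<nu> \<le> z \<and> z \<le> 2 * \<kappa> * w * u \<nu> \<and> F \<nu> z = 0"
proof -
  have 1: "\<forall>\<^sub>F \<nu> in sequentially. F \<nu> ((1/2) * \<kappa> * w * u \<nu>) / u \<nu> < 0"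
    using c by (intro order_tendstoD(2)[OF F_at_multiple]) (auto simp: mult_neg_pos)
  have 2: "\<forall>\<^sub>F \<nu> in sequentially. 0 < F \<nu> (2 * \<kappa> * w * u \<nu>) / u \<nu>"
    using c by (intro order_tendstoD(1)[OF F_at_multiple]) auto
  have 3: "\<forall>\<^sub>F \<nu> in sequentially. 0 \<le> 2 * \<kappa> * w * u \<nu> \<and> 2 * \<kappa> * w * u \<nu> \<le> \<delta>"
    using \<kappa>_pos w u_pos by (intro bounded_le[where M = "2 * \<kappa> * w"]) (simp add: less_imp_le)
  show ?thesis
  proof (use 1 2 3 in eventually_elim)
    case (elim \<nu>)
    have pos: "\<kappa> * w * u \<nu> > 0" using \<kappa>_pos w u_pos[of \<nu>] by simp
    have "continuous_on {\<kappa> / 2 * w * u \<nu>..2 * \<kappa> * w * u \<nu>} (F \<nu>)"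
      unfolding F_def b_def
      by (intro continuous_intros continuous_on_subset[OF R_cont]) (use elim pos in auto)
    moreover have "F \<nu> (\<kappa> / 2 * w * u \<nu>) \<le> 0" "0 \<le> F \<nu> (2 * \<kappa> * w * u \<nu>)"
      using elim u_pos[of \<nu>] by (auto simp: divide_less_0_iff zero_less_divide_iff)
    moreover have "\<kappa> / 2 * w * u \<nu> \<le> 2 * \<kappa> * w * u \<nu>" using pos by (simp add: mult_ac)
    ultimately show ?case using IVT'[of "F \<nu>" "\<kappa> / 2 * w * u \<nu>" 0 "2 * \<kappa> * w * u \<nu>"] by blast
  qed
qed

definition root :: "nat \<Rightarrow> real" where
  "root \<nu> = (SOME z. \<kappa> / 2 * w * u \<nu> \<le> z \<and> z \<le> 2 * \<kappa> * w * u \<nu> \<and> F \<nu> z = 0)"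

lemma root:
  "\<forall>\<^sub>F \<nu> in sequentially. \<kappa> / 2 * w * u \<nu> \<le> root \<nu> \<and> root \<nu> \<le> 2 * \<kappa> * w * u \<nu> \<and> F \<nu> (root \<nu>) = 0"
  using ex_root by eventually_elim (unfold root_def, rule someI_ex)

lemma root_bounded: "\<forall>\<^sub>F \<nu> in sequentially. 0 \<le> root \<nu> \<and> root \<nu> \<le> 2 * \<kappa> * w * u \<nu>"
proof (use root in eventually_elim)
  case (elim \<nu>)
  have "\<kappa> / 2 * w * u \<nu> > 0" using \<kappa>_pos w u_pos[of \<nu>] by simp
  then show ?case using elim by linarith
qed

lemma root_ratio: "(\<lambda>\<nu>. root \<nu> / (w * u \<nu>)) \<longlonglongrightarrow> \<kappa>"
proof -
  have "(\<lambda>\<nu>. F \<nu> (root \<nu>) / u \<nu> - (root \<nu> / u \<nu> * (m / w) - (1 - c))) \<longlonglongrightarrow> 0"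
    by (rule bounded_F[OF root_bounded])
  moreover have "\<forall>\<^sub>F \<nu> in sequentially. F \<nu> (root \<nu>) / u \<nu> - (root \<nu> / u \<nu> * (m / w) - (1 - c)) = (1 - c) - m * (root \<nu> / (w * u \<nu>))"
    using root by eventually_elim (simp add: mult.commute)
  ultimately have "(\<lambda>\<nu>. (1 - c) - m * (root \<nu> / (w * u \<nu>))) \<longlonglongrightarrow> 0" by (rule Lim_transform_eventually)
  then have "(\<lambda>\<nu>. ((1 - c) - ((1 - c) - m * (root \<nu> / (w * u \<nu>)))) / m) \<longlonglongrightarrow> ((1 - c) - 0) / m"
    using m by (intro tendsto_intros) auto
  then show ?thesis using m by (simp add: \<kappa>_def)
qed

text \<open>The roots tend to zero, so \<open>b\<close> tends to \<open>c < 1\<close> and division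
  by \<open>1 - b\<close> is legitimate.\<close>

lemma root_equation:
  "\<forall>\<^sub>F \<nu> in sequentially. b (root \<nu>) ^ (\<nu> - n\<^sub>0) = (R (root \<nu>) - 1) * (\<Sum>j<\<nu> - n\<^sub>0. b (root \<nu>) ^ j)"
proof -
  have "\<forall>\<^sub>F \<nu> in sequentially. b (root \<nu>) < 1"
    by (rule order_tendstoD(2)[OF bounded_b[OF root_bounded] c(2)])
  with root show ?thesis
  proof eventually_elim
    case (elim \<nu>)
    let ?b = "b (root \<nu>)" and ?R = "R (root \<nu>)" and ?J = "\<nu> - n\<^sub>0"
    have "?R - 1 = ?b ^ ?J * (?R - ?b)" using elim by (simp add: F_def)
    then have "(?R - 1) * (1 - ?b ^ ?J) = ?b ^ ?J * (1 - ?b)" by (simp add: algebra_simps)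
    then have "(1 - ?b) * ((?R - 1) * (\<Sum>j<?J. ?b ^ j)) = (1 - ?b) * ?b ^ ?J"
      unfolding one_diff_power_eq[of ?b ?J] by (simp add: mult_ac)
    then show ?case using elim by simp
  qed
qed

text \<open>This is the positivity condition for \<open>h\<close> off the hole: at the root,
  \<open>R - 1\<close> relative to \<open>u \<nu>\<close> tends to \<open>1 - c\<close>.\<close>

lemma root_gap:
  assumes "q < 1"
  shows "\<forall>\<^sub>F \<nu> in sequentially. (R (root \<nu>) - 1) * q < c ^ (\<nu> - n\<^sub>0) * (1 - c)"
proof -
  have "(\<lambda>\<nu>. (((R (root \<nu>) - 1) / u \<nu> - root \<nu> / u \<nu> * (m / w)) + m * (root \<nu> / (w * u \<nu>))) * q) \<longlonglongrightarrow> (0 + m * \<kappa>) * q"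
    by (intro tendsto_intros bounded_R[OF root_bounded] root_ratio)
  then have "(\<lambda>\<nu>. (R (root \<nu>) - 1) / u \<nu> * q) \<longlonglongrightarrow> (1 - c) * q"
    using m by (simp add: \<kappa>_def mult_ac)
  moreover have "(1 - c) * q < 1 - c" using assms c by simp
  ultimately have "\<forall>\<^sub>F \<nu> in sequentially. (R (root \<nu>) - 1) / u \<nu> * q < 1 - c"
    by (rule order_tendstoD(2))
  then show ?thesis
  proof eventually_elim
    case (elim \<nu>)
    then show ?case using u_pos[of \<nu>] by (simp add: u_def[symmetric] divide_less_eq mult_ac)
  qed
qed

lemma remainder_bounds:
  assumes z: "0 \<le> z" "z \<le> \<delta>" "z * s \<le> 1"
  shows "\<bar>(R z - 1) - (b z - c)\<bar> \<le> (m / w + K * \<delta> + 2 * c * s) * z"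
proof -
  have "K * z\<^sup>2 \<le> K * \<delta> * z" using z K by (simp add: power2_eq_square mult_right_mono)
  moreover have "\<bar>b z - c\<bar> \<le> 2 * c * s * z"
  proof -
    have "0 \<le> exp (z * s) - 1" "exp (z * s) - 1 \<le> 2 * (z * s)"
      using z s exp_minus_1_le[of "z * s"] by auto
    then have "\<bar>c * (exp (z * s) - 1)\<bar> \<le> c * (2 * (z * s))" using c by (simp add: abs_mult)
    then show ?thesis by (simp add: b_def algebra_simps)
  qed
  moreover have "0 \<le> z * m / w" using z m w by simp
  ultimately show ?thesis using R_approx[OF z(1,2)] by (simp add: algebra_simps abs_le_iff)
qed

text \<open>With the errors \<open>\<rho>\<close> and \<open>\<sigma>\<close> the equation is
  exactly \<open>z * m = v * e * (m * \<kappa> + \<sigma>) - \<rho> * w\<close>. Inserting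
  \<open>e = 1 + (\<nu> - n\<^sub>0) * z * s + ...\<close> and
  \<open>z / v \<longlonglongrightarrow> \<kappa>\<close> produces both terms.\<close>

lemma root_expansion:
  "(\<lambda>\<nu>. root \<nu> - (\<kappa> * (w * u \<nu>) + \<kappa>\<^sup>2 * s * \<nu> * (w * u \<nu>)\<^sup>2)) \<in> o(\<lambda>\<nu>. \<nu> * (w * u \<nu>)\<^sup>2)"
proof (rule smalloI_tendsto)
  define z where "z = root"
  define v where "v = (\<lambda>\<nu>. w * u \<nu>)"
  define e where "e = (\<lambda>\<nu>. exp (z \<nu> * s) ^ (\<nu> - n\<^sub>0))"
  define \<rho> where "\<rho> = (\<lambda>\<nu>. R (z \<nu>) - 1 - z \<nu> * m / w)"
  define \<sigma> where "\<sigma> = (\<lambda>\<nu>. (R (z \<nu>) - 1) - (b (z \<nu>) - c))"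
  have v_pos: "v \<nu> > 0" for \<nu> using w u_pos by (simp add: v_def)
  have z0: "z \<longlonglongrightarrow> 0" and nz: "(\<lambda>\<nu>. \<nu> * z \<nu>) \<longlonglongrightarrow> 0" and e1: "e \<longlonglongrightarrow> 1"
    and z_le: "\<forall>\<^sub>F \<nu> in sequentially. 0 \<le> z \<nu> \<and> z \<nu> \<le> \<delta>"
    unfolding z_def e_def
    by (rule bounded_null[OF root_bounded] bounded_times_null[OF root_bounded]
        bounded_exp[OF root_bounded] bounded_le[OF root_bounded])+
  have zv: "(\<lambda>\<nu>. z \<nu> / v \<nu>) \<longlonglongrightarrow> \<kappa>" using root_ratio by (simp add: z_def v_def)
  have inv: "(\<lambda>\<nu>. 1 / real \<nu>) \<longlonglongrightarrow> 0" by (rule lim_1_over_n)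
  \<comment> \<open>The four error sources relative to \<nu> times \<open>v\<^sup>2\<close>: the
    Taylor remainder of \<open>e\<close>; the replacement of \<open>(\<nu> - n\<^sub>0) * z\<close>
    by \<open>\<kappa> * \<nu> * v\<close>; the drift of \<open>R - b\<close> from
    \<open>1 - c\<close>; the nonlinearity of \<open>R\<close>. The last two vanish only thanks to
    the factor \<nu> in the denominator.\<close>
  define T\<^sub>1 where "T\<^sub>1 = (\<lambda>\<nu>. \<kappa> * ((e \<nu> - 1 - (\<nu> - n\<^sub>0) * z \<nu> * s) / (\<nu> * v \<nu>)))"
  define T\<^sub>2 where "T\<^sub>2 = (\<lambda>\<nu>::nat. \<kappa> * s * (z \<nu> / v \<nu> - \<kappa> - n\<^sub>0 * (z \<nu> / v \<nu>) * (1 / \<nu>)))"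
  define T\<^sub>3 where "T\<^sub>3 = (\<lambda>\<nu>. e \<nu> * \<sigma> \<nu> / (m * (\<nu> * v \<nu>)))"
  define T\<^sub>4 where "T\<^sub>4 = (\<lambda>\<nu>. \<rho> \<nu> * w / (m * (\<nu> * (v \<nu>)\<^sup>2)))"
  have T1: "T\<^sub>1 \<longlonglongrightarrow> 0"
  proof (rule Lim_null_comparison)
    have "(\<lambda>\<nu>. \<nu> * z \<nu> * s) \<longlonglongrightarrow> 0 * s" by (intro tendsto_intros nz)
    then have lt: "\<forall>\<^sub>F \<nu> in sequentially. \<nu> * z \<nu> * s < 1" by (intro order_tendstoD(2)) auto
    show "\<forall>\<^sub>F \<nu> in sequentially. norm (T\<^sub>1 \<nu>) \<le> \<kappa> * (s\<^sup>2 * (z \<nu> / v \<nu>) * (\<nu> * z \<nu>))"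
    proof (use lt z_le eventually_gt_at_top[of n\<^sub>0] in eventually_elim)
      case (elim \<nu>)
      define t where "t = real (\<nu> - n\<^sub>0) * z \<nu> * s"
      have J: "real (\<nu> - n\<^sub>0) = real \<nu> - real n\<^sub>0" using elim by simp
      have t: "0 \<le> t" "t \<le> \<nu> * z \<nu> * s"
        using elim s by (auto simp: t_def intro!: mult_right_mono)
      have "e \<nu> = exp t" by (simp add: e_def t_def mult_ac flip: exp_of_nat_mult)
      moreover have "exp t \<le> 1 + t + t\<^sup>2" using exp_bound[of t] t elim by simp
      ultimately have "\<bar>e \<nu> - 1 - t\<bar> \<le> t\<^sup>2"
        using exp_ge_add_one_self[of t] zero_le_power2[of t] by linarith
      also have "t\<^sup>2 \<le> (\<nu> * z \<nu> * s)\<^sup>2" using t by (intro power_mono)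
      finally have "\<bar>e \<nu> - 1 - t\<bar> / (\<nu> * v \<nu>) \<le> (\<nu> * z \<nu> * s)\<^sup>2 / (\<nu> * v \<nu>)"
        using v_pos[of \<nu>] by (intro divide_right_mono) auto
      also have "\<dots> = s\<^sup>2 * (z \<nu> / v \<nu>) * (\<nu> * z \<nu>)"
        using v_pos[of \<nu>] elim by (simp add: power2_eq_square)
      finally have "\<kappa> * (\<bar>e \<nu> - 1 - t\<bar> / (\<nu> * v \<nu>)) \<le> \<kappa> * (s\<^sup>2 * (z \<nu> / v \<nu>) * (\<nu> * z \<nu>))"
        using \<kappa>_pos by (intro mult_left_mono) auto
      moreover have "norm (T\<^sub>1 \<nu>) = \<kappa> * (\<bar>e \<nu> - 1 - t\<bar> / (\<nu> * v \<nu>))"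
        using \<kappa>_pos v_pos[of \<nu>] by (simp add: T\<^sub>1_def t_def J abs_mult)
      ultimately show ?case by simp
    qed
    have "(\<lambda>\<nu>. \<kappa> * (s\<^sup>2 * (z \<nu> / v \<nu>) * (\<nu> * z \<nu>))) \<longlonglongrightarrow> \<kappa> * (s\<^sup>2 * \<kappa> * 0)"
      by (intro tendsto_intros zv nz)
    then show "(\<lambda>\<nu>. \<kappa> * (s\<^sup>2 * (z \<nu> / v \<nu>) * (\<nu> * z \<nu>))) \<longlonglongrightarrow> 0" by simp
  qed
  have T2: "T\<^sub>2 \<longlonglongrightarrow> 0"
  proof -
    have "T\<^sub>2 \<longlonglongrightarrow> \<kappa> * s * (\<kappa> - \<kappa> - n\<^sub>0 * \<kappa> * 0)"
      unfolding T\<^sub>2_def by (intro tendsto_intros zv inv)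
    then show ?thesis by simp
  qed
  have T3: "T\<^sub>3 \<longlonglongrightarrow> 0"
  proof (rule Lim_null_comparison)
    define C where "C = m / w + K * \<delta> + 2 * c * s"
    have "(\<lambda>\<nu>. z \<nu> * s) \<longlonglongrightarrow> 0 * s" by (intro tendsto_intros z0)
    then have lt: "\<forall>\<^sub>F \<nu> in sequentially. z \<nu> * s < 1" by (intro order_tendstoD(2)) auto
    show "\<forall>\<^sub>F \<nu> in sequentially. norm (T\<^sub>3 \<nu>) \<le> C / m * e \<nu> * (z \<nu> / v \<nu>) * (1 / \<nu>)"
    proof (use lt z_le in eventually_elim)
      case (elim \<nu>)
      have "\<bar>\<sigma> \<nu>\<bar> \<le> C * z \<nu>" unfolding \<sigma>_def C_def by (rule remainder_bounds) (use elim in auto)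
      moreover have e: "e \<nu> \<ge> 0" by (simp add: e_def)
      ultimately have "e \<nu> * \<bar>\<sigma> \<nu>\<bar> / (m * (\<nu> * v \<nu>)) \<le> e \<nu> * (C * z \<nu>) / (m * (\<nu> * v \<nu>))"
        using m v_pos[of \<nu>] by (intro divide_right_mono mult_left_mono) auto
      then show ?case using e m v_pos[of \<nu>] by (simp add: T\<^sub>3_def abs_mult mult_ac)
    qed
    have "(\<lambda>\<nu>. C / m * e \<nu> * (z \<nu> / v \<nu>) * (1 / \<nu>)) \<longlonglongrightarrow> C / m * 1 * \<kappa> * 0"
      by (intro tendsto_intros e1 zv inv)
    then show "(\<lambda>\<nu>. C / m * e \<nu> * (z \<nu> / v \<nu>) * (1 / \<nu>)) \<longlonglongrightarrow> 0" by simp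
  qed
  have T4: "T\<^sub>4 \<longlonglongrightarrow> 0"
  proof (rule Lim_null_comparison)
    show "\<forall>\<^sub>F \<nu> in sequentially. norm (T\<^sub>4 \<nu>) \<le> K * w / m * (z \<nu> / v \<nu>)\<^sup>2 * (1 / \<nu>)"
    proof (use z_le in eventually_elim)
      case (elim \<nu>)
      have "\<bar>\<rho> \<nu>\<bar> * w / (m * (\<nu> * (v \<nu>)\<^sup>2)) \<le> K * (z \<nu>)\<^sup>2 * w / (m * (\<nu> * (v \<nu>)\<^sup>2))"
        using R_approx[of "z \<nu>"] elim w m by (intro divide_right_mono mult_right_mono) (auto simp: \<rho>_def)
      then show ?case using w m by (simp add: T\<^sub>4_def abs_mult power_divide mult_ac)
    qed
    have "(\<lambda>\<nu>. K * w / m * (z \<nu> / v \<nu>)\<^sup>2 * (1 / \<nu>)) \<longlonglongrightarrow> K * w / m * \<kappa>\<^sup>2 * 0"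
      by (intro tendsto_intros zv inv)
    then show "(\<lambda>\<nu>. K * w / m * (z \<nu> / v \<nu>)\<^sup>2 * (1 / \<nu>)) \<longlonglongrightarrow> 0" by simp
  qed
  have "(\<lambda>\<nu>. T\<^sub>1 \<nu> + T\<^sub>2 \<nu> + T\<^sub>3 \<nu> - T\<^sub>4 \<nu>) \<longlonglongrightarrow> 0 + 0 + 0 - 0"
    by (intro tendsto_intros T1 T2 T3 T4)
  moreover have "\<forall>\<^sub>F \<nu> in sequentially. T\<^sub>1 \<nu> + T\<^sub>2 \<nu> + T\<^sub>3 \<nu> - T\<^sub>4 \<nu>
      = (z \<nu> - (\<kappa> * v \<nu> + \<kappa>\<^sup>2 * s * \<nu> * (v \<nu>)\<^sup>2)) / (\<nu> * (v \<nu>)\<^sup>2)"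
    using root eventually_gt_at_top[of n\<^sub>0]
  proof eventually_elim
    case (elim \<nu>)
    have \<nu>: "real \<nu> > 0" and J: "real (\<nu> - n\<^sub>0) = real \<nu> - real n\<^sub>0" using elim by simp_all
    have "b (z \<nu>) ^ (\<nu> - n\<^sub>0) = u \<nu> * e \<nu>" by (simp add: b_def u_def e_def power_mult_distrib)
    moreover have "u \<nu> = v \<nu> / w" using w by (simp add: v_def)
    ultimately have "R (z \<nu>) - 1 = v \<nu> / w * e \<nu> * (R (z \<nu>) - b (z \<nu>))"
      using elim by (simp add: F_def z_def)
    then have "z \<nu> * m / w + \<rho> \<nu> = v \<nu> / w * e \<nu> * (1 - c + \<sigma> \<nu>)"
      by (simp add: \<rho>_def \<sigma>_def)
    then have "z \<nu> * m + \<rho> \<nu> * w = v \<nu> * e \<nu> * (1 - c + \<sigma> \<nu>)"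
      using w by (simp add: field_simps)
    then have "z \<nu> * m = v \<nu> * e \<nu> * (m * \<kappa> + \<sigma> \<nu>) - \<rho> \<nu> * w"
      using m by (simp add: \<kappa>_def)
    then have z_eq: "z \<nu> = (v \<nu> * e \<nu> * (m * \<kappa> + \<sigma> \<nu>) - \<rho> \<nu> * w) / m"
      using m by (simp add: eq_divide_eq)
    have "T\<^sub>1 \<nu> + T\<^sub>2 \<nu> + T\<^sub>3 \<nu> - T\<^sub>4 \<nu> =
       (\<kappa> * v \<nu> * (e \<nu> - 1 - (\<nu> - n\<^sub>0) * z \<nu> * s) + \<kappa> * s * v \<nu> * (\<nu> * z \<nu> - \<kappa> * \<nu> * v \<nu> - n\<^sub>0 * z \<nu>)
         + v \<nu> * e \<nu> * \<sigma> \<nu> / m - \<rho> \<nu> * w / m) / (\<nu> * (v \<nu>)\<^sup>2)"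
      using \<nu> v_pos[of \<nu>] m
      by (simp add: T\<^sub>1_def T\<^sub>2_def T\<^sub>3_def T\<^sub>4_def field_simps power2_eq_square)
    also have "\<kappa> * v \<nu> * (e \<nu> - 1 - (\<nu> - n\<^sub>0) * z \<nu> * s) + \<kappa> * s * v \<nu> * (\<nu> * z \<nu> - \<kappa> * \<nu> * v \<nu> - n\<^sub>0 * z \<nu>)
         + v \<nu> * e \<nu> * \<sigma> \<nu> / m - \<rho> \<nu> * w / m
       = (v \<nu> * e \<nu> * (m * \<kappa> + \<sigma> \<nu>) - \<rho> \<nu> * w) / m - (\<kappa> * v \<nu> + \<kappa>\<^sup>2 * s * \<nu> * (v \<nu>)\<^sup>2)"
      unfolding J using m by (simp add: field_simps power2_eq_square)
    also have "\<dots> = z \<nu> - (\<kappa> * v \<nu> + \<kappa>\<^sup>2 * s * \<nu> * (v \<nu>)\<^sup>2)" using z_eq by simp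
    finally show ?case .
  qed
  ultimately show "(\<lambda>\<nu>. (root \<nu> - (\<kappa> * (w * u \<nu>) + \<kappa>\<^sup>2 * s * \<nu> * (w * u \<nu>)\<^sup>2)) / (\<nu> * (w * u \<nu>)\<^sup>2)) \<longlonglongrightarrow> 0"
    unfolding z_def v_def using Lim_transform_eventually by fastforce
  show "\<forall>\<^sub>F \<nu> in sequentially. \<nu> * (w * u \<nu>)\<^sup>2 \<noteq> 0"
    using eventually_gt_at_top[of 0] by eventually_elim (use w u_pos in \<open>simp add: less_imp_neq[symmetric]\<close>)
qed

end

section \<open>Expansion of the escape rate\<close>

context periodic_point
begin

lemma weight_x_add: "weight x (N + j * p) = weight x N * c ^ j"
proof (induction j)
  case (Suc j)
  define n where "n = N + j * p"
  have n: "n \<ge> 1" using N by (simp add: n_def)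
  have "N + Suc j * p - 1 = (n - 1) + p" using n by (simp add: n_def)
  then have "weight x (N + Suc j * p) = weight x n * (\<Prod>k<p. P (x (n - 1 + k)) (x (Suc (n - 1 + k))))"
    unfolding weight_def by (simp only: prod_lessThan_add mult.assoc)
  then show ?case using Suc by (simp add: prod_period n_def mult_ac)
qed simp

lemma measure_cyl: "n \<ge> 1 \<Longrightarrow> measure \<mu> (cyl P x n) = weight x n"
proof -
  assume n: "n \<ge> 1"
  have "cyl P x n = prefix_set x n \<inter> Sigma_P P" by (auto simp: cyl_def mem_prefix_set)
  moreover have "measure \<mu> (prefix_set x n \<inter> Sigma_P P) = measure \<mu> (prefix_set x n)"
    by (rule finite_measure_eq_AE) (use AE_Sigma in auto)
  ultimately show ?thesis using n by (simp add: measure_prefix)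
qed

lemma integral_\<phi>_pos: "(\<integral>y. \<phi> y \<partial>\<mu>) > 0"
  using integral_ge_const[OF integrable_word_fun[OF \<phi>], of \<phi>\<^sub>0] \<phi>_ge \<phi>\<^sub>0 by force

theorem escape_rate_expansion:
  "\<exists>R :: nat \<Rightarrow> real.
     (\<forall>\<^sub>F \<nu> in sequentially. has_escape_rate P \<mu> (cyl P x (\<nu> * p)) \<phi> (R \<nu>)) \<and>
     (\<lambda>\<nu>. R \<nu> - ((1 - c) / (\<integral>y. \<phi> y \<partial>\<mu>) * measure \<mu> (cyl P x (\<nu> * p))
           + ((1 - c) / (\<integral>y. \<phi> y \<partial>\<mu>))\<^sup>2 * s * real \<nu> * (measure \<mu> (cyl P x (\<nu> * p)))\<^sup>2))
     \<in> o(\<lambda>\<nu>. real \<nu> * (measure \<mu> (cyl P x (\<nu> * p)))\<^sup>2)"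
proof -
  \<comment> \<open>Chosen before \<nu>: one renewal function serves all holes.\<close>
  obtain \<delta> K H R where \<delta>: "\<delta> > 0" and K: "K > 0"
    and H: "\<And>z. 0 \<le> z \<Longrightarrow> z \<le> \<delta> \<Longrightarrow> word_fun N (H z)"
      "\<And>z y. 0 \<le> z \<Longrightarrow> z \<le> \<delta> \<Longrightarrow> 1 \<le> H z y"
      "\<And>z y. 0 \<le> z \<Longrightarrow> z \<le> \<delta> \<Longrightarrow> y \<in> W \<Longrightarrow> H z y = 1"
      "\<And>z y. 0 \<le> z \<Longrightarrow> z \<le> \<delta> \<Longrightarrow> exp (z * \<phi> y) * push P N (H z) y = H z y + (if y \<in> W then R z - 1 else 0)"
    and R: "\<And>z. 0 \<le> z \<Longrightarrow> z \<le> \<delta> \<Longrightarrow> 1 \<le> R z"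
      "\<And>z. 0 \<le> z \<Longrightarrow> z \<le> \<delta> \<Longrightarrow> \<bar>R z - 1 - z * (\<integral>y. \<phi> y \<partial>\<mu>) / weight x N\<bar> \<le> K * z\<^sup>2"
      "continuous_on {0..\<delta>} R"
    by (rule renewal_function) blast
  interpret eq: escape_equation R c s "\<integral>y. \<phi> y \<partial>\<mu>" "weight x N" K \<delta> n\<^sub>0
    by unfold_locales (use c_pos c_less_1 s_pos integral_\<phi>_pos weight_x_pos \<delta> K R in auto)
  have rate: "\<forall>\<^sub>F \<nu> in sequentially. has_escape_rate P \<mu> (cyl P x (\<nu> * p)) \<phi> (eq.root \<nu>)"
    using eq.bounded_le[OF eq.root_bounded] eq.root_equation eq.root_gap[OF q_less_1] eventually_gt_at_top[of n\<^sub>0]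
  proof eventually_elim
    case (elim \<nu>)
    let ?z = "eq.root \<nu>"
    interpret hole: periodic_hole P \<pi> \<mu> \<phi> \<phi>\<^sub>0 x N p n\<^sub>0 \<nu> ?z "R ?z" "H ?z"
      by unfold_locales (use elim H[of ?z] R(1)[of ?z] in auto)
    show ?case
      by (rule hole.escape_rate_hole) (use elim in \<open>simp_all add: hole.J_def eq.b_def\<close>)
  qed
  have measure: "\<forall>\<^sub>F \<nu> in sequentially. measure \<mu> (cyl P x (\<nu> * p)) = weight x N * eq.u \<nu>"
    using eventually_gt_at_top[of n\<^sub>0]
  proof eventually_elim
    case (elim \<nu>)
    have "\<nu> * p = N + (\<nu> - n\<^sub>0) * p" using elim by (simp add: N_eq flip: distrib_right)
    then show ?case using weight_x_add[of "\<nu> - n\<^sub>0"] N by (simp add: measure_cyl eq.u_def)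
  qed
  define m where "m = (\<integral>y. \<phi> y \<partial>\<mu>)"
  define M where "M = (\<lambda>\<nu>. measure \<mu> (cyl P x (\<nu> * p)))"
  have "(\<lambda>\<nu>. eq.root \<nu> - ((1 - c) / m * M \<nu> + ((1 - c) / m)\<^sup>2 * s * \<nu> * (M \<nu>)\<^sup>2)) \<in> o(\<lambda>\<nu>. \<nu> * (M \<nu>)\<^sup>2)"
  proof -
    have 1: "\<forall>\<^sub>F \<nu> in sequentially. eq.root \<nu> - (eq.\<kappa> * (weight x N * eq.u \<nu>) + eq.\<kappa>\<^sup>2 * s * \<nu> * (weight x N * eq.u \<nu>)\<^sup>2)
        = eq.root \<nu> - ((1 - c) / m * M \<nu> + ((1 - c) / m)\<^sup>2 * s * \<nu> * (M \<nu>)\<^sup>2)"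
      using measure by eventually_elim (simp add: M_def m_def eq.\<kappa>_def)
    have 2: "\<forall>\<^sub>F \<nu> in sequentially. \<nu> * (weight x N * eq.u \<nu>)\<^sup>2 = \<nu> * (M \<nu>)\<^sup>2"
      using measure by eventually_elim (simp add: M_def)
    show ?thesis
      using eq.root_expansion unfolding landau_o.small.in_cong[OF 1] landau_o.small.cong[OF 2] .
  qed
  then show ?thesis using rate unfolding M_def m_def by blast
qed

end

theorem theorem7p9:
  fixes P :: "'a::finite \<Rightarrow> 'a \<Rightarrow> real" and \<pi> :: "'a \<Rightarrow> real"
    and \<mu> :: "(nat \<Rightarrow> 'a) measure" and \<beta> :: real
    and x :: "nat \<Rightarrow> 'a" and p :: nat and \<phi> :: "(nat \<Rightarrow> 'a) \<Rightarrow> real"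
  assumes P: "stochastic_irreducible P"
    and \<pi>: "stationary_vector P \<pi>"
    and \<mu>: "markov_measure P \<pi> \<mu>"
    and \<beta>: "\<beta> > 0"
    and x: "x \<in> Sigma_P P"
    and per: "p \<ge> 1" "shiftn p x = x" "\<forall>q. 0 < q \<and> q < p \<longrightarrow> shiftn q x \<noteq> x"
    and red: "reduced_word P x p"
    and loc: "local_escape_rate_exists P \<mu> \<beta> x"
    and ceil: "ceiling_function P \<mu> \<phi>"
    and cylf: "cylinder_function \<phi>"
  shows "\<exists>R :: nat \<Rightarrow> real.
     (\<forall>\<^sub>F \<nu> in sequentially. has_escape_rate P \<mu> (cyl P x (\<nu> * p)) \<phi> (R \<nu>)) \<and>
     (\<lambda>\<nu>. R \<nu>
        - ((1 - (\<Prod>i<p. P (x i) (x (Suc i)))) / integral\<^sup>L \<mu> \<phi> * measure \<mu> (cyl P x (\<nu> * p))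
           + ((1 - (\<Prod>i<p. P (x i) (x (Suc i)))) / integral\<^sup>L \<mu> \<phi>)\<^sup>2 * birkhoff_sum \<phi> p x
             * real \<nu> * (measure \<mu> (cyl P x (\<nu> * p)))\<^sup>2))
     \<in> o(\<lambda>\<nu>. real \<nu> * (measure \<mu> (cyl P x (\<nu> * p)))\<^sup>2)"
proof -
  interpret M: markov_shift P \<pi> \<mu> by unfold_locales (rule P \<pi> \<mu>)+
  obtain n where n: "word_fun n \<phi>" using cylf unfolding cylinder_function_def word_fun_def by blast
  define \<phi>\<^sub>0 where "\<phi>\<^sub>0 = (INF y\<in>Sigma_P P. \<phi> y)"
  have \<phi>\<^sub>0: "\<phi>\<^sub>0 > 0" using ceil by (simp add: ceiling_function_def \<phi>\<^sub>0_def)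
  have "bdd_below (\<phi> ` Sigma_P P)"
    using finite_range_word_fun[OF n] by (intro bdd_below_finite) (meson finite_subset image_mono subset_UNIV)
  then have ge: "\<phi>\<^sub>0 \<le> \<phi> y" if "y \<in> Sigma_P P" for y
    unfolding \<phi>\<^sub>0_def using that by (rule cINF_lower)
  \<comment> \<open>The ceiling is bounded below only on \<open>Sigma_P P\<close>. Truncation makes
    the bound global and changes neither the flow there nor, up to a null set, the
    integrand.\<close>
  define \<psi> where "\<psi> = (\<lambda>y. max (\<phi> y) \<phi>\<^sub>0)"
  have \<psi>: "\<psi> y = \<phi> y" if "y \<in> Sigma_P P" for y using ge[OF that] by (simp add: \<psi>_def)
  have shift: "shiftn j y \<in> Sigma_P P" if "y \<in> Sigma_P P" for j y
    using that by (simp add: Sigma_P_def shiftn_def)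
  have birkhoff: "birkhoff_sum \<psi> j y = birkhoff_sum \<phi> j y" if "y \<in> Sigma_P P" for j y
    using that by (simp add: birkhoff_sum_def \<psi> shift)
  have "special_flow \<psi> t (y, r) = special_flow \<phi> t (y, r)" if "y \<in> Sigma_P P" for t y r
    using that by (simp add: special_flow_def lap_count_def \<psi> birkhoff)
  then have "survivor_set P \<psi> A t = survivor_set P \<phi> A t" for A t
    unfolding survivor_set_def using \<psi> by auto
  then have rate: "has_escape_rate P \<mu> A \<psi> L \<longleftrightarrow> has_escape_rate P \<mu> A \<phi> L" for A L
    by (simp add: has_escape_rate_def)
  have \<psi>_word: "word_fun n \<psi>" unfolding \<psi>_def by (rule word_fun_comp[OF n])
  have integral: "integral\<^sup>L \<mu> \<psi> = integral\<^sup>L \<mu> \<phi>"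
  proof (rule integral_cong_AE)
    show "\<psi> \<in> borel_measurable \<mu>" "\<phi> \<in> borel_measurable \<mu>"
      using M.integrable_word_fun[OF \<psi>_word] M.integrable_word_fun[OF n] by auto
    show "AE y in \<mu>. \<psi> y = \<phi> y" using M.AE_Sigma by eventually_elim (rule \<psi>)
  qed
  \<comment> \<open>A multiple of the period, long enough to determine the ceiling and to contain
    two periods.\<close>
  define N where "N = (n + 2) * p"
  have "n + 2 \<le> N" using mult_le_mono2[OF per(1), of "n + 2"] by (simp add: N_def)
  interpret pp: periodic_point P \<pi> \<mu> \<psi> \<phi>\<^sub>0 x N p "n + 2"
  proof unfold_locales
    show "word_fun N \<psi>" using word_fun_mono[OF \<psi>_word] \<open>n + 2 \<le> N\<close> by simp
  qed (use \<open>n + 2 \<le> N\<close> \<phi>\<^sub>0 x per red in \<open>auto simp: \<psi>_def N_def\<close>)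
  show ?thesis
    using pp.escape_rate_expansion unfolding rate integral pp.c_def pp.s_def birkhoff[OF x] .
qed

end
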